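(* Let $p,q$ be odd positive integers, $m=p+q$, and let $\mu,k,\ell\ge 0$ be integers. Let $P_k(\underline x):\mathbb R^{p}\rightarrow\mathbb{R}_{p}$ and $P_\ell(\underline y):\mathbb R^{q}\rightarrow\mathbb{R}_{q}$ be homogeneous monogenic polynomials of degrees $k$ and $\ell$ respectively. Suppose that $w(z,\overline z)=u(x,y)+iv(x,y)$ (with $u,v$ real-valued) is a $\mathbb C$-valued function satisfying the equation $$\partial_z\Delta_{x,y}^{\mu}w(z,\overline z)=0,\qquad \Delta_{x,y}=\partial_x^2+\partial_y^2,$$ in the open set $\Xi\subset\{(x,y)\in\mathbb R^2:\ x,y>0\}$. Then the functions $$\Delta_{\underline X}^{\mu+k+\ell+\frac{m-2}{2}}\Big[\big(u(r,\rho)+\underline\omega\,\underline\nu\,v(r,\rho)\big)P_k(\underline x)P_\ell(\underline y)\Big]$$ and $$\Delta_{\underline X}^{\mu+k+\ell+\frac{m-2}{2}}\Big[\big(\underline\omega\,u(r,\rho)+\underline\nu\,v(r,\rho)\big)P_k(\underline x)P_\ell(\underline y)\Big]$$ are monogenic in $\Omega=\{\underline X=(\underline x,\underline y)\in\mathbb R^{m}:\ (r,\rho)\in\Xi\}$, where $r=\vert\underline x\vert$, $\rho=\vert\underline y\vert$, $\underline\omega=\underline x/r$, $\underline\nu=\underline y/\rho$.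
   Context: $\mathbb R_m$ denotes the real Clifford algebra generated by the standard basis $e_1,\dots,e_m$ of $\mathbb R^m$, with relations $e_j^2=-1$ and $e_je_k+e_ke_j=0$ for $1\le j\ne k\le m$; it has real dimension $2^m$. Write $\mathbb R^m=\mathbb R^p\oplus\mathbb R^q$ with $p+q=m$; $\mathbb R_p$ and $\mathbb R_q$ denote the subalgebras of $\mathbb R_m$ generated by $\{e_1,\dots,e_p\}$ and $\{e_{p+1},\dots,e_m\}$ respectively. A point of $\mathbb R^m$ is identified with the Clifford vector $\underline X=\underline x+\underline y$, where $\underline x=\sum_{j=1}^p x_je_j$ and $\underline y=\sum_{j=1}^q x_{p+j}e_{p+j}$; $\vert\cdot\vert$ is the Euclidean norm. All products are Clifford products in the order written. The Dirac operators are $\partial_{\underline x}=\sum_{j=1}^p e_j\partial_{x_j}$, $\partial_{\underline y}=\sum_{j=1}^q e_{p+j}\partial_{x_{p+j}}$ and $\partial_{\underline X}=\partial_{\underline x}+\partial_{\underline y}$ (with the $e_j$ multiplying from the left), and $\Delta_{\underline X}=\sum_{j=1}^m\partial_{x_j}^2$ is the Laplacian in $\mathbb R^m$. A continuously differentiable function $F:\Omega\to\mathbb R_m$ on an open set $\Omega\subset\mathbb R^m$ is called (left) monogenic in $\Omega$ if $\partial_{\underline X}F=0$ in $\Omega$; the polynomial $P_k(\underline x)$ is monogenic if $\partial_{\underline x}P_k=0$ on $\mathbb R^p$, and $P_\ell(\underline y)$ is monogenic if $\partial_{\underline y}P_\ell=0$ on $\mathbb R^q$. Here $z=x+iy$ and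 $\partial_z=\frac12(\partial_x-i\partial_y)$. Solutions $w$ of the equation are understood in the classical sense, i.e. $w$ is of class $C^{2\mu+1}$ (such solutions are automatically infinitely differentiable by ellipticity). Polynomials with values in a Clifford algebra are polynomials in the real coordinates with coefficients in that algebra. *)

theory Defs
  imports "HOL-Analysis.Analysis"
begin

section \<open>Real Clifford algebras\<close>

text \<open>
  An element is the family of its coefficients with respect to the basis \<open>e\<^sub>A = e\<^sub>i\<^sub>1 \<cdots> e\<^sub>i\<^sub>r\<close>,
  where \<open>A = {i\<^sub>1 < \<dots> < i\<^sub>r}\<close> ranges over the subsets of the index type.
\<close>

typedef ('n::finite) clifford = "UNIV :: (real ^ ('n set)) set"
  morphisms coeffs Clifford ..

setup_lifting type_definition_clifford

instantiation clifford :: (finite) real_vector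
begin

lift_definition zero_clifford :: "'a clifford" is 0 .
lift_definition plus_clifford :: "'a clifford \<Rightarrow> 'a clifford \<Rightarrow> 'a clifford" is "(+)" .
lift_definition minus_clifford :: "'a clifford \<Rightarrow> 'a clifford \<Rightarrow> 'a clifford" is "(-)" .
lift_definition uminus_clifford :: "'a clifford \<Rightarrow> 'a clifford" is uminus .
lift_definition scaleR_clifford :: "real \<Rightarrow> 'a clifford \<Rightarrow> 'a clifford" is "(*\<^sub>R)" .

instance
proof
  fix a b c :: "'a clifford" and r s :: real
  show "a + b + c = a + (b + c)" by transfer (simp add: add.assoc)
  show "a + b = b + a" by transfer (simp add: add.commute)
  show "0 + a = a" by transfer simp
  show "- a + a = 0" by transfer simp
  show "a - b = a + - b" by transfer simp
  show "r *\<^sub>R (a + b) = r *\<^sub>R a + r *\<^sub>R b" by transfer (simp add: scaleR_add_right)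
  show "(r + s) *\<^sub>R a = r *\<^sub>R a + s *\<^sub>R a" by transfer (simp add: scaleR_add_left)
  show "r *\<^sub>R s *\<^sub>R a = (r * s) *\<^sub>R a" by transfer simp
  show "1 *\<^sub>R a = a" by transfer simp
qed

end

instantiation clifford :: (finite) euclidean_space
begin

lift_definition inner_clifford :: "'a clifford \<Rightarrow> 'a clifford \<Rightarrow> real" is "(\<bullet>)" .
lift_definition norm_clifford :: "'a clifford \<Rightarrow> real" is norm .
lift_definition Basis_clifford :: "'a clifford set" is Basis .

definition sgn_clifford :: "'a clifford \<Rightarrow> 'a clifford"
  where "sgn_clifford x = x /\<^sub>R norm x"

definition dist_clifford :: "'a clifford \<Rightarrow> 'a clifford \<Rightarrow> real"
  where "dist_clifford x y = norm (x - y)"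

definition uniformity_clifford :: "('a clifford \<times> 'a clifford) filter"
  where "uniformity_clifford = (INF e\<in>{0 <..}. principal {(x, y). dist x y < e})"

definition open_clifford :: "'a clifford set \<Rightarrow> bool"
  where "open_clifford U \<longleftrightarrow> (\<forall>x\<in>U. eventually (\<lambda>(x', y). x' = x \<longrightarrow> y \<in> U) uniformity)"

instance
proof
  fix a b c :: "'a clifford" and r :: real
  show "a \<bullet> b = b \<bullet> a" by transfer (simp add: inner_commute)
  show "(a + b) \<bullet> c = a \<bullet> c + b \<bullet> c" by transfer (simp add: inner_add_left)
  show "(r *\<^sub>R a) \<bullet> b = r * (a \<bullet> b)" by transfer simp
  show "0 \<le> a \<bullet> a" by transfer simp
  show "(a \<bullet> a = 0) = (a = 0)" by transfer simp
  show "norm a = sqrt (a \<bullet> a)" by transfer (simp add: norm_eq_sqrt_inner)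
  show "sgn a = a /\<^sub>R norm a" by (rule sgn_clifford_def)
  show "dist a b = norm (a - b)" by (rule dist_clifford_def)
  show "(uniformity :: ('a clifford \<times> 'a clifford) filter) =
      (INF e\<in>{0 <..}. principal {(x, y). dist x y < e})"
    by (rule uniformity_clifford_def)
  show "open U = (\<forall>x\<in>U. eventually (\<lambda>(x', y). x' = x \<longrightarrow> y \<in> U) uniformity)"
    for U :: "'a clifford set" by (rule open_clifford_def)
  show "(Basis :: 'a clifford set) \<noteq> {}" by transfer simp
  show "finite (Basis :: 'a clifford set)" by transfer simp
  show "a \<bullet> b = (if a = b then 1 else 0)" if "a \<in> Basis" "b \<in> Basis"
    using that by transfer (simp add: inner_Basis)
  show "(\<forall>u\<in>Basis. a \<bullet> u = 0) = (a = 0)" by transfer (simp add: euclidean_all_zero_iff)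
qed

end

text \<open>
  \<open>e\<^sub>A e\<^sub>B = \<plusminus> e\<^bsub>A \<triangle> B\<^esub>\<close>: sorting costs one sign for each pair \<open>(a, b) \<in> A \<times> B\<close> with \<open>b < a\<close>, and
  each common generator contributes \<open>e\<^sub>a\<^sup>2 = -1\<close>.
\<close>

definition cliff_sign :: "('n::{finite,linorder}) set \<Rightarrow> 'n set \<Rightarrow> real"
  where "cliff_sign A B = (- 1) ^ card {(a, b). a \<in> A \<and> b \<in> B \<and> b \<le> a}"

lemma cliff_sign_prod:
  "cliff_sign A B = (\<Prod>a\<in>UNIV. \<Prod>b\<in>UNIV. if a \<in> A \<and> b \<in> B \<and> b \<le> a then - 1 else 1)"
proof -
  have "cliff_sign A B = (\<Prod>p\<in>{(a, b). a \<in> A \<and> b \<in> B \<and> b \<le> a}. - 1)"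
    by (simp add: cliff_sign_def)
  also have "\<dots> = (\<Prod>p\<in>UNIV \<times> UNIV. if fst p \<in> A \<and> snd p \<in> B \<and> snd p \<le> fst p then - 1 else 1)"
    by (rule prod.mono_neutral_cong_left) auto
  also have "\<dots> = (\<Prod>a\<in>UNIV. \<Prod>b\<in>UNIV. if a \<in> A \<and> b \<in> B \<and> b \<le> a then - 1 else 1)"
    by (simp add: prod.cartesian_product case_prod_beta)
  finally show ?thesis .
qed

lemma cliff_sign_sym_diff_left:
  "cliff_sign (sym_diff A B) C = cliff_sign A C * cliff_sign B C"
  unfolding cliff_sign_prod prod.distrib[symmetric] by (intro prod.cong) auto

lemma cliff_sign_sym_diff_right:
  "cliff_sign A (sym_diff B C) = cliff_sign A B * cliff_sign A C"
  unfolding cliff_sign_prod prod.distrib[symmetric] by (intro prod.cong) auto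

lemma cliff_sign_empty [simp]: "cliff_sign {} A = 1" "cliff_sign A {} = 1"
  by (simp_all add: cliff_sign_def)

lemma sum_sym_diff_reindex:
  fixes f :: "'n::finite set \<Rightarrow> 'b::comm_monoid_add"
  shows "(\<Sum>B\<in>UNIV. f (sym_diff A B)) = (\<Sum>B\<in>UNIV. f B)"
  by (rule sum.reindex_bij_witness[where i = "sym_diff A" and j = "sym_diff A"]) auto

instantiation clifford :: ("{finite,linorder}") real_algebra_1
begin

lift_definition one_clifford :: "'a clifford" is "axis {} 1" .

lift_definition times_clifford :: "'a clifford \<Rightarrow> 'a clifford \<Rightarrow> 'a clifford"
  is "\<lambda>x y. \<chi> C. \<Sum>A\<in>UNIV. cliff_sign A (sym_diff A C) * x $ A * y $ sym_diff A C" .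

instance
proof
  fix a b c :: "'a clifford" and r :: real
  show "a * b * c = a * (b * c)"
  proof (transfer, rule vec_eq_iff[THEN iffD2], rule allI)
    fix x y z :: "real ^ 'a set" and D :: "'a set"
    let ?s = cliff_sign
    have *: "sym_diff (sym_diff A B) (sym_diff (sym_diff A B) D) = D"
      "sym_diff A (sym_diff A B) = B"
      "sym_diff (sym_diff A B) D = sym_diff B (sym_diff A D)" for A B D :: "'a set"
      by auto
    have "(\<Sum>C\<in>UNIV. ?s C (sym_diff C D) *
          (\<Sum>A\<in>UNIV. ?s A (sym_diff A C) * x $ A * y $ sym_diff A C) * z $ sym_diff C D)
        = (\<Sum>A\<in>UNIV. \<Sum>C\<in>UNIV. ?s C (sym_diff C D) * ?s A (sym_diff A C) *
            x $ A * y $ sym_diff A C * z $ sym_diff C D)"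
      by (subst sum.swap) (simp add: sum_distrib_left sum_distrib_right mult_ac)
    also have "\<dots> = (\<Sum>A\<in>UNIV. \<Sum>B\<in>UNIV. ?s (sym_diff A B) (sym_diff (sym_diff A B) D) *
            ?s A (sym_diff A (sym_diff A B)) *
            x $ A * y $ sym_diff A (sym_diff A B) * z $ sym_diff (sym_diff A B) D)"
      proof (rule sum.cong[OF refl])
      fix A :: "'a set"
      show "(\<Sum>C\<in>UNIV. ?s C (sym_diff C D) * ?s A (sym_diff A C) *
            x $ A * y $ sym_diff A C * z $ sym_diff C D)
          = (\<Sum>B\<in>UNIV. ?s (sym_diff A B) (sym_diff (sym_diff A B) D) *
            ?s A (sym_diff A (sym_diff A B)) *
            x $ A * y $ sym_diff A (sym_diff A B) * z $ sym_diff (sym_diff A B) D)"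
        by (rule sum_sym_diff_reindex[symmetric, where f = "\<lambda>C. ?s C (sym_diff C D) *
              ?s A (sym_diff A C) * x $ A * y $ sym_diff A C * z $ sym_diff C D"])
    qed
    also have "\<dots> = (\<Sum>A\<in>UNIV. \<Sum>B\<in>UNIV. ?s A (sym_diff A D) * ?s B (sym_diff B (sym_diff A D)) *
            x $ A * y $ B * z $ sym_diff B (sym_diff A D))"
    proof (intro sum.cong refl)
      fix A B :: "'a set"
      have sq: "?s A B * ?s A B = 1"
        by (simp add: cliff_sign_def flip: power_add)
      have "?s (sym_diff A B) (sym_diff (sym_diff A B) D) * ?s A B
          = (?s A B * ?s A B) * (?s A (sym_diff A D) * ?s B (sym_diff B (sym_diff A D)))"
        by (simp add: cliff_sign_sym_diff_left cliff_sign_sym_diff_right mult_ac)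
      then show "?s (sym_diff A B) (sym_diff (sym_diff A B) D) * ?s A (sym_diff A (sym_diff A B)) *
            x $ A * y $ sym_diff A (sym_diff A B) * z $ sym_diff (sym_diff A B) D
          = ?s A (sym_diff A D) * ?s B (sym_diff B (sym_diff A D)) *
            x $ A * y $ B * z $ sym_diff B (sym_diff A D)"
        by (simp only: sq *(2,3) mult_1)
    qed
    also have "\<dots> = (\<Sum>A\<in>UNIV. ?s A (sym_diff A D) * x $ A *
          (\<Sum>B\<in>UNIV. ?s B (sym_diff B (sym_diff A D)) * y $ B * z $ sym_diff B (sym_diff A D)))"
      by (simp add: sum_distrib_left mult_ac)
    finally show "(\<chi> C. \<Sum>A\<in>UNIV. ?s A (sym_diff A C) *
          (\<chi> C. \<Sum>A\<in>UNIV. ?s A (sym_diff A C) * x $ A * y $ sym_diff A C) $ A * z $ sym_diff A C) $ D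
        = (\<chi> C. \<Sum>A\<in>UNIV. ?s A (sym_diff A C) * x $ A *
          (\<chi> C. \<Sum>A\<in>UNIV. ?s A (sym_diff A C) * y $ A * z $ sym_diff A C) $ sym_diff A C) $ D"
      by simp
  qed
  show "(a + b) * c = a * c + b * c"
    by transfer (simp add: vec_eq_iff algebra_simps sum.distrib)
  show "a * (b + c) = a * b + a * c"
    by transfer (simp add: vec_eq_iff algebra_simps sum.distrib)
  show "r *\<^sub>R a * b = r *\<^sub>R (a * b)"
    by transfer (simp add: vec_eq_iff sum_distrib_left mult_ac)
  show "a * r *\<^sub>R b = r *\<^sub>R (a * b)"
    by transfer (simp add: vec_eq_iff sum_distrib_left mult_ac)
  show "1 * a = a"
  proof (transfer, rule vec_eq_iff[THEN iffD2], rule allI)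
    fix x :: "real ^ 'a set" and C :: "'a set"
    have "(\<Sum>A\<in>UNIV. cliff_sign A (sym_diff A C) * axis {} 1 $ A * x $ sym_diff A C)
        = (\<Sum>A\<in>(UNIV :: 'a set set). if A = {} then x $ C else 0)"
      by (rule sum.cong) (auto simp: axis_def)
    then show "(\<chi> C. \<Sum>A\<in>UNIV. cliff_sign A (sym_diff A C) * axis {} 1 $ A * x $ sym_diff A C) $ C = x $ C"
      by simp
  qed
  show "a * 1 = a"
  proof (transfer, rule vec_eq_iff[THEN iffD2], rule allI)
    fix x :: "real ^ 'a set" and C :: "'a set"
    have "(\<Sum>A\<in>UNIV. cliff_sign A (sym_diff A C) * x $ A * axis {} 1 $ sym_diff A C)
        = (\<Sum>A\<in>UNIV. if A = C then x $ C else 0)"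
      by (rule sum.cong) (auto simp: axis_def)
    then show "(\<chi> C. \<Sum>A\<in>UNIV. cliff_sign A (sym_diff A C) * x $ A * axis {} 1 $ sym_diff A C) $ C = x $ C"
      by simp
  qed
  show "(0 :: 'a clifford) \<noteq> 1"
    by transfer (simp add: axis_eq_0_iff)
qed

end

lift_definition gen :: "'n::finite \<Rightarrow> 'n clifford" is "\<lambda>j. axis {j} 1" .

lemma gen_mult_gen_nth:
  "coeffs (gen i * gen j) = axis (sym_diff {i} {j}) (cliff_sign {i} {j})"
proof (transfer, rule vec_eq_iff[THEN iffD2], rule allI)
  fix i j :: "'n::{finite,linorder}" and C :: "'n set"
  have "(\<Sum>A\<in>UNIV. cliff_sign A (sym_diff A C) * axis {i} 1 $ A * axis {j} 1 $ sym_diff A C)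
      = (\<Sum>A\<in>UNIV. if A = {i} then cliff_sign {i} {j} * axis {j} 1 $ sym_diff {i} C else 0)"
    by (rule sum.cong) (auto simp: axis_def)
  also have "\<dots> = axis (sym_diff {i} {j}) (cliff_sign {i} {j}) $ C"
  proof -
    have "sym_diff {i} C = {j} \<longleftrightarrow> sym_diff {i} {j} = C" by auto
    then show ?thesis by (simp add: axis_def)
  qed
  finally show "(\<chi> C. \<Sum>A\<in>UNIV. cliff_sign A (sym_diff A C) * axis {i} 1 $ A *
      axis {j} 1 $ sym_diff A C) $ C = axis (sym_diff {i} {j}) (cliff_sign {i} {j}) $ C"
    by simp
qed

lemma gen_square: "gen j * gen j = - 1"
proof -
  have "{(a, b). a = j \<and> b = j \<and> b \<le> a} = {(j, j)}" by auto
  then have "coeffs (gen j * gen j) = coeffs (- 1)"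
    by (simp add: gen_mult_gen_nth cliff_sign_def one_clifford.rep_eq uminus_clifford.rep_eq
        vec_eq_iff axis_def)
  then show ?thesis by (simp add: coeffs_inject)
qed

lemma gen_anticommute:
  assumes "i \<noteq> j" shows "gen i * gen j + gen j * gen i = 0"
proof -
  have "{(a, b). a = i \<and> b = j \<and> b \<le> a} = (if j \<le> i then {(i, j)} else {})" 
    "{(a, b). a = j \<and> b = i \<and> b \<le> a} = (if i \<le> j then {(j, i)} else {})" by auto
  moreover have "sym_diff {i} {j} = {i, j}" "sym_diff {j} {i} = {i, j}" using assms by auto
  ultimately have "coeffs (gen i * gen j + gen j * gen i) = coeffs 0"
    using assms by (auto simp: gen_mult_gen_nth plus_clifford.rep_eq cliff_sign_def
        zero_clifford.rep_eq vec_eq_iff axis_def)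
  then show ?thesis by (simp add: coeffs_inject)
qed

lemma DIM_clifford: "DIM('n::finite clifford) = 2 ^ CARD('n)"
proof -
  have "coeffs ` (Basis :: 'n clifford set) = Basis"
    by (simp add: Basis_clifford_def image_image Clifford_inverse)
  then have "DIM('n clifford) = DIM(real ^ 'n set)"
    by (metis card_image coeffs_inject inj_onI)
  also have "\<dots> = 2 ^ CARD('n)"
    by (simp add: card_Pow flip: Pow_UNIV)
  finally show ?thesis .
qed

text \<open>
  For \<open>m = p + q\<close> the generators are indexed by \<open>'p + 'q\<close>, with \<open>|'p| = p\<close> and \<open>|'q| = q\<close>;
  those of \<open>'p\<close> come first.
\<close>

instantiation sum :: (linorder, linorder) linorder
begin

fun less_eq_sum :: "'a + 'b \<Rightarrow> 'a + 'b \<Rightarrow> bool" where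
  "Inl a \<le> Inl b \<longleftrightarrow> a \<le> b"
| "Inl a \<le> Inr b \<longleftrightarrow> True"
| "Inr a \<le> Inl b \<longleftrightarrow> False"
| "Inr a \<le> Inr b \<longleftrightarrow> a \<le> b"

definition less_sum :: "'a + 'b \<Rightarrow> 'a + 'b \<Rightarrow> bool"
  where "less_sum x y \<longleftrightarrow> x \<le> y \<and> \<not> y \<le> x"

instance
proof
  fix x y z :: "'a + 'b"
  show "(x < y) = (x \<le> y \<and> \<not> y \<le> x)" by (rule less_sum_def)
  show "x \<le> x" by (cases x) auto
  show "x \<le> z" if "x \<le> y" "y \<le> z" using that by (cases x; cases y; cases z) auto
  show "x = y" if "x \<le> y" "y \<le> x" using that by (cases x; cases y) auto
  show "x \<le> y \<or> y \<le> x" by (cases x; cases y) auto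
qed

end

definition subalgebra :: "'a::real_algebra_1 set \<Rightarrow> bool"
  where "subalgebra V \<longleftrightarrow> subspace V \<and> 1 \<in> V \<and> (\<forall>a\<in>V. \<forall>b\<in>V. a * b \<in> V)"

definition cliff_p :: "('p::{finite,linorder} + 'q::{finite,linorder}) clifford set"
  where "cliff_p = subalgebra hull range (\<lambda>j. gen (Inl j))"

definition cliff_q :: "('p::{finite,linorder} + 'q::{finite,linorder}) clifford set"
  where "cliff_q = subalgebra hull range (\<lambda>j. gen (Inr j))"

definition vec_p :: "real ^ 'p \<Rightarrow> ('p::finite + 'q::finite) clifford"
  where "vec_p x = (\<Sum>j\<in>UNIV. x $ j *\<^sub>R gen (Inl j))"

definition vec_q :: "real ^ 'q \<Rightarrow> ('p::finite + 'q::finite) clifford"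
  where "vec_q y = (\<Sum>j\<in>UNIV. y $ j *\<^sub>R gen (Inr j))"


section \<open>Differential operators\<close>

definition pderivative :: "'a::real_normed_vector \<Rightarrow> ('a \<Rightarrow> 'b::real_normed_vector) \<Rightarrow> 'a \<Rightarrow> 'b"
  where "pderivative b f x = vector_derivative (\<lambda>t. f (x + t *\<^sub>R b)) (at 0)"

text \<open>Only used for open \<open>S\<close>: all partial derivatives up to order \<open>n\<close> exist and are continuous on \<open>S\<close>.\<close>

fun C_on :: "nat \<Rightarrow> 'a::euclidean_space set \<Rightarrow> ('a \<Rightarrow> 'b::real_normed_vector) \<Rightarrow> bool" where
  "C_on 0 S f \<longleftrightarrow> continuous_on S f"
| "C_on (Suc n) S f \<longleftrightarrow> continuous_on S f \<and>
    (\<forall>b\<in>Basis. (\<forall>x\<in>S. (\<lambda>t. f (x + t *\<^sub>R b)) differentiable (at 0)) \<and> C_on n S (pderivative b f))"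

definition laplacian :: "('a::euclidean_space \<Rightarrow> 'b::real_normed_vector) \<Rightarrow> 'a \<Rightarrow> 'b"
  where "laplacian f x = (\<Sum>b\<in>Basis. pderivative b (pderivative b f) x)"

definition wirtinger :: "(real \<times> real \<Rightarrow> complex) \<Rightarrow> real \<times> real \<Rightarrow> complex"
  where "wirtinger w z = (pderivative (1, 0) w z - \<i> * pderivative (0, 1) w z) / 2"

definition dirac_p ::
  "((real, 'p) vec \<Rightarrow> ('p::{finite,linorder} + 'q::{finite,linorder}) clifford) \<Rightarrow> (real, 'p) vec \<Rightarrow> ('p + 'q) clifford"
  where "dirac_p F x = (\<Sum>j\<in>UNIV. gen (Inl j) * pderivative (axis j 1) F x)"

definition dirac_q ::
  "((real, 'q) vec \<Rightarrow> ('p::{finite,linorder} + 'q::{finite,linorder}) clifford) \<Rightarrow> (real, 'q) vec \<Rightarrow> ('p + 'q) clifford"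
  where "dirac_q F y = (\<Sum>j\<in>UNIV. gen (Inr j) * pderivative (axis j 1) F y)"

text \<open>\<open>\<real>\<^sup>m = \<real>\<^sup>p \<oplus> \<real>\<^sup>q\<close> is the Euclidean space of pairs.\<close>

definition dirac ::
  "((real, 'p) vec \<times> (real, 'q) vec \<Rightarrow> ('p::{finite,linorder} + 'q::{finite,linorder}) clifford)
    \<Rightarrow> (real, 'p) vec \<times> (real, 'q) vec \<Rightarrow> ('p + 'q) clifford"
  where "dirac F = (\<lambda>(x, y). dirac_p (\<lambda>x'. F (x', y)) x + dirac_q (\<lambda>y'. F (x, y')) y)"

definition monogenic_on ::
  "((real, 'p) vec \<times> (real, 'q) vec) set
    \<Rightarrow> ((real, 'p) vec \<times> (real, 'q) vec \<Rightarrow> ('p::{finite,linorder} + 'q::{finite,linorder}) clifford) \<Rightarrow> bool"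
  where "monogenic_on S F \<longleftrightarrow> open S \<and> C_on 1 S F \<and> (\<forall>X\<in>S. dirac F X = 0)"

text \<open>The zero polynomial counts as homogeneous of every degree.\<close>

definition homogeneous_polynomial ::
  "'b::real_vector set \<Rightarrow> nat \<Rightarrow> (real ^ 'n::finite \<Rightarrow> 'b) \<Rightarrow> bool"
  where "homogeneous_polynomial V k P \<longleftrightarrow>
    (\<exists>c. (\<forall>\<alpha>. c \<alpha> \<in> V) \<and>
      (\<forall>x. P x = (\<Sum>\<alpha> | sum \<alpha> UNIV = k. (\<Prod>j\<in>UNIV. x $ j ^ \<alpha> j) *\<^sub>R c \<alpha>)))"

end

theory Submission
  imports Defs "HOL-Complex_Analysis.Complex_Analysis"
begin

text \<open>
  Write \<open>x\<close>, \<open>y\<close> for the two components of the vector variable, \<open>r = |x|\<close>, \<open>\<rho> = |y|\<close>, and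
  \<open>R = P\<^sub>k(x) P\<^sub>\<ell>(y)\<close>. Both functions of the theorem are sums of two terms \<open>g(r, \<rho>) K\<close>, where \<open>K\<close> is
  \<open>R\<close>, \<open>x y R\<close> (first function) or \<open>x R\<close>, \<open>y R\<close> (second function), and \<open>g\<close> is \<open>u\<close> or \<open>v\<close>, divided by
  \<open>r\<close> if \<open>x\<close> occurs in \<open>K\<close> and by \<open>\<rho>\<close> if \<open>y\<close> occurs. Each \<open>K\<close> is harmonic and homogeneous in \<open>x\<close> and in
  \<open>y\<close>; if the degrees are \<open>k'\<close> and \<open>\<ell>'\<close>, then \<open>\<Delta> (g K) = (L g) K\<close> with
  \<open>L = \<partial>\<^sub>r\<^sup>2 + \<partial>\<^sub>\<rho>\<^sup>2 + (2a/r) \<partial>\<^sub>r + (2b/\<rho>) \<partial>\<^sub>\<rho>\<close>, \<open>2a = p - 1 + 2k'\<close>, \<open>2b = q - 1 + 2\<ell>'\<close>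
  (\<open>laplacian_funpow_axial_lift\<close>). The problem is thereby moved to the plane.

  As \<open>p\<close> and \<open>q\<close> are odd, \<open>s = (p - 1)/2 + k\<close> and \<open>t = (q - 1)/2 + \<ell>\<close> are integers, and the
  exponent of the theorem is \<open>N = \<mu> + s + t\<close>. Put \<open>D1 = (1/r) \<partial>\<^sub>r\<close>, \<open>D2 = (1/\<rho>) \<partial>\<^sub>\<rho>\<close>.
  Raising the weights \<open>(a, b)\<close> by \<open>(s, t)\<close> adds \<open>2s D1 + 2t D2\<close> to \<open>L\<close>. Pulling \<open>D1\<close> out to the
  left of \<open>L\<close> lowers \<open>a\<close> by one, and \<open>D2\<close> lowers \<open>b\<close>. If \<open>f\<close> is annihilated by the power \<open>\<mu> + 1\<close> of the
  unraised operator \<open>L\<^sub>0\<close>, the expansion of the power \<open>N\<close> of the raised one therefore collapses to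
  the single term \<open>c D1\<^sup>s D2\<^sup>t L\<^sub>0\<^sup>\<mu> f\<close>, where \<open>c\<close> does not depend on \<open>f\<close> or on the base weights
  (\<open>axial_funpow_shift\<close>). Moreover division by \<open>r\<close> or \<open>\<rho>\<close> carries weight \<open>0\<close> to weight \<open>1\<close>, so
  that \<open>L\<^sub>0\<^sup>\<mu>\<close> is always computed by the planar Laplacian (\<open>axial_divide_fst\<close>, \<open>axial_divide_snd\<close>).

  Consequently \<open>\<Delta>\<^sup>N\<close> of both functions is expressed by \<open>U = \<Delta>\<^sup>\<mu> u\<close> and \<open>V = \<Delta>\<^sup>\<mu> v\<close>, which satisfy
  the Cauchy-Riemann equations \<open>U\<^sub>r = - V\<^sub>\<rho>\<close>, \<open>V\<^sub>r = U\<^sub>\<rho>\<close>. What remains is to apply the Dirac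
  operator. Monogenicity of \<open>a R + b x y R\<close> and of \<open>a x R + b y R\<close> amounts to first order systems for
  \<open>a\<close> and \<open>b\<close> with the constants \<open>p + 2k = 2s + 1\<close>, \<open>q + 2\<ell> = 2t + 1\<close> (\<open>dirac_even_combination\<close>,
  \<open>dirac_odd_combination\<close>); commuting the radial derivatives with \<open>r \<partial>\<^sub>r + 2s + 1\<close> and
  \<open>\<rho> \<partial>\<^sub>\<rho> + 2t + 1\<close> turns these systems into the Cauchy-Riemann equations
  (\<open>vekua_system_even\<close>, \<open>vekua_system_odd\<close>).

  The computation differentiates \<open>u\<close> and \<open>v\<close> more often than their class \<open>C\<^sup>2\<^sup>\<mu>\<^sup>+\<^sup>1\<close> permits. Smoothness is
  obtained from an explicit local form of the solutions: inverting \<open>\<partial>\<^sub>z\<close> and its conjugate one after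
  the other shows that \<open>w\<close> is a finite sum of terms \<open>cnj z\<^sup>j \<Phi>(z)\<close> and of conjugates of such terms, with
  \<open>\<Phi>\<close> holomorphic (\<open>polyharmonic_representation\<close>).
\<close>

section \<open>Partial derivatives and smooth functions\<close>

lemma pderivative_eqI:
  assumes "(f has_derivative f') (at x)"
  shows "pderivative b f x = f' b"
proof -
  interpret bounded_linear f' using assms by (rule has_derivative_bounded_linear)
  have "((\<lambda>t. x + t *\<^sub>R b) has_derivative (\<lambda>t. t *\<^sub>R b)) (at 0)"
    by (auto intro!: derivative_eq_intros)
  then have "((\<lambda>t. f (x + t *\<^sub>R b)) has_derivative (\<lambda>t. f' (t *\<^sub>R b))) (at 0)"
    using diff_chain_at[of "\<lambda>t. x + t *\<^sub>R b" "\<lambda>t. t *\<^sub>R b" 0 f f'] assms by (simp add: o_def)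
  then have "((\<lambda>t. f (x + t *\<^sub>R b)) has_vector_derivative f' b) (at 0)"
    by (simp add: has_vector_derivative_def scaleR)
  then show ?thesis
    unfolding pderivative_def by (rule vector_derivative_at)
qed

lemma has_derivative_pderivative:
  assumes "f differentiable (at x)"
  shows "(f has_derivative (\<lambda>h. pderivative h f x)) (at x)"
proof -
  from assms obtain f' where f': "(f has_derivative f') (at x)" by (auto simp: differentiable_def)
  then have "f' = (\<lambda>h. pderivative h f x)" using pderivative_eqI[OF f'] by (simp add: fun_eq_iff)
  with f' show ?thesis by simp
qed

lemma pderivative_eq_sum_Basis:
  fixes x :: "'a::euclidean_space"
  assumes "f differentiable (at x)"
  shows "pderivative h f x = (\<Sum>b\<in>Basis. (h \<bullet> b) *\<^sub>R pderivative b f x)"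
proof -
  have "linear (\<lambda>h. pderivative h f x)"
    using has_derivative_pderivative[OF assms] has_derivative_bounded_linear bounded_linear.linear by blast
  then interpret linear "\<lambda>h. pderivative h f x" .
  have "pderivative h f x = pderivative (\<Sum>b\<in>Basis. (h \<bullet> b) *\<^sub>R b) f x"
    by (simp add: euclidean_representation)
  also have "\<dots> = (\<Sum>b\<in>Basis. (h \<bullet> b) *\<^sub>R pderivative b f x)"
    by (simp only: sum scale)
  finally show ?thesis .
qed

lemma pderivative_cong:
  assumes "open S" "x \<in> S" "\<And>y. y \<in> S \<Longrightarrow> f y = g y"
  shows "pderivative b f x = pderivative b g x"
proof -
  have "((\<lambda>t. x + t *\<^sub>R b) \<longlongrightarrow> x) (nhds (0::real))"
    by (auto intro!: tendsto_eq_intros filterlim_ident)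
  then have "\<forall>\<^sub>F t in nhds 0. x + t *\<^sub>R b \<in> S"
    using assms(1,2) by (rule topological_tendstoD)
  then have "\<forall>\<^sub>F t in nhds 0. f (x + t *\<^sub>R b) = g (x + t *\<^sub>R b)"
    by eventually_elim (rule assms(3))
  then show ?thesis
    unfolding pderivative_def by (intro vector_derivative_cong_eq) auto
qed

lemma differentiable_cong_open:
  assumes "open S" "x \<in> S" "\<And>y. y \<in> S \<Longrightarrow> f y = g y" "f differentiable (at x)"
  shows "g differentiable (at x)"
  using assms by (meson differentiable_def has_derivative_transform_within_open)

lemma pderivative_const [simp]: "pderivative b (\<lambda>_. c) x = 0"
  by (rule pderivative_eqI[of _ "\<lambda>_. 0"]) simp

lemma pderivative_add:
  assumes "f differentiable (at x)" "g differentiable (at x)"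
  shows "pderivative b (\<lambda>x. f x + g x) x = pderivative b f x + pderivative b g x"
  using assms[THEN has_derivative_pderivative]
  by (intro pderivative_eqI[where f' = "\<lambda>b. pderivative b f x + pderivative b g x"]) (rule has_derivative_add)

lemma pderivative_diff:
  assumes "f differentiable (at x)" "g differentiable (at x)"
  shows "pderivative b (\<lambda>x. f x - g x) x = pderivative b f x - pderivative b g x"
  using assms[THEN has_derivative_pderivative]
  by (intro pderivative_eqI[where f' = "\<lambda>b. pderivative b f x - pderivative b g x"]) (rule has_derivative_diff)

lemma pderivative_sum:
  assumes "\<And>i. i \<in> I \<Longrightarrow> f i differentiable (at x)"
  shows "pderivative b (\<lambda>x. \<Sum>i\<in>I. f i x) x = (\<Sum>i\<in>I. pderivative b (f i) x)"
  using assms[THEN has_derivative_pderivative]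
  by (intro pderivative_eqI[where f' = "\<lambda>b. \<Sum>i\<in>I. pderivative b (f i) x"]) (rule has_derivative_sum)

lemma pderivative_bounded_linear:
  assumes "bounded_linear T" "f differentiable (at x)"
  shows "pderivative b (\<lambda>x. T (f x)) x = T (pderivative b f x)"
  using bounded_linear.has_derivative[OF assms(1) has_derivative_pderivative[OF assms(2)]]
  by (rule pderivative_eqI)

lemma (in bounded_bilinear) pderivative_prod:
  assumes "f differentiable (at x)" "g differentiable (at x)"
  shows "pderivative b (\<lambda>x. prod (f x) (g x)) x = prod (f x) (pderivative b g x) + prod (pderivative b f x) (g x)"
  using FDERIV[OF assms[THEN has_derivative_pderivative]] by (rule pderivative_eqI)

lemma (in bounded_bilinear) differentiable_prod:
  assumes "f differentiable (at x)" "g differentiable (at x)"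
  shows "(\<lambda>x. prod (f x) (g x)) differentiable (at x)"
  using FDERIV[OF assms[THEN has_derivative_pderivative]] by (auto simp: differentiable_def)

text \<open>
  Total differentiability is required at each order, so that the chain and product rules are
  available for every derivative; mere partial derivatives along the coordinate lines would not
  support them.
\<close>

primrec Ck_on :: "nat \<Rightarrow> 'a::euclidean_space set \<Rightarrow> ('a \<Rightarrow> 'b::real_normed_vector) \<Rightarrow> bool" where
  "Ck_on 0 S f \<longleftrightarrow> continuous_on S f"
| "Ck_on (Suc n) S f \<longleftrightarrow> (\<forall>x\<in>S. f differentiable (at x)) \<and> (\<forall>b\<in>Basis. Ck_on n S (pderivative b f))"

lemma Ck_on_Suc_imp: "Ck_on (Suc n) S f \<Longrightarrow> Ck_on n S f"
proof (induction n arbitrary: f)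
  case 0
  then show ?case
    by (auto intro!: continuous_at_imp_continuous_on differentiable_imp_continuous_within)
qed auto

lemma Ck_on_mono: "m \<le> n \<Longrightarrow> Ck_on n S f \<Longrightarrow> Ck_on m S f"
  by (induction n rule: dec_induct) (blast dest: Ck_on_Suc_imp)+

lemma Ck_on_continuous: "Ck_on n S f \<Longrightarrow> continuous_on S f"
  using Ck_on_mono[of 0 n S f] by simp

lemma Ck_on_cong:
  assumes "open S"
  shows "(\<And>x. x \<in> S \<Longrightarrow> f x = g x) \<Longrightarrow> Ck_on n S f \<Longrightarrow> Ck_on n S g"
proof (induction n arbitrary: f g)
  case 0
  then show ?case by (simp cong: continuous_on_cong)
next
  case (Suc n)
  have "Ck_on n S (pderivative b g)" if "b \<in> Basis" for b
  proof (rule Suc.IH)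
    show "pderivative b f x = pderivative b g x" if "x \<in> S" for x
      using that Suc.prems(1) by (rule pderivative_cong[OF assms])
    show "Ck_on n S (pderivative b f)" using Suc.prems(2) that by simp
  qed
  moreover have "g differentiable (at x)" if "x \<in> S" for x
  proof (rule differentiable_cong_open[OF assms that])
    show "f differentiable (at x)" using Suc.prems(2) that by simp
  qed (rule Suc.prems(1))
  ultimately show ?case by simp
qed

lemma Ck_on_local:
  assumes "\<And>x. x \<in> S \<Longrightarrow> \<exists>T. open T \<and> x \<in> T \<and> Ck_on n T f"
  shows "Ck_on n S f"
  using assms
proof (induction n arbitrary: f)
  case 0
  show ?case
    unfolding Ck_on.simps
  proof (intro continuous_at_imp_continuous_on ballI)
    fix x assume "x \<in> S"
    then obtain T where "open T" "x \<in> T" "continuous_on T f" using 0 by auto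
    then show "isCont f x" by (simp add: continuous_on_eq_continuous_at)
  qed
next
  case (Suc n)
  have "Ck_on n S (pderivative b f)" if "b \<in> Basis" for b
  proof (rule Suc.IH)
    fix x assume "x \<in> S"
    then obtain T where "open T" "x \<in> T" "Ck_on (Suc n) T f" using Suc.prems by blast
    then show "\<exists>T. open T \<and> x \<in> T \<and> Ck_on n T (pderivative b f)" using that by auto
  qed
  moreover have "f differentiable (at x)" if "x \<in> S" for x
    using Suc.prems[OF that] by auto
  ultimately show ?case by simp
qed

lemma Ck_on_subset: "Ck_on n S f \<Longrightarrow> T \<subseteq> S \<Longrightarrow> Ck_on n T f"
  by (induction n arbitrary: f) (auto intro: continuous_on_subset)

lemma Ck_on_const: "Ck_on n S (\<lambda>_. c)"
proof (induction n arbitrary: c)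
  case (Suc n)
  have "pderivative b (\<lambda>_. c) = (\<lambda>_. 0)" for b :: 'a by (simp add: fun_eq_iff)
  with Suc show ?case by simp
qed simp

lemma Ck_on_add:
  assumes "open S"
  shows "Ck_on n S f \<Longrightarrow> Ck_on n S g \<Longrightarrow> Ck_on n S (\<lambda>x. f x + g x)"
proof (induction n arbitrary: f g)
  case (Suc n)
  have "Ck_on n S (pderivative b (\<lambda>x. f x + g x))" if "b \<in> Basis" for b
    by (rule Ck_on_cong[OF assms _ Suc.IH[of "pderivative b f" "pderivative b g"]])
      (use Suc.prems that in \<open>auto simp: pderivative_add\<close>)
  with Suc.prems show ?case by auto
qed (auto intro: continuous_intros)

lemma Ck_on_sum:
  assumes "open S" "\<And>i. i \<in> I \<Longrightarrow> Ck_on n S (f i)"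
  shows "Ck_on n S (\<lambda>x. \<Sum>i\<in>I. f i x)"
  using assms(2) by (induction I rule: infinite_finite_induct) (auto intro: Ck_on_const Ck_on_add[OF assms(1)])

text \<open>
  The Leibniz rule expresses the derivative of a product by products of functions that are one order
  less regular, so induction on the order works for all bilinear products at once: scalars times
  vectors, real and complex products, and products in the Clifford algebra.
\<close>

lemma (in bounded_bilinear) Ck_on_prod:
  assumes "open S"
  shows "Ck_on n S f \<Longrightarrow> Ck_on n S g \<Longrightarrow> Ck_on n S (\<lambda>x. prod (f x) (g x))"
proof (induction n arbitrary: f g)
  case 0
  then show ?case by (auto intro: continuous_on)
next
  case (Suc n)
  have "Ck_on n S (pderivative b (\<lambda>x. prod (f x) (g x)))" if "b \<in> Basis" for b
  proof (rule Ck_on_cong[OF assms])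
    show "Ck_on n S (\<lambda>x. prod (f x) (pderivative b g x) + prod (pderivative b f x) (g x))"
      using Suc.prems that Suc.prems[THEN Ck_on_Suc_imp]
      by (intro Ck_on_add[OF assms] Suc.IH) auto
  qed (use Suc.prems in \<open>auto simp: pderivative_prod\<close>)
  with Suc.prems show ?case by (auto intro: differentiable_prod)
qed

lemma Ck_on_linear:
  assumes "bounded_linear T"
  shows "open S \<Longrightarrow> Ck_on n S f \<Longrightarrow> Ck_on n S (\<lambda>x. T (f x))"
proof (induction n arbitrary: f)
  case 0
  then show ?case by (auto intro: bounded_linear.continuous_on[OF assms])
next
  case (Suc n)
  have "Ck_on n S (pderivative b (\<lambda>x. T (f x)))" if "b \<in> Basis" for b
    by (rule Ck_on_cong[OF Suc.prems(1) _ Suc.IH[OF Suc.prems(1), of "pderivative b f"]])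
      (use Suc.prems that in \<open>auto simp: pderivative_bounded_linear[OF assms]\<close>)
  moreover have "(\<lambda>x. T (f x)) differentiable (at x)" if "x \<in> S" for x
    using Suc.prems that bounded_linear.has_derivative[OF assms] unfolding Ck_on.simps differentiable_def
    by blast
  ultimately show ?case by simp
qed

lemma Ck_on_id: "Ck_on n S (\<lambda>x. x)"
proof (cases n)
  case (Suc m)
  have "pderivative b (\<lambda>x. x) = (\<lambda>_. b)" for b :: 'a
    by (intro ext pderivative_eqI[where f' = "\<lambda>h. h"] has_derivative_ident)
  then show ?thesis using Suc by (simp add: Ck_on_const)
qed simp

lemma Ck_on_bounded_linear:
  assumes "bounded_linear T"
  shows "Ck_on n S T"
  using Ck_on_subset[OF Ck_on_linear[OF assms open_UNIV Ck_on_id]] by simp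

lemma Ck_on_power:
  fixes f :: "'a::euclidean_space \<Rightarrow> 'b::real_normed_algebra_1"
  assumes "open S" "Ck_on n S f"
  shows "Ck_on n S (\<lambda>x. f x ^ k)"
  by (induction k) (auto intro!: Ck_on_const bounded_bilinear.Ck_on_prod[OF bounded_bilinear_mult] assms)

lemma Ck_on_real_prod:
  fixes f :: "'i \<Rightarrow> 'a::euclidean_space \<Rightarrow> real"
  assumes "open S" "\<And>i. i \<in> I \<Longrightarrow> Ck_on n S (f i)"
  shows "Ck_on n S (\<lambda>x. \<Prod>i\<in>I. f i x)"
  using assms(2) by (induction I rule: infinite_finite_induct)
    (auto intro!: Ck_on_const bounded_bilinear.Ck_on_prod[OF bounded_bilinear_mult] assms(1))

lemma Ck_on_inverse:
  fixes f :: "'a::euclidean_space \<Rightarrow> real"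
  assumes "open S" "\<And>x. x \<in> S \<Longrightarrow> f x \<noteq> 0"
  shows "Ck_on n S f \<Longrightarrow> Ck_on n S (\<lambda>x. inverse (f x))"
proof (induction n)
  case 0
  then show ?case using assms(2) by (auto intro: continuous_intros)
next
  case (Suc n)
  have *: "((\<lambda>x. inverse (f x)) has_derivative
      (\<lambda>b. - (inverse (f x) * pderivative b f x * inverse (f x)))) (at x)" if "x \<in> S" for x
    using Suc.prems that assms(2) by (intro Deriv.has_derivative_inverse has_derivative_pderivative) auto
  have "Ck_on n S (pderivative b (\<lambda>x. inverse (f x)))" if "b \<in> Basis" for b
  proof (rule Ck_on_cong[OF assms(1)])
    show "Ck_on n S (\<lambda>x. (- 1) * (inverse (f x) * pderivative b f x * inverse (f x)))"
      using Suc Suc.prems[THEN Ck_on_Suc_imp] that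
      by (intro Ck_on_const bounded_bilinear.Ck_on_prod[OF bounded_bilinear_mult] assms(1)) auto
  qed (use *[THEN pderivative_eqI] in auto)
  moreover have "(\<lambda>x. inverse (f x)) differentiable (at x)" if "x \<in> S" for x
    using *[OF that] unfolding differentiable_def by blast
  ultimately show ?case by simp
qed

definition smooth_on :: "'a::euclidean_space set \<Rightarrow> ('a \<Rightarrow> 'b::real_normed_vector) \<Rightarrow> bool"
  where "smooth_on S f \<longleftrightarrow> (\<forall>n. Ck_on n S f)"

lemma smooth_on_differentiable: "smooth_on S f \<Longrightarrow> x \<in> S \<Longrightarrow> f differentiable (at x)"
  unfolding smooth_on_def by (drule spec[of _ "Suc 0"]) simp

lemma smooth_on_continuous: "smooth_on S f \<Longrightarrow> continuous_on S f"
  unfolding smooth_on_def by (drule spec[of _ 0]) simp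

lemma smooth_on_pderivative: "smooth_on S f \<Longrightarrow> b \<in> Basis \<Longrightarrow> smooth_on S (pderivative b f)"
  unfolding smooth_on_def by (rule allI, drule_tac x = "Suc n" in spec) simp

lemma smooth_on_cong: "open S \<Longrightarrow> (\<And>x. x \<in> S \<Longrightarrow> f x = g x) \<Longrightarrow> smooth_on S f \<Longrightarrow> smooth_on S g"
  unfolding smooth_on_def by (intro allI, erule allE, rule Ck_on_cong)

lemma smooth_on_subset: "smooth_on S f \<Longrightarrow> T \<subseteq> S \<Longrightarrow> smooth_on T f"
  unfolding smooth_on_def by (intro allI, erule allE, rule Ck_on_subset)

lemma smooth_on_const: "smooth_on S (\<lambda>_. c)"
  by (simp add: smooth_on_def Ck_on_const)

lemma smooth_on_bounded_linear: "bounded_linear T \<Longrightarrow> smooth_on S T"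
  by (simp add: smooth_on_def Ck_on_bounded_linear)

lemma smooth_on_linear: "open S \<Longrightarrow> bounded_linear T \<Longrightarrow> smooth_on S f \<Longrightarrow> smooth_on S (\<lambda>x. T (f x))"
  by (simp add: smooth_on_def Ck_on_linear)

lemma smooth_on_add:
  "open S \<Longrightarrow> smooth_on S f \<Longrightarrow> smooth_on S g \<Longrightarrow> smooth_on S (\<lambda>x. f x + g x)"
  by (simp add: smooth_on_def Ck_on_add)

lemma smooth_on_sum:
  "open S \<Longrightarrow> (\<And>i. i \<in> I \<Longrightarrow> smooth_on S (f i)) \<Longrightarrow> smooth_on S (\<lambda>x. \<Sum>i\<in>I. f i x)"
  unfolding smooth_on_def by (intro allI Ck_on_sum) auto

lemma smooth_on_bilinear:
  "open S \<Longrightarrow> bounded_bilinear h \<Longrightarrow> smooth_on S f \<Longrightarrow> smooth_on S g \<Longrightarrow> smooth_on S (\<lambda>x. h (f x) (g x))"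
  by (simp add: smooth_on_def bounded_bilinear.Ck_on_prod)

lemmas smooth_on_mult = smooth_on_bilinear[OF _ bounded_bilinear_mult]
lemmas smooth_on_scaleR = smooth_on_bilinear[OF _ bounded_bilinear_scaleR]

lemma smooth_on_divide:
  fixes f g :: "'a::euclidean_space \<Rightarrow> real"
  assumes "open S" "\<And>x. x \<in> S \<Longrightarrow> g x \<noteq> 0" "smooth_on S f" "smooth_on S g"
  shows "smooth_on S (\<lambda>x. f x / g x)"
  using assms Ck_on_inverse[of S g] unfolding smooth_on_def divide_inverse
  by (intro allI bounded_bilinear.Ck_on_prod[OF bounded_bilinear_mult]) auto

text \<open>
  The mean value theorem is applied along \<open>a\<close> and then along \<open>b\<close>. The second difference is symmetric
  in \<open>a\<close> and \<open>b\<close>, whereas the derivative on the right is not; this is the source of the symmetry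
  of mixed derivatives.
\<close>

lemma second_difference_mvt:
  fixes f :: "'a::real_normed_vector \<Rightarrow> real"
  assumes "h > 0"
    and "\<And>s t. s \<in> {0..h} \<Longrightarrow> t \<in> {0..h} \<Longrightarrow> f differentiable (at (x + s *\<^sub>R a + t *\<^sub>R b))"
    and "\<And>s t. s \<in> {0..h} \<Longrightarrow> t \<in> {0..h} \<Longrightarrow> pderivative a f differentiable (at (x + s *\<^sub>R a + t *\<^sub>R b))"
  obtains s t where "s \<in> {0..h}" "t \<in> {0..h}"
    "f (x + h *\<^sub>R a + h *\<^sub>R b) - f (x + h *\<^sub>R a) - f (x + h *\<^sub>R b) + f x =
      h * h * pderivative b (pderivative a f) (x + s *\<^sub>R a + t *\<^sub>R b)"
proof -
  have line: "((\<lambda>s. g (y + s *\<^sub>R c)) has_real_derivative pderivative c g (y + s *\<^sub>R c)) (at s)"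
    if "g differentiable (at (y + s *\<^sub>R c))" for g :: "'a \<Rightarrow> real" and y c s
  proof -
    have "((\<lambda>s. y + s *\<^sub>R c) has_derivative (\<lambda>s. s *\<^sub>R c)) (at s)"
      by (auto intro!: derivative_eq_intros)
    from diff_chain_at[OF this has_derivative_pderivative[OF that]]
    have "((\<lambda>s. g (y + s *\<^sub>R c)) has_derivative (\<lambda>t. pderivative (t *\<^sub>R c) g (y + s *\<^sub>R c))) (at s)"
      by (simp add: o_def)
    moreover have "pderivative (t *\<^sub>R c) g (y + s *\<^sub>R c) = pderivative c g (y + s *\<^sub>R c) * t" for t
      using linear_cmul[OF bounded_linear.linear[OF has_derivative_bounded_linear[OF has_derivative_pderivative[OF that]]]]
      by simp
    ultimately show ?thesis by (simp add: has_field_derivative_def)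
  qed
  define \<phi> where "\<phi> s = f (x + h *\<^sub>R b + s *\<^sub>R a) - f (x + s *\<^sub>R a)" for s
  define \<phi>' where "\<phi>' s = pderivative a f (x + h *\<^sub>R b + s *\<^sub>R a) - pderivative a f (x + s *\<^sub>R a)" for s
  have "\<exists>s>0. s < h \<and> \<phi> h - \<phi> 0 = (h - 0) * \<phi>' s"
  proof (rule MVT2[OF \<open>h > 0\<close>])
    fix s assume s: "0 \<le> s" "s \<le> h"
    show "(\<phi> has_real_derivative \<phi>' s) (at s)"
      unfolding \<phi>_def \<phi>'_def
      using assms(2)[of s h] assms(2)[of s 0] s \<open>h > 0\<close>
      by (intro DERIV_diff line) (auto simp: ac_simps)
  qed
  then obtain s where s: "s > 0" "s < h" "\<phi> h - \<phi> 0 = h * \<phi>' s" by auto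
  have "\<exists>t>0. t < h \<and> pderivative a f (x + s *\<^sub>R a + h *\<^sub>R b) - pderivative a f (x + s *\<^sub>R a + 0 *\<^sub>R b)
      = (h - 0) * pderivative b (pderivative a f) (x + s *\<^sub>R a + t *\<^sub>R b)"
    by (rule MVT2[OF \<open>h > 0\<close>], rule line) (use assms(3) s in auto)
  then obtain t where t: "t > 0" "t < h" "\<phi>' s = h * pderivative b (pderivative a f) (x + s *\<^sub>R a + t *\<^sub>R b)"
    by (auto simp: \<phi>'_def ac_simps)
  show ?thesis
    by (rule that[of s t]) (use s t in \<open>auto simp: \<phi>_def ac_simps\<close>)
qed

text \<open>
  Both mixed derivatives, at points that depend on the order of \<open>a\<close> and \<open>b\<close>, equal the same second
  difference quotient over a small square at \<open>x\<close>; continuity identifies their limits.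
\<close>

lemma pderivative_commute_real:
  fixes f :: "'a::euclidean_space \<Rightarrow> real"
  assumes S: "open S" "x \<in> S" and f: "Ck_on 2 S f" and ab: "a \<in> Basis" "b \<in> Basis"
  shows "pderivative a (pderivative b f) x = pderivative b (pderivative a f) x"
proof -
  let ?A = "pderivative a (pderivative b f)" and ?B = "pderivative b (pderivative a f)"
  have d: "\<forall>y\<in>S. f differentiable (at y)" "\<forall>y\<in>S. pderivative a f differentiable (at y)"
    "\<forall>y\<in>S. pderivative b f differentiable (at y)"
    and c: "continuous_on S ?A" "continuous_on S ?B"
    using f ab by (auto simp: numeral_2_eq_2)
  have "\<bar>?A x - ?B x\<bar> < e" if "e > 0" for e
  proof -
    have "\<forall>\<^sub>F y in nhds x. y \<in> S \<and> dist (?A y) (?A x) < e / 2 \<and> dist (?B y) (?B x) < e / 2"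
      using c S \<open>e > 0\<close>
      by (intro eventually_conj eventually_nhds_in_open tendstoD)
        (auto simp: continuous_on_eq_continuous_at isCont_def tendsto_at_iff_tendsto_nhds)
    then obtain \<delta> where \<delta>: "\<delta> > 0"
      "\<And>y. dist y x < \<delta> \<Longrightarrow> y \<in> S \<and> dist (?A y) (?A x) < e / 2 \<and> dist (?B y) (?B x) < e / 2"
      unfolding eventually_nhds_metric by blast
    define h where "h = \<delta> / 3"
    have h: "h > 0" using \<delta> by (simp add: h_def)
    have near: "dist (x + s *\<^sub>R c + t *\<^sub>R d) x < \<delta>"
      if "s \<in> {0..h}" "t \<in> {0..h}" "c \<in> Basis" "d \<in> Basis" for s t and c d :: 'a
    proof -
      have "dist (x + s *\<^sub>R c + t *\<^sub>R d) x \<le> norm (s *\<^sub>R c) + norm (t *\<^sub>R d)"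
        using norm_triangle_ineq[of "s *\<^sub>R c" "t *\<^sub>R d"] by (simp only: dist_norm add.assoc add_diff_cancel_left')
      also have "\<dots> \<le> h + h" using that by auto
      also have "\<dots> < \<delta>" using \<delta>(1) by (simp add: h_def)
      finally show ?thesis .
    qed
    obtain s t where 1: "s \<in> {0..h}" "t \<in> {0..h}"
      "f (x + h *\<^sub>R a + h *\<^sub>R b) - f (x + h *\<^sub>R a) - f (x + h *\<^sub>R b) + f x = h * h * ?B (x + s *\<^sub>R a + t *\<^sub>R b)"
      using second_difference_mvt[OF h, of f x a b] d near \<delta>(2) ab by metis
    obtain s' t' where 2: "s' \<in> {0..h}" "t' \<in> {0..h}"
      "f (x + h *\<^sub>R b + h *\<^sub>R a) - f (x + h *\<^sub>R b) - f (x + h *\<^sub>R a) + f x = h * h * ?A (x + s' *\<^sub>R b + t' *\<^sub>R a)"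
      using second_difference_mvt[OF h, of f x b a] d near \<delta>(2) ab by metis
    have "h * h * ?B (x + s *\<^sub>R a + t *\<^sub>R b) = h * h * ?A (x + s' *\<^sub>R b + t' *\<^sub>R a)"
    proof -
      have "x + h *\<^sub>R b + h *\<^sub>R a = x + h *\<^sub>R a + h *\<^sub>R b" by (simp add: ac_simps)
      with 2(3) have "f (x + h *\<^sub>R a + h *\<^sub>R b) - f (x + h *\<^sub>R b) - f (x + h *\<^sub>R a) + f x =
          h * h * ?A (x + s' *\<^sub>R b + t' *\<^sub>R a)" by simp
      with 1(3) show ?thesis by linarith
    qed
    then have "?B (x + s *\<^sub>R a + t *\<^sub>R b) = ?A (x + s' *\<^sub>R b + t' *\<^sub>R a)" using h by simp
    moreover have "dist (?B (x + s *\<^sub>R a + t *\<^sub>R b)) (?B x) < e / 2"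
      "dist (?A (x + s' *\<^sub>R b + t' *\<^sub>R a)) (?A x) < e / 2"
      using \<delta>(2) near 1 2 ab by blast+
    ultimately show ?thesis unfolding dist_real_def by linarith
  qed
  from this[of "\<bar>?A x - ?B x\<bar>"] show ?thesis by fastforce
qed

lemma pderivative_commute:
  fixes f :: "'a::euclidean_space \<Rightarrow> 'b::euclidean_space"
  assumes S: "open S" "x \<in> S" and f: "Ck_on 2 S f" and ab: "a \<in> Basis" "b \<in> Basis"
  shows "pderivative a (pderivative b f) x = pderivative b (pderivative a f) x"
proof (rule euclidean_eqI)
  fix c :: 'b assume "c \<in> Basis"
  let ?T = "\<lambda>y. y \<bullet> c"
  have T: "bounded_linear ?T" by (rule bounded_linear_inner_left)
  have comp: "pderivative a' (pderivative b' (\<lambda>x. ?T (f x))) x = ?T (pderivative a' (pderivative b' f) x)"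
    if "a' \<in> Basis" "b' \<in> Basis" for a' b'
  proof -
    have "pderivative a' (pderivative b' (\<lambda>x. ?T (f x))) x = pderivative a' (\<lambda>x. ?T (pderivative b' f x)) x"
      using f by (intro pderivative_cong[OF S]) (simp add: pderivative_bounded_linear[OF T] numeral_2_eq_2)
    also have "\<dots> = ?T (pderivative a' (pderivative b' f) x)"
      using f S that by (intro pderivative_bounded_linear[OF T]) (auto simp: numeral_2_eq_2)
    finally show ?thesis .
  qed
  show "pderivative a (pderivative b f) x \<bullet> c = pderivative b (pderivative a f) x \<bullet> c"
    using pderivative_commute_real[OF S Ck_on_linear[OF T S(1) f] ab] by (simp add: comp ab)
qed

section \<open>Linear operators on smooth functions\<close>

text \<open>
  Functions are only of interest on \<open>S\<close>, and identities between operators hold only there. The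
  second conjunct (locality) is what permits rewriting under an operator with such an identity.
\<close>

definition smooth_op ::
  "'a::euclidean_space set \<Rightarrow> (('a \<Rightarrow> 'b::real_normed_vector) \<Rightarrow> 'a \<Rightarrow> 'b) \<Rightarrow> bool"
  where "smooth_op S T \<longleftrightarrow>
    (\<forall>f. smooth_on S f \<longrightarrow> smooth_on S (T f)) \<and>
    (\<forall>f g. (\<forall>z\<in>S. f z = g z) \<longrightarrow> (\<forall>z\<in>S. T f z = T g z)) \<and>
    (\<forall>f g a b. smooth_on S f \<longrightarrow> smooth_on S g \<longrightarrow>
      (\<forall>z\<in>S. T (\<lambda>z. a *\<^sub>R f z + b *\<^sub>R g z) z = a *\<^sub>R T f z + b *\<^sub>R T g z))"

lemma smooth_opI:
  assumes "\<And>f. smooth_on S f \<Longrightarrow> smooth_on S (T f)"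
    and "\<And>f g z. (\<And>z. z \<in> S \<Longrightarrow> f z = g z) \<Longrightarrow> z \<in> S \<Longrightarrow> T f z = T g z"
    and "\<And>f g a b z. smooth_on S f \<Longrightarrow> smooth_on S g \<Longrightarrow> z \<in> S \<Longrightarrow>
      T (\<lambda>z. a *\<^sub>R f z + b *\<^sub>R g z) z = a *\<^sub>R T f z + b *\<^sub>R T g z"
  shows "smooth_op S T"
  unfolding smooth_op_def using assms by blast

context
  fixes S :: "'a::euclidean_space set" and T :: "('a \<Rightarrow> 'b::real_normed_vector) \<Rightarrow> 'a \<Rightarrow> 'b"
  assumes T: "smooth_op S T"
begin

lemma smooth_op_smooth: "smooth_on S f \<Longrightarrow> smooth_on S (T f)"
  using T unfolding smooth_op_def by blast

lemma smooth_op_cong: "(\<And>z. z \<in> S \<Longrightarrow> f z = g z) \<Longrightarrow> z \<in> S \<Longrightarrow> T f z = T g z"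
  using T unfolding smooth_op_def by blast

lemma smooth_op_lincomb:
  "smooth_on S f \<Longrightarrow> smooth_on S g \<Longrightarrow> z \<in> S \<Longrightarrow>
    T (\<lambda>z. a *\<^sub>R f z + b *\<^sub>R g z) z = a *\<^sub>R T f z + b *\<^sub>R T g z"
  using T unfolding smooth_op_def by blast

lemma smooth_op_add:
  "smooth_on S f \<Longrightarrow> smooth_on S g \<Longrightarrow> z \<in> S \<Longrightarrow> T (\<lambda>z. f z + g z) z = T f z + T g z"
  using smooth_op_lincomb[of f g z 1 1] by simp

lemma smooth_op_diff:
  "smooth_on S f \<Longrightarrow> smooth_on S g \<Longrightarrow> z \<in> S \<Longrightarrow> T (\<lambda>z. f z - g z) z = T f z - T g z"
  using smooth_op_lincomb[of f g z 1 "-1"] by simp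

lemma smooth_op_scale:
  "smooth_on S f \<Longrightarrow> z \<in> S \<Longrightarrow> T (\<lambda>z. a *\<^sub>R f z) z = a *\<^sub>R T f z"
  using smooth_op_lincomb[of f f z a 0] by simp

lemma smooth_op_eq_0:
  assumes "\<And>z. z \<in> S \<Longrightarrow> f z = 0" "z \<in> S"
  shows "T f z = 0"
proof -
  have "T f z = T (\<lambda>z. 0 *\<^sub>R 0) z" by (rule smooth_op_cong) (use assms in auto)
  also have "\<dots> = 0" using smooth_op_scale[OF smooth_on_const assms(2), of 0 0] by simp
  finally show ?thesis .
qed

end

lemma smooth_op_compose:
  fixes T U :: "('a::euclidean_space \<Rightarrow> 'b::real_normed_vector) \<Rightarrow> 'a \<Rightarrow> 'b"
  assumes T: "smooth_op S T" and U: "smooth_op S U"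
  shows "smooth_op S (\<lambda>f. T (U f))"
proof (rule smooth_opI)
  fix f g :: "'a \<Rightarrow> 'b" and a b :: real and z assume fg: "smooth_on S f" "smooth_on S g" "z \<in> S"
  have "T (U (\<lambda>z. a *\<^sub>R f z + b *\<^sub>R g z)) z = T (\<lambda>z. a *\<^sub>R U f z + b *\<^sub>R U g z) z"
    using smooth_op_lincomb[OF U fg(1,2)] fg(3) by (rule smooth_op_cong[OF T])
  also have "\<dots> = a *\<^sub>R T (U f) z + b *\<^sub>R T (U g) z"
    by (intro smooth_op_lincomb[OF T] smooth_op_smooth[OF U] fg)
  finally show "T (U (\<lambda>z. a *\<^sub>R f z + b *\<^sub>R g z)) z = \<dots>" .
qed (use smooth_op_smooth[OF T] smooth_op_smooth[OF U] in blast,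
    blast intro: smooth_op_cong[OF T] smooth_op_cong[OF U])

lemma smooth_op_ident: "smooth_op S (\<lambda>f. f)"
  by (rule smooth_opI) auto

lemma smooth_op_funpow:
  assumes "smooth_op S T"
  shows "smooth_op S (T ^^ n)"
proof (induction n)
  case 0
  show ?case using smooth_op_ident by (simp add: id_def)
next
  case (Suc n)
  show ?case using smooth_op_compose[OF assms Suc] by (simp add: o_def)
qed

lemma smooth_op_plus:
  fixes T U :: "('a::euclidean_space \<Rightarrow> 'b::real_normed_vector) \<Rightarrow> 'a \<Rightarrow> 'b"
  assumes "open S" and T: "smooth_op S T" and U: "smooth_op S U"
  shows "smooth_op S (\<lambda>f z. T f z + U f z)"
proof (rule smooth_opI)
  fix f g :: "'a \<Rightarrow> 'b" and z assume "\<And>z. z \<in> S \<Longrightarrow> f z = g z" "z \<in> S"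
  then show "T f z + U f z = T g z + U g z"
    using smooth_op_cong[OF T, of f g z] smooth_op_cong[OF U, of f g z] by simp
qed (use assms smooth_op_smooth in \<open>auto intro!: smooth_on_add
    simp: smooth_op_lincomb[OF T] smooth_op_lincomb[OF U] algebra_simps\<close>)

lemma smooth_op_sum:
  assumes "open S" "\<And>i. i \<in> I \<Longrightarrow> smooth_op S (T i)"
  shows "smooth_op S (\<lambda>f z. \<Sum>i\<in>I. T i f z)"
  using assms(2)
proof (induction I rule: infinite_finite_induct)
  case (insert i I)
  then show ?case by (simp add: smooth_op_plus[OF assms(1)])
qed (auto intro!: smooth_opI smooth_on_const)

lemma smooth_op_pderivative:
  fixes S :: "'a::euclidean_space set"
  assumes "open S" "b \<in> Basis"
  shows "smooth_op S (pderivative b :: ('a \<Rightarrow> 'b::real_normed_vector) \<Rightarrow> 'a \<Rightarrow> 'b)"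
proof (rule smooth_opI)
  fix f g :: "'a \<Rightarrow> 'b" and u v z assume fg: "smooth_on S f" "smooth_on S g" "z \<in> S"
  have d: "f differentiable (at z)" "g differentiable (at z)"
    using fg by (auto intro: smooth_on_differentiable)
  have d': "(\<lambda>x. u *\<^sub>R h x) differentiable (at z)" if "h differentiable (at z)" for u and h :: "'a \<Rightarrow> 'b"
    using bounded_linear.has_derivative[OF bounded_linear_scaleR_right] that
    unfolding differentiable_def by blast
  show "pderivative b (\<lambda>z. u *\<^sub>R f z + v *\<^sub>R g z) z = u *\<^sub>R pderivative b f z + v *\<^sub>R pderivative b g z"
    by (simp add: pderivative_add d d' pderivative_bounded_linear[OF bounded_linear_scaleR_right])
qed (use assms in \<open>auto intro: smooth_on_pderivative pderivative_cong\<close>)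

lemma smooth_op_mult:
  fixes c :: "'a::euclidean_space \<Rightarrow> real"
  assumes "open S" "smooth_on S c"
  shows "smooth_op S (\<lambda>f z. c z *\<^sub>R f z)"
  by (rule smooth_opI) (auto intro: smooth_on_scaleR assms simp: algebra_simps)

text \<open>
  All commutation rules below have the form \<open>A T = T B\<close>, where \<open>A\<close> and \<open>B\<close> belong to one family of
  operators with different parameters.
\<close>

lemma smooth_op_intertwine_funpow:
  assumes "smooth_op S A" "smooth_op S B" "smooth_op S T"
    and comm: "\<And>f z. smooth_on S f \<Longrightarrow> z \<in> S \<Longrightarrow> A (T f) z = T (B f) z"
    and f: "smooth_on S f" and "z \<in> S"
  shows "(A ^^ n) (T f) z = T ((B ^^ n) f) z"
  using \<open>z \<in> S\<close>
proof (induction n arbitrary: z)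
  case (Suc n)
  have "(A ^^ Suc n) (T f) z = A (T ((B ^^ n) f)) z"
    using smooth_op_cong[OF assms(1) Suc.IH Suc.prems] by simp
  also have "\<dots> = T ((B ^^ Suc n) f) z"
    using comm[OF smooth_op_smooth[OF smooth_op_funpow[OF assms(2)] f] Suc.prems] by simp
  finally show ?case .
qed simp

section \<open>Bessel operators away from the coordinate hyperplanes\<close>

text \<open>
  The derivative with respect to half the square of the coordinate \<open>z \<bullet> b\<close>.
\<close>

definition rderiv :: "'a::euclidean_space \<Rightarrow> ('a \<Rightarrow> real) \<Rightarrow> 'a \<Rightarrow> real"
  where "rderiv b f z = pderivative b f z / (z \<bullet> b)"

text \<open>
  For \<open>2 a = n - 1\<close> this is the Laplacian of \<open>\<real>\<^sup>n\<close> on functions of the norm, the coordinate \<open>z \<bullet> b\<close>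
  being the norm.
\<close>

definition bessel :: "'a::euclidean_space \<Rightarrow> real \<Rightarrow> ('a \<Rightarrow> real) \<Rightarrow> 'a \<Rightarrow> real"
  where "bessel b a f z = pderivative b (pderivative b f) z + 2 * a * rderiv b f z"

context
  fixes S :: "'a::euclidean_space set"
  assumes S: "open S" and nonzero: "\<And>z b. z \<in> S \<Longrightarrow> b \<in> Basis \<Longrightarrow> z \<bullet> b \<noteq> 0"
begin

lemma smooth_on_coordinate: "smooth_on S (\<lambda>z. z \<bullet> b)"
  by (rule smooth_on_bounded_linear) (rule bounded_linear_inner_left)

lemma smooth_op_divide:
  assumes "b \<in> Basis"
  shows "smooth_op S (\<lambda>f z. f z / (z \<bullet> b) :: real)"
  using smooth_op_mult[OF S, of "\<lambda>z. 1 / (z \<bullet> b)", where 'b = real] assms nonzero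
  by (simp add: smooth_on_divide[OF S] smooth_on_const smooth_on_coordinate)

lemma smooth_op_rderiv:
  assumes "b \<in> Basis"
  shows "smooth_op S (rderiv b)"
  using smooth_op_compose[OF smooth_op_divide[OF assms] smooth_op_pderivative[OF S assms]]
  by (simp add: rderiv_def[abs_def])

lemma smooth_op_bessel:
  assumes "b \<in> Basis"
  shows "smooth_op S (bessel b a)"
proof -
  have "smooth_op S (\<lambda>f z. pderivative b (pderivative b f) z + (2 * a) *\<^sub>R rderiv b f z)"
    using assms by (intro smooth_op_plus[OF S] smooth_op_compose[OF smooth_op_pderivative]
        smooth_op_compose[OF smooth_op_mult[OF S, of "\<lambda>_. 2 * a"]] smooth_on_const
        smooth_op_pderivative smooth_op_rderiv S)
  then show ?thesis by (simp add: bessel_def[abs_def])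
qed

lemma pderivative_divide_coordinate:
  fixes f :: "'a \<Rightarrow> real"
  assumes "smooth_on S f" "z \<in> S" "b \<in> Basis" "c \<in> Basis"
  shows "pderivative c (\<lambda>z. f z / (z \<bullet> b)) z =
    pderivative c f z / (z \<bullet> b) - (if c = b then f z / (z \<bullet> b)\<^sup>2 else 0)"
proof -
  have nz: "z \<bullet> b \<noteq> 0" using nonzero assms by blast
  have "((\<lambda>z. f z / (z \<bullet> b)) has_derivative
      (\<lambda>h. - f z * (inverse (z \<bullet> b) * (h \<bullet> b) * inverse (z \<bullet> b)) + pderivative h f z / (z \<bullet> b))) (at z)"
    using nz by (intro has_derivative_divide has_derivative_pderivative
        smooth_on_differentiable[OF assms(1,2)] bounded_linear_imp_has_derivative bounded_linear_inner_left)
  then have "pderivative c (\<lambda>z. f z / (z \<bullet> b)) z =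
      - f z * (inverse (z \<bullet> b) * (c \<bullet> b) * inverse (z \<bullet> b)) + pderivative c f z / (z \<bullet> b)"
    by (rule pderivative_eqI)
  then show ?thesis
    using nz assms by (cases "c = b") (simp_all add: inner_Basis field_simps power2_eq_square)
qed

lemma pderivative_rderiv:
  assumes "smooth_on S f" "z \<in> S" "b \<in> Basis"
  shows "pderivative b (rderiv b f) z = pderivative b (pderivative b f) z / (z \<bullet> b) - pderivative b f z / (z \<bullet> b)\<^sup>2"
  using pderivative_divide_coordinate[OF smooth_on_pderivative[OF assms(1,3)] assms(2,3,3)]
  by (simp add: rderiv_def[abs_def])

lemma pderivative_rderiv_commute:
  assumes "smooth_on S f" "z \<in> S" "b \<in> Basis" "c \<in> Basis" "b \<noteq> c"
  shows "pderivative c (rderiv b f) z = rderiv b (pderivative c f) z"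
  using pderivative_divide_coordinate[OF smooth_on_pderivative[OF assms(1,3)] assms(2,3,4)] assms(5)
    pderivative_commute[OF S assms(2) _ assms(3,4), of f] assms(1)
  by (simp add: rderiv_def[abs_def] smooth_on_def)

lemma rderiv_commute:
  assumes "smooth_on S f" "z \<in> S" "b \<in> Basis" "c \<in> Basis"
  shows "rderiv c (rderiv b f) z = rderiv b (rderiv c f) z"
proof (cases "b = c")
  case False
  have "rderiv c (rderiv b f) z = rderiv b (pderivative c f) z / (z \<bullet> c)"
    using pderivative_rderiv_commute[OF assms False] by (simp add: rderiv_def)
  also have "\<dots> = pderivative b (\<lambda>z. pderivative c f z / (z \<bullet> c)) z / (z \<bullet> b)"
    using pderivative_divide_coordinate[OF smooth_on_pderivative[OF assms(1,4)] assms(2,4,3)] False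
    by (simp add: rderiv_def)
  finally show ?thesis by (simp add: rderiv_def[abs_def])
qed simp

text \<open>
  A radial derivative raises the dimension by two: it maps radial functions on \<open>\<real>\<^sup>n\<close> to radial
  functions on \<open>\<real>\<^sup>n\<^sup>+\<^sup>2\<close> and intertwines the Laplacians.
\<close>

lemma bessel_rderiv_same:
  assumes f: "smooth_on S f" and z: "z \<in> S" and b: "b \<in> Basis"
  shows "bessel b (a + 1) (rderiv b f) z = rderiv b (bessel b a f) z"
proof -
  let ?d = "pderivative b"
  note sm = smooth_on_pderivative[OF _ b]
  note div = smooth_op_smooth[OF smooth_op_divide[OF b]]
  have nz: "z \<bullet> b \<noteq> 0" using nonzero z b by blast
  have dr: "?d (rderiv b f) y = ?d (?d f) y / (y \<bullet> b) - ?d f y / (y \<bullet> b) / (y \<bullet> b)" if "y \<in> S" for y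
    using pderivative_rderiv[OF f that b] by (simp add: power2_eq_square)
  have "?d (?d (rderiv b f)) z = ?d (\<lambda>y. ?d (?d f) y / (y \<bullet> b) - ?d f y / (y \<bullet> b) / (y \<bullet> b)) z"
    by (rule pderivative_cong[OF S z dr])
  also have "\<dots> = ?d (\<lambda>y. ?d (?d f) y / (y \<bullet> b)) z - ?d (\<lambda>y. ?d f y / (y \<bullet> b) / (y \<bullet> b)) z"
    by (intro smooth_op_diff[OF smooth_op_pderivative[OF S b]] div sm f z)
  also have "\<dots> = ?d (?d (?d f)) z / (z \<bullet> b) - ?d (?d f) z / (z \<bullet> b)\<^sup>2 -
      ((?d (?d f) z / (z \<bullet> b) - ?d f z / (z \<bullet> b)\<^sup>2) / (z \<bullet> b) - ?d f z / (z \<bullet> b) / (z \<bullet> b)\<^sup>2)"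
    by (simp add: pderivative_divide_coordinate z b div sm f del: divide_divide_eq_left)
  finally have 1: "?d (?d (rderiv b f)) z = \<dots>" .
  have 2: "?d (bessel b a f) z = ?d (?d (?d f)) z + 2 * a * ?d (rderiv b f) z"
    using smooth_op_lincomb[OF smooth_op_pderivative[OF S b] sm[OF sm[OF f]]
        smooth_op_smooth[OF smooth_op_rderiv[OF b] f] z, of 1 "2 * a"]
    by (simp add: bessel_def[abs_def])
  show ?thesis
    unfolding bessel_def[of b "a + 1"] rderiv_def[of b "bessel b a f"] rderiv_def[of b "rderiv b f"] 1 2 dr[OF z]
    using nz by (simp add: field_simps power2_eq_square)
qed

lemma bessel_rderiv_other:
  assumes f: "smooth_on S f" and z: "z \<in> S" and b: "b \<in> Basis" "c \<in> Basis" "b \<noteq> c"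
  shows "bessel c a (rderiv b f) z = rderiv b (bessel c a f) z"
proof -
  let ?d = "pderivative c"
  note sm = smooth_on_pderivative[OF _ b(2)]
  have "?d (?d (rderiv b f)) z = ?d (rderiv b (?d f)) z"
    by (rule pderivative_cong[OF S z]) (rule pderivative_rderiv_commute[OF f _ b])
  also have "\<dots> = rderiv b (?d (?d f)) z"
    by (rule pderivative_rderiv_commute[OF sm[OF f] z b])
  finally have "bessel c a (rderiv b f) z = rderiv b (?d (?d f)) z + 2 * a * rderiv b (rderiv c f) z"
    using rderiv_commute[OF f z b(1,2)] by (simp add: bessel_def)
  also have "\<dots> = rderiv b (bessel c a f) z"
    using smooth_op_lincomb[OF smooth_op_rderiv[OF b(1)] sm[OF sm[OF f]]
        smooth_op_smooth[OF smooth_op_rderiv[OF b(2)] f] z, of 1 "2 * a"]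
    by (simp add: bessel_def[abs_def])
  finally show ?thesis .
qed

text \<open>
  The classical relation between dimensions one and three: \<open>f(r)\<close> solves \<open>f'' = 0\<close> if and only if
  \<open>f(r)/r\<close> is harmonic in \<open>\<real>\<^sup>3\<close>.
\<close>

lemma bessel_divide_same:
  assumes f: "smooth_on S f" and z: "z \<in> S" and b: "b \<in> Basis"
  shows "bessel b 1 (\<lambda>z. f z / (z \<bullet> b)) z = bessel b 0 f z / (z \<bullet> b)"
proof -
  let ?d = "pderivative b"
  note sm = smooth_on_pderivative[OF _ b]
  note div = smooth_op_smooth[OF smooth_op_divide[OF b]]
  have nz: "z \<bullet> b \<noteq> 0" using nonzero z b by blast
  have d1: "?d (\<lambda>z. f z / (z \<bullet> b)) y = ?d f y / (y \<bullet> b) - f y / (y \<bullet> b) / (y \<bullet> b)" if "y \<in> S" for y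
    using pderivative_divide_coordinate[OF f that b b] by (simp add: power2_eq_square)
  have "?d (?d (\<lambda>z. f z / (z \<bullet> b))) z = ?d (\<lambda>y. ?d f y / (y \<bullet> b) - f y / (y \<bullet> b) / (y \<bullet> b)) z"
    by (rule pderivative_cong[OF S z d1])
  also have "\<dots> = ?d (\<lambda>y. ?d f y / (y \<bullet> b)) z - ?d (\<lambda>y. f y / (y \<bullet> b) / (y \<bullet> b)) z"
    by (intro smooth_op_diff[OF smooth_op_pderivative[OF S b]] div sm f z)
  also have "\<dots> = ?d (?d f) z / (z \<bullet> b) - ?d f z / (z \<bullet> b)\<^sup>2 -
      ((?d f z / (z \<bullet> b) - f z / (z \<bullet> b)\<^sup>2) / (z \<bullet> b) - f z / (z \<bullet> b) / (z \<bullet> b)\<^sup>2)"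
    by (simp add: pderivative_divide_coordinate z b div sm f del: divide_divide_eq_left)
  finally have 1: "?d (?d (\<lambda>z. f z / (z \<bullet> b))) z = \<dots>" .
  show ?thesis
    using nz by (simp add: bessel_def rderiv_def d1[OF z] 1 field_simps power2_eq_square)
qed

lemma bessel_divide_other:
  assumes f: "smooth_on S f" and z: "z \<in> S" and b: "b \<in> Basis" "c \<in> Basis" "b \<noteq> c"
  shows "bessel c a (\<lambda>z. f z / (z \<bullet> b)) z = bessel c a f z / (z \<bullet> b)"
proof -
  let ?d = "pderivative c"
  note sm = smooth_on_pderivative[OF _ b(2)]
  have d1: "?d (\<lambda>z. g z / (z \<bullet> b)) y = ?d g y / (y \<bullet> b)" if "smooth_on S g" "y \<in> S" for g y
    using pderivative_divide_coordinate[OF that b(1,2)] b(3) by simp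
  have "?d (?d (\<lambda>z. f z / (z \<bullet> b))) z = ?d (\<lambda>y. ?d f y / (y \<bullet> b)) z"
    by (rule pderivative_cong[OF S z d1[OF f]])
  also have "\<dots> = ?d (?d f) z / (z \<bullet> b)" by (rule d1[OF sm[OF f] z])
  finally show ?thesis
    by (simp add: bessel_def rderiv_def d1[OF f z] add_divide_distrib)
qed

text \<open>
  The operator \<open>rderiv b\<close> lowers the degree in the coordinate \<open>r = z \<bullet> b\<close> by two, so it shifts
  \<open>r \<partial>\<^sub>r\<close> by two; the constant term is chosen to absorb the shift.
\<close>

lemma euler_rderiv_same:
  assumes f: "smooth_on S f" and z: "z \<in> S" and b: "b \<in> Basis"
  shows "(z \<bullet> b) * pderivative b (rderiv b f) z + (2 * real (Suc s) + 1) * rderiv b f z =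
    rderiv b (\<lambda>z. (z \<bullet> b) * pderivative b f z + (2 * real s + 1) * f z) z"
proof -
  have nz: "z \<bullet> b \<noteq> 0" using nonzero z b by blast
  have "((\<lambda>z. (z \<bullet> b) * pderivative b f z + (2 * real s + 1) * f z) has_derivative
      (\<lambda>h. ((z \<bullet> b) * pderivative h (pderivative b f) z + (h \<bullet> b) * pderivative b f z) +
        (2 * real s + 1) * pderivative h f z)) (at z)"
    by (intro has_derivative_add has_derivative_mult has_derivative_mult_right has_derivative_pderivative
        smooth_on_differentiable[OF _ z] smooth_on_pderivative f b bounded_linear_imp_has_derivative
        bounded_linear_inner_left)
  from pderivative_eqI[OF this, of b] show ?thesis
    using nz b by (simp add: rderiv_def[of b "\<lambda>z. _ z + _ z"] pderivative_rderiv[OF f z b] rderiv_def[of b f]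
        inner_Basis field_simps power2_eq_square)
qed

lemma euler_rderiv_other:
  assumes f: "smooth_on S f" and z: "z \<in> S" and b: "b \<in> Basis" "c \<in> Basis" "b \<noteq> c"
  shows "(z \<bullet> b) * pderivative b (rderiv c f) z + k * rderiv c f z =
    rderiv c (\<lambda>z. (z \<bullet> b) * pderivative b f z + k * f z) z"
proof -
  have "((\<lambda>z. (z \<bullet> b) * pderivative b f z + k * f z) has_derivative
      (\<lambda>h. ((z \<bullet> b) * pderivative h (pderivative b f) z + (h \<bullet> b) * pderivative b f z) +
        k * pderivative h f z)) (at z)"
    by (intro has_derivative_add has_derivative_mult has_derivative_mult_right has_derivative_pderivative
        smooth_on_differentiable[OF _ z] smooth_on_pderivative f b bounded_linear_imp_has_derivative
        bounded_linear_inner_left)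
  from pderivative_eqI[OF this, of c] show ?thesis
    using b pderivative_rderiv_commute[OF f z b(2,1) b(3)[symmetric]]
      pderivative_commute[OF S z _ b(1,2), of f] f
    by (simp add: rderiv_def inner_Basis smooth_on_def add_divide_distrib)
qed

lemma euler_divide:
  fixes f :: "'a \<Rightarrow> real"
  assumes f: "smooth_on S f" and z: "z \<in> S" and b: "b \<in> Basis"
  shows "(z \<bullet> b) * pderivative b (\<lambda>z. f z / (z \<bullet> b)) z + f z / (z \<bullet> b) = pderivative b f z"
  using nonzero[OF z b] by (simp add: pderivative_divide_coordinate[OF f z b b] field_simps power2_eq_square)

lemma smooth_op_rderivs:
  assumes "b \<in> Basis" "c \<in> Basis"
  shows "smooth_op S (\<lambda>h. (rderiv b ^^ s) ((rderiv c ^^ t) h))"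
  by (intro smooth_op_compose[of S "rderiv b ^^ s" "rderiv c ^^ t"] smooth_op_funpow smooth_op_rderiv assms)

lemma rderivs_commute:
  assumes f: "smooth_on S f" and z: "z \<in> S" and b: "b \<in> Basis" "c \<in> Basis"
  shows "(rderiv b ^^ s) ((rderiv c ^^ t) f) z = (rderiv c ^^ t) ((rderiv b ^^ s) f) z"
proof -
  note D = smooth_op_rderiv[OF b(1)] smooth_op_rderiv[OF b(2)]
  have "(rderiv c ^^ t) (rderiv b g) y = rderiv b ((rderiv c ^^ t) g) y" if "smooth_on S g" "y \<in> S" for g y
    using rderiv_commute[OF _ _ b] by (rule smooth_op_intertwine_funpow[OF D(2) D(2) D(1) _ that])
  then show ?thesis
    by (intro smooth_op_intertwine_funpow[OF D(1) D(1) smooth_op_funpow[OF D(2)] _ f z]) simp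
qed

text \<open>
  The first order operators \<open>r \<partial>\<^sub>r + (2 s + 1)\<close> arise when the Dirac operator acts on a product with the
  vector variable. Moved through \<open>s\<close> radial derivatives they become \<open>r \<partial>\<^sub>r + 1\<close>, which undoes the
  division by \<open>r\<close> up to a plain derivative.
\<close>

lemma euler_rderivs:
  assumes f: "smooth_on S f" and z: "z \<in> S" and b: "b \<in> Basis" "c \<in> Basis" "b \<noteq> c"
  shows "(z \<bullet> b) * pderivative b ((rderiv b ^^ s) ((rderiv c ^^ t) (\<lambda>z. f z / (z \<bullet> b)))) z
      + (2 * real s + 1) * (rderiv b ^^ s) ((rderiv c ^^ t) (\<lambda>z. f z / (z \<bullet> b))) z
    = (rderiv b ^^ s) ((rderiv c ^^ t) (pderivative b f)) z"
proof -
  define E where "E k f z = (z \<bullet> b) * pderivative b f z + (2 * real k + 1) * f z" for k f and z :: 'a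
  note D = smooth_op_rderiv[OF b(1)] smooth_op_rderiv[OF b(2)]
  have E: "smooth_op S (E k)" for k
    unfolding E_def
    using smooth_op_mult[OF S smooth_on_const[of S "2 * real k + 1"], where 'b = real]
      smooth_op_compose[OF smooth_op_mult[OF S smooth_on_coordinate]
        smooth_op_pderivative[OF S b(1)], of b, where 'b = real]
    by (intro smooth_op_plus[OF S]) (simp_all add: E_def)
  have same: "E k ((rderiv b ^^ k) g) z = (rderiv b ^^ k) (E 0 g) z" if "smooth_on S g" "z \<in> S" for k g z
    using that(2)
  proof (induction k arbitrary: z)
    case (Suc k)
    have "E (Suc k) (rderiv b ((rderiv b ^^ k) g)) z = rderiv b (E k ((rderiv b ^^ k) g)) z"
      unfolding E_def
      by (rule euler_rderiv_same[OF smooth_op_smooth[OF smooth_op_funpow[OF D(1)] that(1)] Suc.prems b(1)])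
    also have "\<dots> = rderiv b ((rderiv b ^^ k) (E 0 g)) z"
      using Suc.IH Suc.prems by (rule smooth_op_cong[OF D(1)])
    finally show ?case by simp
  qed simp
  have other: "(rderiv c ^^ t) (E 0 g) z = E 0 ((rderiv c ^^ t) g) z" if "smooth_on S g" "z \<in> S" for g z
    by (rule smooth_op_intertwine_funpow[OF D(2) D(2) E _ that])
      (simp add: E_def[abs_def] euler_rderiv_other[OF _ _ b, where k = 1, simplified])
  let ?g = "\<lambda>z. f z / (z \<bullet> b)"
  have g: "smooth_on S ?g" by (rule smooth_op_smooth[OF smooth_op_divide[OF b(1)] f])
  note Dn = smooth_op_funpow[OF D(1)] smooth_op_funpow[OF D(2)]
  have "E s ((rderiv b ^^ s) ((rderiv c ^^ t) ?g)) z = (rderiv b ^^ s) (E 0 ((rderiv c ^^ t) ?g)) z"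
    by (rule same[OF smooth_op_smooth[OF Dn(2) g] z])
  also have "\<dots> = (rderiv b ^^ s) ((rderiv c ^^ t) (E 0 ?g)) z"
    by (rule smooth_op_cong[OF Dn(1) other[OF g, symmetric] z])
  also have "\<dots> = (rderiv b ^^ s) ((rderiv c ^^ t) (pderivative b f)) z"
    by (rule smooth_op_cong[OF smooth_op_rderivs[OF b(1,2)] _ z])
      (simp add: E_def euler_divide[OF f _ b(1)])
  finally show ?thesis by (simp add: E_def)
qed

end

section \<open>Axially symmetric Laplacians in the open quadrant\<close>

text \<open>
  The two coordinates stand for the radii \<open>|x|\<close> and \<open>|y|\<close>. With \<open>2 a = p - 1 + 2 k\<close> and
  \<open>2 b = q - 1 + 2 l\<close> this is the action of the Laplacian on the factor in front of a harmonic
  function that is homogeneous of degree \<open>k\<close> in \<open>x\<close> and \<open>l\<close> in \<open>y\<close>.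
\<close>

definition axial_laplacian :: "real \<Rightarrow> real \<Rightarrow> (real \<times> real \<Rightarrow> real) \<Rightarrow> real \<times> real \<Rightarrow> real"
  where "axial_laplacian a b f z = bessel (1, 0) a f z + bessel (0, 1) b f z"

abbreviation D1 :: "(real \<times> real \<Rightarrow> real) \<Rightarrow> real \<times> real \<Rightarrow> real" where "D1 \<equiv> rderiv (1, 0)"
abbreviation D2 :: "(real \<times> real \<Rightarrow> real) \<Rightarrow> real \<times> real \<Rightarrow> real" where "D2 \<equiv> rderiv (0, 1)"

abbreviation rderivs :: "nat \<Rightarrow> nat \<Rightarrow> (real \<times> real \<Rightarrow> real) \<Rightarrow> real \<times> real \<Rightarrow> real"
  where "rderivs s t h \<equiv> (D1 ^^ s) ((D2 ^^ t) h)"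

lemma Basis_plane: "(Basis :: (real \<times> real) set) = {(1, 0), (0, 1)}"
  by (auto simp: Basis_prod_def)

lemma laplacian_eq_axial: "laplacian = axial_laplacian 0 0"
  by (simp add: fun_eq_iff laplacian_def axial_laplacian_def bessel_def Basis_plane)

context
  fixes S :: "(real \<times> real) set"
  assumes S: "open S" and quadrant: "S \<subseteq> {(x, y). 0 < x \<and> 0 < y}"
begin

lemma coordinate_nonzero: "z \<in> S \<Longrightarrow> b \<in> Basis \<Longrightarrow> z \<bullet> b \<noteq> 0"
  using quadrant by (auto simp: Basis_plane)

lemma smooth_op_D: "smooth_op S D1" "smooth_op S D2"
  by (rule smooth_op_rderiv[OF S coordinate_nonzero]; simp add: Basis_plane)+

lemma smooth_op_D_funpow: "smooth_op S (\<lambda>f. (D1 ^^ s) ((D2 ^^ t) f))"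
  by (rule smooth_op_rderivs[OF S coordinate_nonzero]) (simp_all add: Basis_plane)

lemma smooth_op_axial: "smooth_op S (axial_laplacian a b)"
  unfolding axial_laplacian_def[abs_def]
  by (intro smooth_op_plus[OF S] smooth_op_bessel[OF S coordinate_nonzero]) (simp_all add: Basis_plane)

lemma axial_D1:
  assumes "smooth_on S f" "z \<in> S"
  shows "axial_laplacian (a + 1) b (D1 f) z = D1 (axial_laplacian a b f) z"
proof -
  have "axial_laplacian (a + 1) b (D1 f) z = D1 (bessel (1, 0) a f) z + D1 (bessel (0, 1) b f) z"
    using bessel_rderiv_same[OF S coordinate_nonzero assms, of "(1, 0)" a]
      bessel_rderiv_other[OF S coordinate_nonzero assms, of "(1, 0)" "(0, 1)" b]
    by (simp add: axial_laplacian_def Basis_plane)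
  also have "\<dots> = D1 (axial_laplacian a b f) z"
    unfolding axial_laplacian_def[abs_def]
    by (intro smooth_op_add[OF smooth_op_D(1), symmetric]
        smooth_op_smooth[OF smooth_op_bessel[OF S coordinate_nonzero]] assms) (simp_all add: Basis_plane)
  finally show ?thesis .
qed

lemma axial_D2:
  assumes "smooth_on S f" "z \<in> S"
  shows "axial_laplacian a (b + 1) (D2 f) z = D2 (axial_laplacian a b f) z"
proof -
  have "axial_laplacian a (b + 1) (D2 f) z = D2 (bessel (1, 0) a f) z + D2 (bessel (0, 1) b f) z"
    using bessel_rderiv_same[OF S coordinate_nonzero assms, of "(0, 1)" b]
      bessel_rderiv_other[OF S coordinate_nonzero assms, of "(0, 1)" "(1, 0)" a]
    by (simp add: axial_laplacian_def Basis_plane)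
  also have "\<dots> = D2 (axial_laplacian a b f) z"
    unfolding axial_laplacian_def[abs_def]
    by (intro smooth_op_add[OF smooth_op_D(2), symmetric]
        smooth_op_smooth[OF smooth_op_bessel[OF S coordinate_nonzero]] assms) (simp_all add: Basis_plane)
  finally show ?thesis .
qed

lemma axial_divide_fst:
  assumes "smooth_on S f" "z \<in> S"
  shows "axial_laplacian 1 b (\<lambda>z. f z / fst z) z = axial_laplacian 0 b f z / fst z"
  using bessel_divide_same[OF S coordinate_nonzero assms, of "(1, 0)"]
    bessel_divide_other[OF S coordinate_nonzero assms, of "(1, 0)" "(0, 1)" b]
  by (simp add: axial_laplacian_def Basis_plane inner_prod_def add_divide_distrib)

lemma axial_divide_snd:
  assumes "smooth_on S f" "z \<in> S"
  shows "axial_laplacian a 1 (\<lambda>z. f z / snd z) z = axial_laplacian a 0 f z / snd z"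
  using bessel_divide_same[OF S coordinate_nonzero assms, of "(0, 1)"]
    bessel_divide_other[OF S coordinate_nonzero assms, of "(0, 1)" "(1, 0)" a]
  by (simp add: axial_laplacian_def Basis_plane inner_prod_def add_divide_distrib)

lemma smooth_op_divide_fst: "smooth_op S (\<lambda>f z. f z / fst z :: real)"
  using smooth_op_divide[OF S coordinate_nonzero, of "(1, 0)"] by (simp add: Basis_plane inner_prod_def)

lemma smooth_op_divide_snd: "smooth_op S (\<lambda>f z. f z / snd z :: real)"
  using smooth_op_divide[OF S coordinate_nonzero, of "(0, 1)"] by (simp add: Basis_plane inner_prod_def)

lemma axial_shift:
  "axial_laplacian (a + real s) (b + real t) f z = axial_laplacian a b f z + (2 * real s * D1 f z + 2 * real t * D2 f z)"
  by (simp add: axial_laplacian_def bessel_def algebra_simps)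

text \<open>
  This explains the exponent in the theorem. By \<open>axial_shift\<close> the raised operator is a sum of three
  terms: the operator of weights \<open>(a, b)\<close>, \<open>2 s D1\<close> and \<open>2 t D2\<close>. Applying the first one uses up one
  of the \<open>\<mu> + 1\<close> powers that annihilate \<open>f\<close>; extracting \<open>D1\<close> lowers \<open>s\<close> by one, and extracting \<open>D2\<close>
  lowers \<open>t\<close>. A term vanishes when its index is exhausted, because of the factors \<open>2 s\<close> and \<open>2 t\<close> or
  because \<open>f\<close> is annihilated, so after \<open>\<mu> + s + t\<close> steps all three must have been used up exactly.
  The constant is the weighted number of orders in which this can happen. That it is the same for all
  weights and all \<open>f\<close> is essential: the two components of the function in the theorem have different
  weights, and their images must fit together.
\<close>

lemma axial_funpow_shift:
  "\<exists>c. \<forall>a b f. smooth_on S f \<longrightarrow> (\<forall>z\<in>S. (axial_laplacian a b ^^ Suc \<mu>) f z = 0) \<longrightarrow>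
    (\<forall>z\<in>S. (axial_laplacian (a + real s) (b + real t) ^^ (\<mu> + s + t)) f z =
      c * (D1 ^^ s) ((D2 ^^ t) ((axial_laplacian a b ^^ \<mu>) f)) z)"
proof (induction "\<mu> + s + t" arbitrary: \<mu> s t)
  case 0
  then show ?case by (intro exI[of _ 1]) auto
next
  case (Suc n)
  let ?G = "\<lambda>a b. axial_laplacian (a + real s) (b + real t)"
  let ?M = "\<lambda>a b f. (D1 ^^ s) ((D2 ^^ t) ((axial_laplacian a b ^^ \<mu>) f))"
  note op = smooth_op_D smooth_op_D_funpow smooth_op_axial
    smooth_op_funpow[OF smooth_op_axial]
    smooth_op_funpow[OF smooth_op_D(1)] smooth_op_funpow[OF smooth_op_D(2)]
  note sm = op[THEN smooth_op_smooth]
  \<comment> \<open>The three summands of the last operator applied are treated in turn; each leads to the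
    induction hypothesis with one of \<open>\<mu>\<close>, \<open>s\<close>, \<open>t\<close> lowered, or vanishes if that index is \<open>0\<close>.\<close>
  have "\<exists>c. \<forall>a b f z. smooth_on S f \<longrightarrow> (\<forall>z\<in>S. (axial_laplacian a b ^^ Suc \<mu>) f z = 0) \<longrightarrow> z \<in> S \<longrightarrow>
    (?G a b ^^ n) (axial_laplacian a b f) z = c * ?M a b f z"
  proof (cases \<mu>)
    case 0
    then show ?thesis
      by (intro exI[of _ 0]) (auto intro: smooth_op_eq_0[OF op(5)])
  next
    case (Suc \<nu>)
    then have "n = \<nu> + s + t" using Suc.hyps(2) by simp
    from Suc.hyps(1)[OF this] obtain c where c: "\<And>a b f z. smooth_on S f \<Longrightarrow>
        (\<And>z. z \<in> S \<Longrightarrow> (axial_laplacian a b ^^ Suc \<nu>) f z = 0) \<Longrightarrow> z \<in> S \<Longrightarrow>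
        (?G a b ^^ n) f z = c * (D1 ^^ s) ((D2 ^^ t) ((axial_laplacian a b ^^ \<nu>) f)) z"
      unfolding \<open>n = \<nu> + s + t\<close> by blast
    show ?thesis
      using c[OF sm(4)] unfolding Suc funpow_Suc_right o_def by blast
  qed
  then obtain c0 where c0: "\<And>a b f z. smooth_on S f \<Longrightarrow> (\<And>z. z \<in> S \<Longrightarrow> (axial_laplacian a b ^^ Suc \<mu>) f z = 0) \<Longrightarrow>
    z \<in> S \<Longrightarrow> (?G a b ^^ n) (axial_laplacian a b f) z = c0 * ?M a b f z" by blast
  have "\<exists>c. \<forall>a b f z. smooth_on S f \<longrightarrow> (\<forall>z\<in>S. (axial_laplacian a b ^^ Suc \<mu>) f z = 0) \<longrightarrow> z \<in> S \<longrightarrow>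
    2 * real s * (?G a b ^^ n) (D1 f) z = c * ?M a b f z"
  proof (cases s)
    case 0
    then show ?thesis by (intro exI[of _ 0]) auto
  next
    case (Suc s')
    then have "n = \<mu> + s' + t" using Suc.hyps(2) by simp
    from Suc.hyps(1)[OF this] obtain c where c: "\<And>a b f z. smooth_on S f \<Longrightarrow>
        (\<And>z. z \<in> S \<Longrightarrow> (axial_laplacian a b ^^ Suc \<mu>) f z = 0) \<Longrightarrow> z \<in> S \<Longrightarrow>
        (axial_laplacian (a + real s') (b + real t) ^^ n) f z = c * (D1 ^^ s') ((D2 ^^ t) ((axial_laplacian a b ^^ \<mu>) f)) z"
      unfolding \<open>n = \<mu> + s' + t\<close> by blast
    have "(?G a b ^^ n) (D1 f) z = c * ?M a b f z"
      if f: "smooth_on S f" "\<And>z. z \<in> S \<Longrightarrow> (axial_laplacian a b ^^ Suc \<mu>) f z = 0" and z: "z \<in> S" for a b f z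
    proof -
      have "(?G a b ^^ n) (D1 f) z = D1 ((axial_laplacian (a + real s') (b + real t) ^^ n) f) z"
        using axial_D1[of _ _ "a + real s'" "b + real t"]
        by (intro smooth_op_intertwine_funpow[OF op(4) op(4) op(1) _ f(1) z]) (simp add: Suc ac_simps)
      also have "\<dots> = D1 (\<lambda>z. c *\<^sub>R (D1 ^^ s') ((D2 ^^ t) ((axial_laplacian a b ^^ \<mu>) f)) z) z"
        by (rule smooth_op_cong[OF op(1) _ z]) (simp add: c[OF f])
      also have "\<dots> = c * ?M a b f z"
        by (subst smooth_op_scale[OF op(1) sm(3)[OF sm(5)[OF f(1)]] z]) (simp add: Suc)
      finally show ?thesis .
    qed
    then show ?thesis by (intro exI[of _ "2 * real s * c"]) auto
  qed
  then obtain c1 where c1: "\<And>a b f z. smooth_on S f \<Longrightarrow> (\<And>z. z \<in> S \<Longrightarrow> (axial_laplacian a b ^^ Suc \<mu>) f z = 0) \<Longrightarrow>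
    z \<in> S \<Longrightarrow> 2 * real s * (?G a b ^^ n) (D1 f) z = c1 * ?M a b f z" by blast
  have "\<exists>c. \<forall>a b f z. smooth_on S f \<longrightarrow> (\<forall>z\<in>S. (axial_laplacian a b ^^ Suc \<mu>) f z = 0) \<longrightarrow> z \<in> S \<longrightarrow>
    2 * real t * (?G a b ^^ n) (D2 f) z = c * ?M a b f z"
  proof (cases t)
    case 0
    then show ?thesis by (intro exI[of _ 0]) auto
  next
    case (Suc t')
    then have "n = \<mu> + s + t'" using Suc.hyps(2) by simp
    from Suc.hyps(1)[OF this] obtain c where c: "\<And>a b f z. smooth_on S f \<Longrightarrow>
        (\<And>z. z \<in> S \<Longrightarrow> (axial_laplacian a b ^^ Suc \<mu>) f z = 0) \<Longrightarrow> z \<in> S \<Longrightarrow>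
        (axial_laplacian (a + real s) (b + real t') ^^ n) f z = c * (D1 ^^ s) ((D2 ^^ t') ((axial_laplacian a b ^^ \<mu>) f)) z"
      unfolding \<open>n = \<mu> + s + t'\<close> by blast
    have "(?G a b ^^ n) (D2 f) z = c * ?M a b f z"
      if f: "smooth_on S f" "\<And>z. z \<in> S \<Longrightarrow> (axial_laplacian a b ^^ Suc \<mu>) f z = 0" and z: "z \<in> S" for a b f z
    proof -
      have "(?G a b ^^ n) (D2 f) z = D2 ((axial_laplacian (a + real s) (b + real t') ^^ n) f) z"
        using axial_D2[of _ _ "a + real s" "b + real t'"]
        by (intro smooth_op_intertwine_funpow[OF op(4) op(4) op(2) _ f(1) z]) (simp add: Suc ac_simps)
      also have "\<dots> = D2 (\<lambda>z. c *\<^sub>R (D1 ^^ s) ((D2 ^^ t') ((axial_laplacian a b ^^ \<mu>) f)) z) z"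
        by (rule smooth_op_cong[OF op(2) _ z]) (simp add: c[OF f])
      also have "\<dots> = c * D2 ((D1 ^^ s) ((D2 ^^ t') ((axial_laplacian a b ^^ \<mu>) f))) z"
        by (subst smooth_op_scale[OF op(2) sm(3)[OF sm(5)[OF f(1)]] z]) simp
      also have "D2 ((D1 ^^ s) ((D2 ^^ t') ((axial_laplacian a b ^^ \<mu>) f))) z = ?M a b f z"
        using rderivs_commute[OF S coordinate_nonzero sm(7)[OF sm(5)[OF f(1)]] z, of "(0, 1)" "(1, 0)" 1 s t']
        by (simp add: Suc Basis_plane)
      finally show ?thesis .
    qed
    then show ?thesis by (intro exI[of _ "2 * real t * c"]) auto
  qed
  then obtain c2 where c2: "\<And>a b f z. smooth_on S f \<Longrightarrow> (\<And>z. z \<in> S \<Longrightarrow> (axial_laplacian a b ^^ Suc \<mu>) f z = 0) \<Longrightarrow>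
    z \<in> S \<Longrightarrow> 2 * real t * (?G a b ^^ n) (D2 f) z = c2 * ?M a b f z" by blast
  have "(?G a b ^^ (\<mu> + s + t)) f z = (c0 + c1 + c2) * ?M a b f z"
    if f: "smooth_on S f" "\<forall>z\<in>S. (axial_laplacian a b ^^ Suc \<mu>) f z = 0" and z: "z \<in> S" for a b f z
  proof -
    note D1f = sm(1)[OF f(1)] and D2f = sm(2)[OF f(1)]
    have f0: "\<And>z. z \<in> S \<Longrightarrow> (axial_laplacian a b ^^ Suc \<mu>) f z = 0" using f(2) by blast
    have lin: "smooth_on S (\<lambda>z. (2 * real s) *\<^sub>R D1 f z + (2 * real t) *\<^sub>R D2 f z)"
      by (intro smooth_on_add S smooth_on_scaleR smooth_on_const D1f D2f)
    have "(?G a b ^^ (\<mu> + s + t)) f z = (?G a b ^^ n) (?G a b f) z"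
      unfolding Suc.hyps(2)[symmetric] by (simp add: funpow_swap1)
    also have "\<dots> = (?G a b ^^ n) (\<lambda>z. axial_laplacian a b f z + ((2 * real s) *\<^sub>R D1 f z + (2 * real t) *\<^sub>R D2 f z)) z"
      by (rule smooth_op_cong[OF op(5) _ z]) (simp add: axial_shift)
    also have "\<dots> = (?G a b ^^ n) (axial_laplacian a b f) z +
        (2 * real s * (?G a b ^^ n) (D1 f) z + 2 * real t * (?G a b ^^ n) (D2 f) z)"
      unfolding smooth_op_add[OF op(5) sm(4)[OF f(1)] lin z] smooth_op_lincomb[OF op(5) D1f D2f z]
      by simp
    also have "\<dots> = (c0 + c1 + c2) * ?M a b f z"
      by (simp only: c0[OF f(1) f0 z] c1[OF f(1) f0 z] c2[OF f(1) f0 z]) (simp add: algebra_simps)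
    finally show ?thesis .
  qed
  then show ?case by blast
qed

end

section \<open>Regularity of the solutions of the planar equation\<close>

lemma smooth_on_local:
  assumes "\<And>x. x \<in> S \<Longrightarrow> \<exists>T. open T \<and> x \<in> T \<and> smooth_on T f"
  shows "smooth_on S f"
  unfolding smooth_on_def
proof (intro allI Ck_on_local)
  fix n x assume "x \<in> S"
  then show "\<exists>T. open T \<and> x \<in> T \<and> Ck_on n T f" using assms unfolding smooth_on_def by blast
qed

lemma line_differentiable:
  assumes "f differentiable (at x)"
  shows "(\<lambda>t. f (x + t *\<^sub>R b)) differentiable (at 0)"
proof -
  have "((\<lambda>t. x + t *\<^sub>R b) has_derivative (\<lambda>t. t *\<^sub>R b)) (at 0)"
    by (auto intro!: derivative_eq_intros)
  from diff_chain_at[OF this, of f] has_derivative_pderivative[OF assms] show ?thesis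
    by (auto simp: differentiable_def o_def)
qed

lemma Ck_on_imp_C_on: "Ck_on n S f \<Longrightarrow> C_on n S f"
proof (induction n arbitrary: f)
  case (Suc n)
  then show ?case using Ck_on_continuous[OF Suc.prems] by (auto intro: line_differentiable)
qed simp

text \<open>
  One partial derivative controls the increment along a fixed line through the point; continuity of
  the other one controls the increments transversal to that line uniformly.
\<close>

lemma C_on_1_imp_differentiable:
  fixes f :: "real \<times> real \<Rightarrow> 'b::real_normed_vector"
  assumes S: "open S" and f: "C_on 1 S f" and z: "z \<in> S"
  shows "f differentiable (at z)"
proof -
  obtain x y where xy: "z = (x, y)" by (cases z)
  obtain X Y where XY: "open X" "open Y" "z \<in> X \<times> Y" "X \<times> Y \<subseteq> S"
    using open_prod_elim[OF S z] by blast
  obtain e where e: "e > 0" "ball y e \<subseteq> Y" using XY xy by (auto simp: open_contains_ball)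
  have sub: "X \<times> ball y e \<subseteq> S" using XY e by auto
  have der: "((\<lambda>t. f (p + t *\<^sub>R b)) has_vector_derivative pderivative b f p) (at 0)"
    if "p \<in> S" "b \<in> Basis" for p b
    using f that by (auto simp: pderivative_def vector_derivative_works)
  have px: "((\<lambda>s. f (s, y)) has_derivative (\<lambda>h. h *\<^sub>R pderivative (1, 0) f z)) (at x within X)"
  proof (rule has_derivative_at_withinI)
    have "((\<lambda>s. s - x) has_vector_derivative 1) (at x)"
      by (auto intro!: derivative_eq_intros)
    from vector_diff_chain_at[OF this, of "\<lambda>t. f (z + t *\<^sub>R (1, 0))"] der[OF z, of "(1, 0)"]
    have "((\<lambda>s. f (z + (s - x) *\<^sub>R (1, 0))) has_vector_derivative pderivative (1, 0) f z) (at x)"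
      by (simp add: Basis_plane o_def)
    then show "((\<lambda>s. f (s, y)) has_derivative (\<lambda>h. h *\<^sub>R pderivative (1, 0) f z)) (at x)"
      by (simp add: xy has_vector_derivative_def)
  qed
  have py: "((\<lambda>t. f (a, t)) has_derivative blinfun_apply (blinfun_scaleR_left (pderivative (0, 1) f (a, b))))
      (at b within ball y e)" if "a \<in> X" "b \<in> ball y e" for a b
  proof (rule has_derivative_at_withinI)
    have "((\<lambda>s. s - b) has_vector_derivative 1) (at b)"
      by (auto intro!: derivative_eq_intros)
    moreover have "(a, b) \<in> S" using that sub by auto
    ultimately have "((\<lambda>s. f ((a, b) + (s - b) *\<^sub>R (0, 1))) has_vector_derivative pderivative (0, 1) f (a, b)) (at b)"
      using vector_diff_chain_at[of "\<lambda>s. s - b" 1 b "\<lambda>t. f ((a, b) + t *\<^sub>R (0, 1))"] der[of "(a, b)" "(0, 1)"]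
      by (simp add: Basis_plane o_def)
    then show "((\<lambda>t. f (a, t)) has_derivative blinfun_apply (blinfun_scaleR_left (pderivative (0, 1) f (a, b)))) (at b)"
      by (simp add: has_vector_derivative_def)
  qed
  have "isCont (pderivative (0, 1) f) z"
    using f z S by (auto simp: Basis_plane continuous_on_eq_continuous_at)
  then have "isCont (\<lambda>p. blinfun_scaleR_left (pderivative (0, 1) f p)) z"
    by (rule bounded_linear.isCont[OF bounded_linear_blinfun_scaleR_left])
  then have cont: "continuous (at (x, y) within X \<times> ball y e)
      (\<lambda>(a, b). blinfun_scaleR_left (pderivative (0, 1) f (a, b)))"
    using continuous_at_imp_continuous_at_within by (simp add: xy case_prod_beta')
  have "((\<lambda>(a, b). f (a, b)) has_derivative
      (\<lambda>(s, t). s *\<^sub>R pderivative (1, 0) f z + blinfun_apply (blinfun_scaleR_left (pderivative (0, 1) f (x, y))) t))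
      (at (x, y) within X \<times> ball y e)"
    by (rule has_derivative_partialsI[OF px py cont]) (use e in auto)
  moreover have "at (x, y) within X \<times> ball y e = at (x, y)"
    using XY e xy by (intro at_within_open open_Times) auto
  ultimately show ?thesis unfolding differentiable_def by (auto simp: xy)
qed

lemma C_on_imp_Ck_on:
  fixes f :: "real \<times> real \<Rightarrow> 'b::real_normed_vector"
  assumes "open S"
  shows "C_on n S f \<Longrightarrow> Ck_on n S f"
proof (induction n arbitrary: f)
  case (Suc n)
  have "continuous_on S (pderivative b f)" if "b \<in> Basis" for b
    using Suc.IH[of "pderivative b f"] Suc.prems that Ck_on_continuous by auto
  then have "C_on 1 S f" using Suc.prems by simp
  then have "\<forall>x\<in>S. f differentiable (at x)" using C_on_1_imp_differentiable[OF assms] by blast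
  then show ?case using Suc by simp
qed simp

definition to_complex :: "real \<times> real \<Rightarrow> complex" where "to_complex z = Complex (fst z) (snd z)"

lemma bounded_linear_to_complex: "bounded_linear to_complex"
proof -
  have "linear to_complex" by (rule linearI) (simp_all add: to_complex_def complex_eq_iff)
  then show ?thesis by (simp add: linear_conv_bounded_linear)
qed

definition wirtinger_bar :: "(real \<times> real \<Rightarrow> complex) \<Rightarrow> real \<times> real \<Rightarrow> complex"
  where "wirtinger_bar w z = (pderivative (1, 0) w z + \<i> * pderivative (0, 1) w z) / 2"

text \<open>
  Both Wirtinger derivatives are the coefficients of the differential written in terms of \<open>dz\<close> and
  its conjugate. Together with \<open>has_derivative_wirtinger\<close> this reduces their calculus to that of
  total derivatives.
\<close>

lemma wirtinger_eqI:
  assumes "(f has_derivative (\<lambda>h. A * to_complex h + B * cnj (to_complex h))) (at z)"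
  shows "wirtinger f z = A" "wirtinger_bar f z = B"
  using pderivative_eqI[OF assms, of "(1, 0)"] pderivative_eqI[OF assms, of "(0, 1)"]
  by (simp_all add: wirtinger_def wirtinger_bar_def to_complex_def complex_eq_iff)

lemma has_derivative_wirtinger:
  assumes "f differentiable (at z)"
  shows "(f has_derivative (\<lambda>h. wirtinger f z * to_complex h + wirtinger_bar f z * cnj (to_complex h))) (at z)"
proof -
  have "pderivative h f z = wirtinger f z * to_complex h + wirtinger_bar f z * cnj (to_complex h)" for h
    unfolding pderivative_eq_sum_Basis[OF assms, of h]
    by (cases h) (simp add: wirtinger_def wirtinger_bar_def to_complex_def complex_eq_iff Basis_plane field_simps)
  then show ?thesis using has_derivative_pderivative[OF assms] by simp
qed

lemma wirtinger_cnj: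
  assumes "f differentiable (at z)"
  shows "wirtinger (\<lambda>z. cnj (f z)) z = cnj (wirtinger_bar f z)"
    and "wirtinger_bar (\<lambda>z. cnj (f z)) z = cnj (wirtinger f z)"
proof -
  have "((\<lambda>z. cnj (f z)) has_derivative
      (\<lambda>h. cnj (wirtinger_bar f z) * to_complex h + cnj (wirtinger f z) * cnj (to_complex h))) (at z)"
    using has_derivative_cnj[OF has_derivative_wirtinger[OF assms]] by (simp add: add.commute)
  from wirtinger_eqI[OF this]
  show "wirtinger (\<lambda>z. cnj (f z)) z = cnj (wirtinger_bar f z)"
    "wirtinger_bar (\<lambda>z. cnj (f z)) z = cnj (wirtinger f z)" .
qed

lemma has_derivative_holomorphic_to_complex:
  assumes "(\<Phi> has_field_derivative \<Phi>') (at (to_complex z))"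
  shows "((\<lambda>z. \<Phi> (to_complex z)) has_derivative (\<lambda>h. \<Phi>' * to_complex h)) (at z)"
  using diff_chain_at[OF bounded_linear_imp_has_derivative[OF bounded_linear_to_complex], of \<Phi> _ z]
    assms[unfolded has_field_derivative_def] by (simp add: o_def)

lemma has_derivative_cnj_power_holomorphic:
  assumes "(\<Phi> has_field_derivative \<Phi>') (at (to_complex z))"
  shows "((\<lambda>z. cnj (to_complex z) ^ j * \<Phi> (to_complex z)) has_derivative
    (\<lambda>h. (cnj (to_complex z) ^ j * \<Phi>') * to_complex h
      + (of_nat j * cnj (to_complex z) ^ (j - 1) * \<Phi> (to_complex z)) * cnj (to_complex h))) (at z)"
proof -
  have "((\<lambda>z. cnj (to_complex z)) has_derivative (\<lambda>h. cnj (to_complex h))) (at z)"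
    by (intro has_derivative_cnj bounded_linear_imp_has_derivative bounded_linear_to_complex)
  from has_derivative_mult[OF has_derivative_power[OF this, of j] has_derivative_holomorphic_to_complex[OF assms]]
  show ?thesis by (simp add: algebra_simps)
qed

lemma smooth_on_holomorphic_to_complex:
  assumes D: "open D" and \<Phi>: "\<Phi> holomorphic_on to_complex ` D" and o: "open (to_complex ` D)"
  shows "smooth_on D (\<lambda>z. \<Phi> (to_complex z))"
  unfolding smooth_on_def
proof
  fix n show "Ck_on n D (\<lambda>z. \<Phi> (to_complex z))"
    using \<Phi>
  proof (induction n arbitrary: \<Phi>)
    case 0
    then show ?case
      using holomorphic_on_imp_continuous_on continuous_on_compose2[of "to_complex ` D" \<Phi> D to_complex]
        bounded_linear.continuous_on[OF bounded_linear_to_complex continuous_on_id] by auto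
  next
    case (Suc n)
    have der: "((\<lambda>z. \<Phi> (to_complex z)) has_derivative (\<lambda>h. deriv \<Phi> (to_complex z) * to_complex h)) (at z)" if "z \<in> D" for z
      using holomorphic_derivI[OF Suc.prems o] that by (intro has_derivative_holomorphic_to_complex) auto
    have "Ck_on n D (pderivative b (\<lambda>z. \<Phi> (to_complex z)))" for b
    proof (rule Ck_on_cong[OF D])
      show "Ck_on n D (\<lambda>z. deriv \<Phi> (to_complex z) * to_complex b)"
        by (intro bounded_bilinear.Ck_on_prod[OF bounded_bilinear_mult] D Ck_on_const Suc.IH
            holomorphic_deriv Suc.prems o)
    qed (use pderivative_eqI[OF der] in auto)
    with der show ?case by (auto simp: differentiable_def)
  qed
qed

text \<open>
  The span of the functions \<open>cnj z\<^sup>j \<Phi>(z)\<close> with \<open>\<Phi>\<close> holomorphic and of their conjugates; by the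
  Almansi expansion these are, locally, the complex polyharmonic functions. The last rule makes
  membership depend on the values in \<open>D\<close> only.
\<close>

inductive polyharmonic :: "(real \<times> real) set \<Rightarrow> (real \<times> real \<Rightarrow> complex) \<Rightarrow> bool" for D where
  holomorphic: "\<Phi> holomorphic_on to_complex ` D \<Longrightarrow> polyharmonic D (\<lambda>z. cnj (to_complex z) ^ j * \<Phi> (to_complex z))"
| cnj: "polyharmonic D f \<Longrightarrow> polyharmonic D (\<lambda>z. cnj (f z))"
| add: "polyharmonic D f \<Longrightarrow> polyharmonic D g \<Longrightarrow> polyharmonic D (\<lambda>z. f z + g z)"
| cong: "polyharmonic D f \<Longrightarrow> (\<And>z. z \<in> D \<Longrightarrow> f z = g z) \<Longrightarrow> polyharmonic D g"

lemma polyharmonic_scale: "polyharmonic D f \<Longrightarrow> polyharmonic D (\<lambda>z. c * f z)"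
proof (induction arbitrary: c rule: polyharmonic.induct)
  case (holomorphic \<Phi> j)
  then have "polyharmonic D (\<lambda>z. cnj (to_complex z) ^ j * (\<lambda>w. c * \<Phi> w) (to_complex z))"
    by (intro polyharmonic.holomorphic holomorphic_intros)
  then show ?case by (simp add: mult.left_commute)
next
  case (cnj f)
  show ?case using polyharmonic.cnj[OF cnj.IH[of "cnj c"]] by simp
next
  case (add f g)
  show ?case using polyharmonic.add[OF add.IH] by (simp add: distrib_left)
next
  case (cong f g)
  show ?case by (rule polyharmonic.cong[OF cong.IH[of c]]) (simp add: cong)
qed

context
  fixes D :: "(real \<times> real) set"
  assumes D: "open D" "convex D"
begin

lemma open_to_complex: "open (to_complex ` D)"
proof -
  have "to_complex ` D = (\<lambda>c. (Re c, Im c)) -` D"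
    by (force simp: to_complex_def image_iff complex_eq_iff)
  moreover have "open ((\<lambda>c. (Re c, Im c)) -` D)"
    by (intro open_vimage D continuous_intros)
  ultimately show ?thesis by simp
qed

lemma convex_to_complex: "convex (to_complex ` D)"
  using bounded_linear.linear[OF bounded_linear_to_complex] D(2) by (rule convex_linear_image)

lemma polyharmonic_smooth: "polyharmonic D f \<Longrightarrow> smooth_on D f"
proof (induction rule: polyharmonic.induct)
  case (holomorphic \<Phi> j)
  have "smooth_on D (\<lambda>z. cnj (to_complex z) ^ j)"
    unfolding smooth_on_def
    by (intro allI Ck_on_power D Ck_on_bounded_linear bounded_linear_compose[OF bounded_linear_cnj bounded_linear_to_complex])
  then show ?case
    by (rule smooth_on_mult[OF D(1) _ smooth_on_holomorphic_to_complex[OF D(1) holomorphic open_to_complex]])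
next
  case (cong f g)
  show ?case by (rule smooth_on_cong[OF D(1) cong.hyps(2) cong.IH])
qed (auto intro: smooth_on_add[OF D(1)] smooth_on_linear[OF D(1) bounded_linear_cnj])

text \<open>
  On \<open>cnj z\<^sup>j \<Phi>(z)\<close> the operator \<open>\<partial>\<^sub>z\<close> is inverted by a primitive of \<open>\<Phi>\<close>, which exists because \<open>D\<close> is
  convex, and the conjugate operator by raising \<open>j\<close>. Conjugation exchanges the two operators, so both
  inverses have to be constructed simultaneously.
\<close>

lemma polyharmonic_antiderivative:
  assumes "polyharmonic D g"
  shows "(\<exists>f. polyharmonic D f \<and> (\<forall>z\<in>D. wirtinger f z = g z)) \<and>
    (\<exists>f. polyharmonic D f \<and> (\<forall>z\<in>D. wirtinger_bar f z = g z))"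
  using assms
proof (induction rule: polyharmonic.induct)
  case (holomorphic \<Phi> j)
  obtain \<Psi> where \<Psi>: "\<And>w. w \<in> to_complex ` D \<Longrightarrow> (\<Psi> has_field_derivative \<Phi> w) (at w)"
    using holomorphic_convex_primitive'[OF convex_to_complex open_to_complex holomorphic] at_within_open[OF _ open_to_complex]
    by metis
  then have hol: "\<Psi> holomorphic_on to_complex ` D"
    by (auto simp: holomorphic_on_open[OF open_to_complex])
  have "wirtinger (\<lambda>z. cnj (to_complex z) ^ j * \<Psi> (to_complex z)) z = cnj (to_complex z) ^ j * \<Phi> (to_complex z)" if "z \<in> D" for z
    using that by (intro wirtinger_eqI(1)[OF has_derivative_cnj_power_holomorphic] \<Psi>) auto
  moreover have "wirtinger_bar (\<lambda>z. cnj (to_complex z) ^ Suc j * (\<Phi> (to_complex z) / of_nat (Suc j))) z =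
      cnj (to_complex z) ^ j * \<Phi> (to_complex z)" if "z \<in> D" for z
  proof -
    have "((\<lambda>w. \<Phi> w / of_nat (Suc j)) has_field_derivative deriv \<Phi> (to_complex z) / of_nat (Suc j)) (at (to_complex z))"
      using that by (intro DERIV_cdivide holomorphic_derivI[OF holomorphic open_to_complex]) auto
    from wirtinger_eqI(2)[OF has_derivative_cnj_power_holomorphic[OF this, of "Suc j"]] show ?thesis
      by (simp add: field_simps del: of_nat_Suc)
  qed
  moreover have "polyharmonic D (\<lambda>z. cnj (to_complex z) ^ Suc j * (\<Phi> (to_complex z) / of_nat (Suc j)))"
    by (rule polyharmonic.holomorphic[of "\<lambda>w. \<Phi> w / of_nat (Suc j)"]) (intro holomorphic_intros holomorphic, simp)
  ultimately show ?case using polyharmonic.holomorphic[OF hol, of j] by blast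
next
  case (cnj g)
  then obtain f1 f2 where f: "polyharmonic D f1" "\<And>z. z \<in> D \<Longrightarrow> wirtinger f1 z = g z"
    "polyharmonic D f2" "\<And>z. z \<in> D \<Longrightarrow> wirtinger_bar f2 z = g z" by blast
  note d = smooth_on_differentiable[OF polyharmonic_smooth]
  show ?case
    using polyharmonic.cnj[OF f(1)] polyharmonic.cnj[OF f(3)] f(2,4) wirtinger_cnj[OF d[OF f(1)]] wirtinger_cnj[OF d[OF f(3)]]
    by (intro conjI exI[of _ "\<lambda>z. cnj (f1 z)"] exI[of _ "\<lambda>z. cnj (f2 z)"]) auto
next
  case (add g1 g2)
  note d = smooth_on_differentiable[OF polyharmonic_smooth]
  have sum: "wirtinger (\<lambda>z. f z + g z) z = wirtinger f z + wirtinger g z"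
    "wirtinger_bar (\<lambda>z. f z + g z) z = wirtinger_bar f z + wirtinger_bar g z"
    if "polyharmonic D f" "polyharmonic D g" "z \<in> D" for f g z
    using d[OF that(1,3)] d[OF that(2,3)]
    by (simp_all add: wirtinger_def wirtinger_bar_def pderivative_add field_simps)
  from add.IH obtain f1 f2 h1 h2 where
    "polyharmonic D f1" "\<forall>z\<in>D. wirtinger f1 z = g1 z" "polyharmonic D f2" "\<forall>z\<in>D. wirtinger f2 z = g2 z"
    "polyharmonic D h1" "\<forall>z\<in>D. wirtinger_bar h1 z = g1 z" "polyharmonic D h2" "\<forall>z\<in>D. wirtinger_bar h2 z = g2 z"
    by blast
  then show ?case
    by (intro conjI exI[of _ "\<lambda>z. f1 z + f2 z"] exI[of _ "\<lambda>z. h1 z + h2 z"])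
      (auto simp: sum intro: polyharmonic.add)
next
  case (cong f g)
  then show ?case by metis
qed

text \<open>
  The equation \<open>\<partial>\<^sub>z f = 0\<close> is the Cauchy-Riemann equation for the conjugate of \<open>f\<close>.
\<close>

lemma polyharmonic_kernel:
  assumes f: "\<And>z. z \<in> D \<Longrightarrow> f differentiable (at z)" and 0: "\<And>z. z \<in> D \<Longrightarrow> wirtinger f z = 0"
  shows "polyharmonic D f"
proof -
  define \<Psi> where "\<Psi> c = cnj (f (Re c, Im c))" for c
  have "(\<Psi> has_field_derivative cnj (wirtinger_bar f z)) (at (to_complex z))" if "z \<in> D" for z
  proof -
    have "((\<lambda>c. (Re c, Im c)) has_derivative (\<lambda>c. (Re c, Im c))) (at (to_complex z))"
      by (auto intro!: derivative_eq_intros)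
    moreover have "(f has_derivative (\<lambda>h. wirtinger_bar f z * cnj (to_complex h))) (at (Re (to_complex z), Im (to_complex z)))"
      using has_derivative_wirtinger[OF f[OF that]] 0[OF that] by (simp add: to_complex_def)
    from diff_chain_at[OF calculation this]
    have "((\<lambda>c. f (Re c, Im c)) has_derivative (\<lambda>c. wirtinger_bar f z * cnj c)) (at (to_complex z))"
      by (simp add: o_def to_complex_def[of "(_, _)"])
    from has_derivative_cnj[OF this] show ?thesis
      by (simp add: has_field_derivative_def \<Psi>_def[abs_def])
  qed
  then have "\<Psi> holomorphic_on to_complex ` D" by (auto simp: holomorphic_on_open[OF open_to_complex])
  then have "polyharmonic D (\<lambda>z. cnj (cnj (to_complex z) ^ 0 * \<Psi> (to_complex z)))"
    by (intro polyharmonic.cnj polyharmonic.holomorphic)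
  then show ?thesis by (rule polyharmonic.cong) (simp add: \<Psi>_def to_complex_def)
qed

lemma polyharmonic_if_wirtinger:
  assumes f: "\<And>z. z \<in> D \<Longrightarrow> f differentiable (at z)"
    and "polyharmonic D g" "\<And>z. z \<in> D \<Longrightarrow> wirtinger f z = g z"
  shows "polyharmonic D f"
proof -
  obtain h where h: "polyharmonic D h" "\<And>z. z \<in> D \<Longrightarrow> wirtinger h z = g z"
    using polyharmonic_antiderivative[OF assms(2)] by blast
  note d = smooth_on_differentiable[OF polyharmonic_smooth[OF h(1)]]
  have "polyharmonic D (\<lambda>z. f z - h z)"
    using f d h(2) assms(3)
    by (intro polyharmonic_kernel) (auto intro: differentiable_diff simp: wirtinger_def pderivative_diff field_simps)
  from polyharmonic.add[OF h(1) this] show ?thesis by simp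
qed

lemma polyharmonic_if_wirtinger_bar:
  assumes f: "\<And>z. z \<in> D \<Longrightarrow> f differentiable (at z)"
    and "polyharmonic D g" "\<And>z. z \<in> D \<Longrightarrow> wirtinger_bar f z = g z"
  shows "polyharmonic D f"
proof -
  have "(\<lambda>z. cnj (f z)) differentiable (at z)" if "z \<in> D" for z
    using has_derivative_cnj f[OF that] unfolding differentiable_def by blast
  then have "polyharmonic D (\<lambda>z. cnj (f z))"
    by (rule polyharmonic_if_wirtinger[OF _ polyharmonic.cnj[OF assms(2)]]) (simp_all add: wirtinger_cnj f assms(3))
  from polyharmonic.cnj[OF this] show ?thesis by simp
qed

lemma laplacian_eq_wirtinger:
  assumes "Ck_on 2 D w" "z \<in> D"
  shows "laplacian w z = 4 * wirtinger (wirtinger_bar w) z"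
proof -
  have d: "pderivative b w differentiable (at z)" if "b \<in> Basis" for b
    using assms that by (simp add: numeral_2_eq_2)
  have pb: "pderivative b (wirtinger_bar w) z =
      (pderivative b (pderivative (1, 0) w) z + \<i> * pderivative b (pderivative (0, 1) w) z) / 2" for b
  proof -
    have "((\<lambda>z. (pderivative (1, 0) w z + \<i> * pderivative (0, 1) w z) / 2) has_derivative
      (\<lambda>b. (pderivative b (pderivative (1, 0) w) z + \<i> * pderivative b (pderivative (0, 1) w) z) / 2)) (at z)"
      by (intro bounded_linear.has_derivative[OF bounded_linear_divide] has_derivative_add has_derivative_mult_right
          has_derivative_pderivative d) (simp_all add: Basis_plane)
    from pderivative_eqI[OF this] show ?thesis by (simp add: wirtinger_bar_def[abs_def])
  qed
  have "pderivative (1, 0) (pderivative (0, 1) w) z = pderivative (0, 1) (pderivative (1, 0) w) z"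
    by (rule pderivative_commute[OF D(1) assms(2,1)]) (simp_all add: Basis_plane)
  then show ?thesis
    by (simp add: wirtinger_def laplacian_def Basis_plane pb complex_eq_iff) (simp add: field_simps)
qed

lemma Ck_on_laplacian:
  assumes "Ck_on (n + 2) D w"
  shows "Ck_on n D (laplacian w)"
  unfolding laplacian_def using assms by (intro Ck_on_sum D) simp

text \<open>
  As \<open>\<Delta> = 4 \<partial>\<^sub>z cnj(\<partial>\<^sub>z)\<close>, where \<open>cnj(\<partial>\<^sub>z)\<close> denotes the conjugate operator, \<open>w\<close> is reached from a function
  annihilated by \<open>\<partial>\<^sub>z\<close> by inverting these two operators \<open>\<mu>\<close> times each, and none of these
  steps leaves the class of polyharmonic functions.
\<close>

lemma polyharmonic_representation:
  "Ck_on (2 * \<mu> + 1) D w \<Longrightarrow> (\<And>z. z \<in> D \<Longrightarrow> wirtinger ((laplacian ^^ \<mu>) w) z = 0) \<Longrightarrow> polyharmonic D w"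
proof (induction \<mu> arbitrary: w)
  case 0
  then show ?case by (intro polyharmonic_kernel) auto
next
  case (Suc \<mu>)
  have "polyharmonic D (laplacian w)"
  proof (rule Suc.IH)
    show "Ck_on (2 * \<mu> + 1) D (laplacian w)" using Suc.prems(1) by (intro Ck_on_laplacian) (simp del: Ck_on.simps)
    show "wirtinger ((laplacian ^^ \<mu>) (laplacian w)) z = 0" if "z \<in> D" for z
      using Suc.prems(2)[OF that] by (simp add: funpow_swap1)
  qed
  from polyharmonic_scale[OF this, of "1 / 4"] have L: "polyharmonic D (\<lambda>z. 1 / 4 * laplacian w z)" .
  have C2: "Ck_on 2 D w" by (rule Ck_on_mono[OF _ Suc.prems(1)]) simp
  have "polyharmonic D (wirtinger_bar w)"
  proof (rule polyharmonic_if_wirtinger[OF _ L])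
    show "wirtinger_bar w differentiable (at z)" if "z \<in> D" for z
      using C2 that unfolding wirtinger_bar_def[abs_def] numeral_2_eq_2
      by (auto simp: Basis_plane intro!: derivative_intros)
    show "wirtinger (wirtinger_bar w) z = 1 / 4 * laplacian w z" if "z \<in> D" for z
      using laplacian_eq_wirtinger[OF C2 that] by simp
  qed
  then show ?case
    by (rule polyharmonic_if_wirtinger_bar[rotated]) (use C2 in \<open>auto simp: numeral_2_eq_2\<close>)
qed

end

theorem smooth_on_solution:
  assumes "open S" "C_on (2 * \<mu> + 1) S w" "\<And>z. z \<in> S \<Longrightarrow> wirtinger ((laplacian ^^ \<mu>) w) z = 0"
  shows "smooth_on S w"
proof (rule smooth_on_local)
  fix z assume "z \<in> S"
  then obtain e where e: "e > 0" "ball z e \<subseteq> S" using \<open>open S\<close> open_contains_ball by blast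
  have "polyharmonic (ball z e) w"
    using e assms by (intro polyharmonic_representation[of _ \<mu>] Ck_on_subset[OF C_on_imp_Ck_on]) auto
  with e show "\<exists>T. open T \<and> z \<in> T \<and> smooth_on T w"
    by (intro exI[of _ "ball z e"]) (auto intro: polyharmonic_smooth)
qed

lemma smooth_op_laplacian: "open S \<Longrightarrow> smooth_op S laplacian"
  unfolding laplacian_def[abs_def]
  by (intro smooth_op_sum smooth_op_compose[OF smooth_op_pderivative smooth_op_pderivative])

lemma laplacian_funpow_bounded_linear:
  assumes S: "open S" and T: "bounded_linear T" and f: "smooth_on S f" and "z \<in> S"
  shows "(laplacian ^^ n) (\<lambda>z. T (f z)) z = T ((laplacian ^^ n) f z)"
  using \<open>z \<in> S\<close>
proof (induction n arbitrary: z)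
  case (Suc n)
  let ?g = "(laplacian ^^ n) f"
  have g: "smooth_on S ?g"
    by (rule smooth_op_smooth[OF smooth_op_funpow[OF smooth_op_laplacian[OF S]] f])
  have pd: "pderivative b (\<lambda>z. T (h z)) y = T (pderivative b h y)" if "smooth_on S h" "y \<in> S" for b h y
    by (rule pderivative_bounded_linear[OF T smooth_on_differentiable[OF that]])
  have "(laplacian ^^ Suc n) (\<lambda>z. T (f z)) z = laplacian (\<lambda>z. T (?g z)) z"
    using smooth_op_cong[OF smooth_op_laplacian[OF S] Suc.IH Suc.prems] by simp
  also have "\<dots> = (\<Sum>b\<in>Basis. pderivative b (\<lambda>z. T (pderivative b ?g z)) z)"
    unfolding laplacian_def[of "\<lambda>z. T (?g z)"] using pd[OF g] by (intro sum.cong refl pderivative_cong[OF S Suc.prems])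
  also have "\<dots> = T (laplacian ?g z)"
    unfolding laplacian_def[of ?g] linear_sum[OF bounded_linear.linear[OF T]]
    by (intro sum.cong refl pd smooth_on_pderivative g Suc.prems)
  finally show ?case by simp
qed simp

text \<open>
  The real and imaginary parts of the equation say that \<open>\<Delta>\<^sup>\<mu> v\<close> and \<open>\<Delta>\<^sup>\<mu> u\<close> are the two parts of
  a holomorphic function, so that both are harmonic by cross differentiation.
\<close>

lemma conjugate_system:
  fixes u v :: "real \<times> real \<Rightarrow> real"
  assumes S: "open S" and w: "\<And>z. z \<in> S \<Longrightarrow> w z = of_real (u z) + \<i> * of_real (v z)"
    and C: "C_on (2 * \<mu> + 1) S w" and 0: "\<And>z. z \<in> S \<Longrightarrow> wirtinger ((laplacian ^^ \<mu>) w) z = 0"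
  shows "smooth_on S u" "smooth_on S v"
    and "\<And>z. z \<in> S \<Longrightarrow> pderivative (1, 0) ((axial_laplacian 0 0 ^^ \<mu>) u) z = - pderivative (0, 1) ((axial_laplacian 0 0 ^^ \<mu>) v) z"
    and "\<And>z. z \<in> S \<Longrightarrow> pderivative (1, 0) ((axial_laplacian 0 0 ^^ \<mu>) v) z = pderivative (0, 1) ((axial_laplacian 0 0 ^^ \<mu>) u) z"
    and "\<And>z. z \<in> S \<Longrightarrow> (axial_laplacian 0 0 ^^ Suc \<mu>) u z = 0"
    and "\<And>z. z \<in> S \<Longrightarrow> (axial_laplacian 0 0 ^^ Suc \<mu>) v z = 0"
proof -
  have sw: "smooth_on S w" by (rule smooth_on_solution[OF S C 0])
  let ?W = "(laplacian ^^ \<mu>) w" and ?U = "(laplacian ^^ \<mu>) u" and ?V = "(laplacian ^^ \<mu>) v"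
  note lap = smooth_op_laplacian[OF S]
  note lapn = smooth_op_funpow[OF lap]
  show su: "smooth_on S u"
    by (rule smooth_on_cong[OF S _ smooth_on_linear[OF S bounded_linear_Re sw]]) (simp add: w)
  show sv: "smooth_on S v"
    by (rule smooth_on_cong[OF S _ smooth_on_linear[OF S bounded_linear_Im sw]]) (simp add: w)
  have sW: "smooth_on S ?W" and sU: "smooth_on S ?U" and sV: "smooth_on S ?V"
    by (intro smooth_op_smooth[OF lapn] sw su sv)+
  have U: "?U z = Re (?W z)" if "z \<in> S" for z
    using smooth_op_cong[OF lapn _ that, of u "\<lambda>z. Re (w z)"]
      laplacian_funpow_bounded_linear[OF S bounded_linear_Re sw that] by (simp add: w)
  have V: "?V z = Im (?W z)" if "z \<in> S" for z
    using smooth_op_cong[OF lapn _ that, of v "\<lambda>z. Im (w z)"]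
      laplacian_funpow_bounded_linear[OF S bounded_linear_Im sw that] by (simp add: w)
  have dU: "pderivative b ?U z = Re (pderivative b ?W z)" and dV: "pderivative b ?V z = Im (pderivative b ?W z)"
    if "z \<in> S" for b z
    using pderivative_cong[OF S that U, where b = b] pderivative_cong[OF S that V, where b = b]
      pderivative_bounded_linear[OF bounded_linear_Re smooth_on_differentiable[OF sW that]]
      pderivative_bounded_linear[OF bounded_linear_Im smooth_on_differentiable[OF sW that]] by simp_all
  have cr: "pderivative (1, 0) ?U z = - pderivative (0, 1) ?V z" "pderivative (1, 0) ?V z = pderivative (0, 1) ?U z"
    if "z \<in> S" for z
    using 0[OF that] by (auto simp: dU dV that wirtinger_def complex_eq_iff)
  then show "pderivative (1, 0) ((axial_laplacian 0 0 ^^ \<mu>) u) z = - pderivative (0, 1) ((axial_laplacian 0 0 ^^ \<mu>) v) z"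
    "pderivative (1, 0) ((axial_laplacian 0 0 ^^ \<mu>) v) z = pderivative (0, 1) ((axial_laplacian 0 0 ^^ \<mu>) u) z"
    if "z \<in> S" for z using that by (simp_all add: laplacian_eq_axial)
  have comm: "pderivative (1, 0) (pderivative (0, 1) f) z = pderivative (0, 1) (pderivative (1, 0) f) z"
    if "smooth_on S f" "z \<in> S" for f :: "real \<times> real \<Rightarrow> real" and z
    using that by (intro pderivative_commute[OF S]) (auto simp: smooth_on_def Basis_plane)
  have neg: "pderivative b (\<lambda>z. - pderivative c ?V z) z = - pderivative b (pderivative c ?V) z"
    if "z \<in> S" "c \<in> Basis" for b c z
    by (rule pderivative_bounded_linear[OF bounded_linear_minus[OF bounded_linear_ident]
        smooth_on_differentiable[OF smooth_on_pderivative[OF sV that(2)] that(1)]])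
  have "laplacian ?U z = 0" "laplacian ?V z = 0" if z: "z \<in> S" for z
    using pderivative_cong[OF S z cr(1), where b = "(1, 0)"] pderivative_cong[OF S z cr(2), where b = "(1, 0)"]
      pderivative_cong[OF S z cr(2), where b = "(0, 1)"]
      pderivative_cong[OF S z, of "\<lambda>z. - pderivative (1, 0) ?U z" "pderivative (0, 1) ?V" "(0, 1)"]
      comm[OF sV z] comm[OF sU z] neg[OF z, where c = "(0, 1)"] cr
      pderivative_bounded_linear[OF bounded_linear_minus[OF bounded_linear_ident]
        smooth_on_differentiable[OF smooth_on_pderivative[OF sU, of "(1, 0)"] z], where b = "(0, 1)"]
    by (simp_all add: laplacian_def Basis_plane)
  then show "(axial_laplacian 0 0 ^^ Suc \<mu>) u z = 0" "(axial_laplacian 0 0 ^^ Suc \<mu>) v z = 0" if "z \<in> S" for z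
    using that by (simp_all add: laplacian_eq_axial)
qed

section \<open>Dirac operators on blocks of coordinates\<close>

text \<open>
  The Euclidean norm of the coefficients is not submultiplicative in general, but in finite dimension
  bilinearity alone gives the bound on which the product rule rests.
\<close>

lemma bounded_bilinear_clifford_mult:
  "bounded_bilinear ((*) :: 'n::{finite,linorder} clifford \<Rightarrow> 'n clifford \<Rightarrow> 'n clifford)"
  unfolding bilinear_conv_bounded_bilinear[symmetric] bilinear_def
  by (auto intro!: linearI simp: algebra_simps)

lemmas smooth_on_clifford_mult = smooth_on_bilinear[OF _ bounded_bilinear_clifford_mult]

lemma bounded_linear_clifford_mult_left:
  "bounded_linear (\<lambda>F. a * F :: 'n::{finite,linorder} clifford)"
  by (rule bounded_bilinear.bounded_linear_right[OF bounded_bilinear_clifford_mult])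

type_synonym ('p, 'q) biaxial = "(real, 'p) vec \<times> (real, 'q) vec"

primrec direction :: "'p::finite + 'q::finite \<Rightarrow> ('p, 'q) biaxial" where
  "direction (Inl j) = (axis j 1, 0)"
| "direction (Inr j) = (0, axis j 1)"

lemma direction_Basis [simp]: "direction c \<in> Basis"
  by (cases c) (auto simp: Basis_prod_def Basis_vec_def)

lemma direction_eq_iff: "direction c = direction d \<longleftrightarrow> c = d"
  by (cases c; cases d) (auto simp: axis_eq_axis axis_eq_0_iff)

lemma inner_direction: "direction c \<bullet> direction d = (if c = d then 1 else 0)"
  by (simp add: inner_Basis direction_eq_iff)

lemma Basis_eq_direction: "Basis = range (direction :: 'p::finite + 'q::finite \<Rightarrow> _)"
proof -
  have "range (direction :: 'p + 'q \<Rightarrow> _) = (\<lambda>j. (axis j 1, 0)) ` UNIV \<union> (\<lambda>j. (0, axis j 1)) ` UNIV"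
    unfolding UNIV_sum by (simp add: image_Un image_image)
  then show ?thesis by (auto simp: Basis_prod_def Basis_vec_def)
qed

text \<open>
  The restrictions of the vector variable and of the Dirac, Laplace and Euler operators to a set
  \<open>I\<close> of coordinates. The two blocks of coordinates play symmetric roles; with \<open>I\<close> as a parameter
  each identity is proved only once.
\<close>

context
  fixes I :: "('p::{finite,linorder} + 'q::{finite,linorder}) set"
begin

definition vec_part :: "('p, 'q) biaxial \<Rightarrow> ('p + 'q) clifford"
  where "vec_part X = (\<Sum>c\<in>I. (X \<bullet> direction c) *\<^sub>R gen c)"

definition dirac_part ::
  "(('p, 'q) biaxial \<Rightarrow> ('p + 'q) clifford) \<Rightarrow> ('p, 'q) biaxial \<Rightarrow> ('p + 'q) clifford"
  where "dirac_part F X = (\<Sum>c\<in>I. gen c * pderivative (direction c) F X)"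

definition laplacian_part ::
  "(('p, 'q) biaxial \<Rightarrow> ('p + 'q) clifford) \<Rightarrow> ('p, 'q) biaxial \<Rightarrow> ('p + 'q) clifford"
  where "laplacian_part F X = (\<Sum>c\<in>I. pderivative (direction c) (pderivative (direction c) F) X)"

definition euler_part ::
  "(('p, 'q) biaxial \<Rightarrow> ('p + 'q) clifford) \<Rightarrow> ('p, 'q) biaxial \<Rightarrow> ('p + 'q) clifford"
  where "euler_part F X = (\<Sum>c\<in>I. (X \<bullet> direction c) *\<^sub>R pderivative (direction c) F X)"

end

lemma gen_anticommutator: "gen c * gen d = - (gen d * gen c) - (if c = d then 2 *\<^sub>R 1 else 0)"
proof (cases "c = d")
  case True
  then show ?thesis by (simp add: gen_square scaleR_2)
next
  case False
  then show ?thesis using gen_anticommute[of c d] by (simp add: eq_neg_iff_add_eq_0)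
qed

text \<open>
  A generator anticommutes with all components of a vector except the one in its own direction.
\<close>

lemma gen_vec_part:
  "gen c * vec_part I X = - (vec_part I X * gen c) - (if c \<in> I then (2 * (X \<bullet> direction c)) *\<^sub>R 1 else 0)"
proof -
  have "gen c * vec_part I X = (\<Sum>d\<in>I. (X \<bullet> direction d) *\<^sub>R (gen c * gen d))"
    by (simp add: vec_part_def sum_distrib_left)
  also have "\<dots> = (\<Sum>d\<in>I. - ((X \<bullet> direction d) *\<^sub>R (gen d * gen c)) - (if c = d then (2 * (X \<bullet> direction d)) *\<^sub>R 1 else 0))"
    by (intro sum.cong refl, subst gen_anticommutator) (simp add: scaleR_diff_right mult.commute)
  also have "\<dots> = - (vec_part I X * gen c) - (if c \<in> I then (2 * (X \<bullet> direction c)) *\<^sub>R 1 else 0)"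
    by (simp add: vec_part_def sum_distrib_right sum_subtractf sum_negf)
  finally show ?thesis .
qed

lemma vec_part_anticommute:
  assumes "I \<inter> J = {}"
  shows "vec_part I X * vec_part J X = - (vec_part J X * vec_part I X)"
proof -
  have "vec_part I X * vec_part J X = (\<Sum>c\<in>I. (X \<bullet> direction c) *\<^sub>R (gen c * vec_part J X))"
    by (simp add: vec_part_def[of I] sum_distrib_right)
  also have "\<dots> = (\<Sum>c\<in>I. - ((X \<bullet> direction c) *\<^sub>R (vec_part J X * gen c)))"
    using assms by (intro sum.cong refl) (auto simp: gen_vec_part)
  also have "\<dots> = - (vec_part J X * vec_part I X)"
    by (simp add: vec_part_def[of I] sum_distrib_left sum_negf)
  finally show ?thesis .
qed

text \<open>
  Reversing the order of a product of generators leads back to the same expression with the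
  opposite sign, up to a diagonal term; the diagonal term then determines the product.
\<close>

lemma eq_minus_if_eq_minus_diff:
  fixes a b :: "'a::real_vector"
  assumes "a = - a - 2 *\<^sub>R b"
  shows "a = - b"
proof -
  have "2 *\<^sub>R a = a + a" by (simp add: scaleR_2)
  also have "\<dots> = a + (- a - 2 *\<^sub>R b)" using assms by (rule arg_cong)
  finally have "2 *\<^sub>R a = 2 *\<^sub>R (- b)" by simp
  then show ?thesis unfolding scaleR_cancel_left by simp
qed

lemma vec_part_square: "vec_part I X * vec_part I X = - ((\<Sum>c\<in>I. (X \<bullet> direction c)\<^sup>2) *\<^sub>R 1)"
proof -
  have "vec_part I X * vec_part I X = (\<Sum>c\<in>I. (X \<bullet> direction c) *\<^sub>R (gen c * vec_part I X))"
    by (simp add: vec_part_def[of I X] sum_distrib_right)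
  also have "\<dots> = (\<Sum>c\<in>I. - ((X \<bullet> direction c) *\<^sub>R (vec_part I X * gen c)) - (2 * (X \<bullet> direction c)\<^sup>2) *\<^sub>R 1)"
    by (intro sum.cong refl) (auto simp: gen_vec_part scaleR_diff_right power2_eq_square mult_ac)
  also have "\<dots> = - (vec_part I X * vec_part I X) - 2 *\<^sub>R ((\<Sum>c\<in>I. (X \<bullet> direction c)\<^sup>2) *\<^sub>R 1)"
    by (simp add: vec_part_def[of I X] sum_distrib_left sum_negf sum_subtractf scaleR_sum_left scaleR_sum_right)
  finally show ?thesis by (rule eq_minus_if_eq_minus_diff)
qed

lemma has_derivative_vec_part: "(vec_part I has_derivative vec_part I) (at X)"
  unfolding vec_part_def[abs_def]
  by (intro has_derivative_sum has_derivative_scaleR_left bounded_linear_imp_has_derivative bounded_linear_inner_left)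

lemma vec_part_direction: "vec_part I (direction c) = (if c \<in> I then gen c else 0)"
  by (simp add: vec_part_def inner_direction if_distrib[of "\<lambda>r. r *\<^sub>R _"] cong: if_cong)

lemma smooth_on_vec_part: "smooth_on S (vec_part I)"
  using has_derivative_vec_part has_derivative_bounded_linear by (intro smooth_on_bounded_linear) blast

lemma smooth_on_vec_part_mult: "open S \<Longrightarrow> smooth_on S F \<Longrightarrow> smooth_on S (\<lambda>X. vec_part I X * F X)"
  by (intro smooth_on_clifford_mult smooth_on_vec_part)

lemma pderivative_vec_part_mult:
  assumes "F differentiable (at X)"
  shows "pderivative (direction c) (\<lambda>X. vec_part I X * F X) X =
    vec_part I X * pderivative (direction c) F X + (if c \<in> I then gen c * F X else 0)"
proof -
  have "pderivative (direction c) (vec_part I) X = (if c \<in> I then gen c else 0)"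
    using pderivative_eqI[OF has_derivative_vec_part] vec_part_direction by metis
  then show ?thesis
    using bounded_bilinear.pderivative_prod[OF bounded_bilinear_clifford_mult _ assms, of "vec_part I" "direction c"]
      has_derivative_vec_part differentiable_def by fastforce
qed

text \<open>
  The relation \<open>\<partial> x + x \<partial> = - (n + 2 E)\<close>, with \<open>E\<close> the Euler operator and \<open>n\<close> the number of
  coordinates: moving \<open>\<partial>\<close> past \<open>x\<close> leaves \<open>-1\<close> for each \<open>e\<^sub>c\<^sup>2\<close> and \<open>- 2 X\<^sub>c \<partial>\<^sub>c\<close> for each failure to anticommute.
\<close>

lemma dirac_part_vec_part_same:
  assumes "F differentiable (at X)"
  shows "dirac_part I (\<lambda>X. vec_part I X * F X) X =
    - (vec_part I X * dirac_part I F X) - (real (card I) *\<^sub>R F X + 2 *\<^sub>R euler_part I F X)"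
proof -
  have "dirac_part I (\<lambda>X. vec_part I X * F X) X =
      (\<Sum>c\<in>I. (gen c * vec_part I X) * pderivative (direction c) F X + (gen c * gen c) * F X)"
    unfolding dirac_part_def
    by (intro sum.cong refl) (simp add: pderivative_vec_part_mult[OF assms] distrib_left mult.assoc)
  also have "\<dots> = (\<Sum>c\<in>I. - (vec_part I X * (gen c * pderivative (direction c) F X))
      - 2 *\<^sub>R ((X \<bullet> direction c) *\<^sub>R pderivative (direction c) F X) - F X)"
    by (intro sum.cong refl) (simp add: gen_vec_part gen_square algebra_simps)
  also have "\<dots> = - (vec_part I X * dirac_part I F X) - (of_real (real (card I)) * F X + 2 *\<^sub>R euler_part I F X)"
    by (simp add: dirac_part_def euler_part_def sum_subtractf sum_negf sum_distrib_left scaleR_sum_right)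
  also have "of_real (real (card I)) * F X = real (card I) *\<^sub>R F X"
    by (rule scaleR_conv_of_real[symmetric])
  finally show ?thesis .
qed

lemma dirac_part_vec_part_other:
  assumes "F differentiable (at X)" "I \<inter> J = {}"
  shows "dirac_part I (\<lambda>X. vec_part J X * F X) X = - (vec_part J X * dirac_part I F X)"
proof -
  have "dirac_part I (\<lambda>X. vec_part J X * F X) X = (\<Sum>c\<in>I. (gen c * vec_part J X) * pderivative (direction c) F X)"
    unfolding dirac_part_def using assms(2)
    by (intro sum.cong refl) (auto simp: pderivative_vec_part_mult[OF assms(1)] mult.assoc)
  also have "\<dots> = (\<Sum>c\<in>I. - (vec_part J X * (gen c * pderivative (direction c) F X)))"
    using assms(2) by (intro sum.cong refl) (auto simp: gen_vec_part mult.assoc)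
  finally show ?thesis by (simp add: dirac_part_def sum_distrib_left sum_negf)
qed

lemma euler_part_vec_part:
  assumes "F differentiable (at X)" "I = J \<or> I \<inter> J = {}"
  shows "euler_part I (\<lambda>X. vec_part J X * F X) X =
    vec_part J X * euler_part I F X + (if I = J then vec_part J X * F X else 0)"
proof -
  have "euler_part I (\<lambda>X. vec_part J X * F X) X =
      (\<Sum>c\<in>I. vec_part J X * ((X \<bullet> direction c) *\<^sub>R pderivative (direction c) F X)
        + (if c \<in> J then (X \<bullet> direction c) *\<^sub>R (gen c * F X) else 0))"
    unfolding euler_part_def by (intro sum.cong refl) (simp add: pderivative_vec_part_mult[OF assms(1)] scaleR_add_right)
  also have "\<dots> = vec_part J X * euler_part I F X + (\<Sum>c\<in>I \<inter> J. ((X \<bullet> direction c) *\<^sub>R gen c) * F X)"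
    by (simp add: sum.distrib euler_part_def sum_distrib_left sum.inter_restrict)
  also have "(\<Sum>c\<in>I \<inter> J. ((X \<bullet> direction c) *\<^sub>R gen c) * F X) = (if I = J then vec_part J X * F X else 0)"
    using assms(2) by (auto simp: vec_part_def sum_distrib_right)
  finally show ?thesis .
qed

lemma laplacian_part_vec_part:
  assumes S: "open S" "smooth_on S F" "X \<in> S" and IJ: "I = J \<or> I \<inter> J = {}"
  shows "laplacian_part I (\<lambda>X. vec_part J X * F X) X =
    vec_part J X * laplacian_part I F X + (if I = J then 2 *\<^sub>R dirac_part I F X else 0)"
proof -
  have dF: "F differentiable (at Y)" if "Y \<in> S" for Y using smooth_on_differentiable[OF S(2) that] .
  have sF: "smooth_on S (pderivative (direction c) F)" for c by (rule smooth_on_pderivative[OF S(2)]) simp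
  have "pderivative (direction c) (pderivative (direction c) (\<lambda>X. vec_part J X * F X)) X =
      vec_part J X * pderivative (direction c) (pderivative (direction c) F) X
      + (if c \<in> J then 2 *\<^sub>R (gen c * pderivative (direction c) F X) else 0)" for c
  proof -
    let ?g = "if c \<in> J then gen c else 0"
    have "pderivative (direction c) (pderivative (direction c) (\<lambda>X. vec_part J X * F X)) X =
        pderivative (direction c) (\<lambda>Y. vec_part J Y * pderivative (direction c) F Y + ?g * F Y) X"
      by (rule pderivative_cong[OF S(1,3)]) (simp add: pderivative_vec_part_mult dF)
    also have "\<dots> = pderivative (direction c) (\<lambda>Y. vec_part J Y * pderivative (direction c) F Y) X
        + pderivative (direction c) (\<lambda>Y. ?g * F Y) X"
      by (intro pderivative_add smooth_on_differentiable[OF _ S(3)] smooth_on_vec_part_mult S sF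
          smooth_on_linear[OF S(1) bounded_linear_clifford_mult_left])
    also have "\<dots> = vec_part J X * pderivative (direction c) (pderivative (direction c) F) X
        + 2 *\<^sub>R (?g * pderivative (direction c) F X)"
      by (simp add: pderivative_vec_part_mult[OF smooth_on_differentiable[OF sF S(3)]]
          pderivative_bounded_linear[OF bounded_linear_clifford_mult_left dF[OF S(3)]] scaleR_2)
    finally show ?thesis by simp
  qed
  then have "laplacian_part I (\<lambda>X. vec_part J X * F X) X = vec_part J X * laplacian_part I F X
      + (\<Sum>c\<in>I \<inter> J. 2 *\<^sub>R (gen c * pderivative (direction c) F X))"
    by (simp add: laplacian_part_def sum.distrib sum_distrib_left sum.inter_restrict)
  also have "(\<Sum>c\<in>I \<inter> J. 2 *\<^sub>R (gen c * pderivative (direction c) F X)) = (if I = J then 2 *\<^sub>R dirac_part I F X else 0)"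
    using IJ by (auto simp: dirac_part_def scaleR_sum_right)
  finally show ?thesis .
qed

text \<open>
  The mixed terms cancel because the generators anticommute while the partial derivatives commute.
\<close>

lemma dirac_part_square:
  assumes S: "open S" "smooth_on S F" "X \<in> S"
  shows "dirac_part I (dirac_part I F) X = - laplacian_part I F X"
proof -
  let ?d = "\<lambda>c. pderivative (direction c)"
  have dF: "?d d F differentiable (at X)" for d
    by (intro smooth_on_differentiable[OF _ S(3)] smooth_on_pderivative S) simp
  have "?d c (dirac_part I F) X = (\<Sum>d\<in>I. gen d * ?d c (?d d F) X)" for c
  proof -
    have "?d c (dirac_part I F) X = (\<Sum>d\<in>I. ?d c (\<lambda>X. gen d * ?d d F X) X)"
      unfolding dirac_part_def[abs_def]
      by (intro pderivative_sum smooth_on_differentiable[OF _ S(3)] smooth_on_pderivative S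
          smooth_on_linear[OF S(1) bounded_linear_clifford_mult_left]) simp
    then show ?thesis by (simp add: pderivative_bounded_linear[OF bounded_linear_clifford_mult_left dF])
  qed
  then have DD: "dirac_part I (dirac_part I F) X = (\<Sum>c\<in>I. \<Sum>d\<in>I. (gen c * gen d) * ?d c (?d d F) X)"
    by (simp add: dirac_part_def[of I "dirac_part I F"] sum_distrib_left mult.assoc)
  have comm: "?d c (?d d F) X = ?d d (?d c F) X" for c d
    using S by (intro pderivative_commute[OF S(1,3)]) (auto simp: smooth_on_def)
  have "(\<Sum>c\<in>I. \<Sum>d\<in>I. (gen c * gen d) * ?d c (?d d F) X) =
      (\<Sum>c\<in>I. \<Sum>d\<in>I. - ((gen d * gen c) * ?d d (?d c F) X) - (if c = d then 2 *\<^sub>R ?d c (?d c F) X else 0))"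
    by (intro sum.cong refl, subst gen_anticommutator, subst comm) (simp add: left_diff_distrib)
  also have "\<dots> = - (\<Sum>c\<in>I. \<Sum>d\<in>I. (gen d * gen c) * ?d d (?d c F) X) - 2 *\<^sub>R laplacian_part I F X"
    by (simp add: sum_subtractf sum_negf laplacian_part_def scaleR_sum_right)
  also have "(\<Sum>c\<in>I. \<Sum>d\<in>I. (gen d * gen c) * ?d d (?d c F) X) = (\<Sum>c\<in>I. \<Sum>d\<in>I. (gen c * gen d) * ?d c (?d d F) X)"
    by (rule sum.swap)
  finally show ?thesis unfolding DD by (rule eq_minus_if_eq_minus_diff)
qed

section \<open>Functions of the two radii\<close>

definition axial_lift :: "(real \<times> real \<Rightarrow> real) \<Rightarrow> 'a::real_normed_vector \<times> 'b::real_normed_vector \<Rightarrow> real"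
  where "axial_lift g X = g (norm (fst X), norm (snd X))"

definition axial_domain :: "(real \<times> real) set \<Rightarrow> ('a::real_normed_vector \<times> 'b::real_normed_vector) set"
  where "axial_domain S = {X. (norm (fst X), norm (snd X)) \<in> S}"

lemma open_axial_domain:
  assumes "open S"
  shows "open (axial_domain S :: ('a::real_normed_vector \<times> 'b::real_normed_vector) set)"
proof -
  have "open ((\<lambda>X :: 'a \<times> 'b. (norm (fst X), norm (snd X))) -` S)"
    by (intro open_vimage assms continuous_intros)
  then show ?thesis by (simp add: axial_domain_def vimage_def)
qed

context
  fixes S :: "(real \<times> real) set"
  assumes S: "open S" and quadrant: "S \<subseteq> {(x, y). 0 < x \<and> 0 < y}"
begin

text \<open>
  The quotient in \<open>rderiv\<close> is exactly the one produced by the gradient \<open>x / |x|\<close> of the norm, so that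
  no further singular factor appears.
\<close>

lemma has_derivative_axial_lift:
  fixes X :: "'a::euclidean_space \<times> 'b::euclidean_space"
  assumes g: "smooth_on S g" and X: "X \<in> axial_domain S"
  shows "(axial_lift g has_derivative (\<lambda>h. (fst X \<bullet> fst h) * axial_lift (D1 g) X
    + (snd X \<bullet> snd h) * axial_lift (D2 g) X)) (at X)"
proof -
  let ?z = "(norm (fst X), norm (snd X))"
  have z: "?z \<in> S" and nz: "fst X \<noteq> 0" "snd X \<noteq> 0"
    using X quadrant by (auto simp: axial_domain_def)
  have dg: "g differentiable (at ?z)" by (rule smooth_on_differentiable[OF g z])
  have norm: "((\<lambda>X. norm (l X)) has_derivative (\<lambda>h. (l X \<bullet> l h) / norm (l X))) (at X)"
    if "l X \<noteq> 0" "bounded_linear l" for l :: "'a \<times> 'b \<Rightarrow> 'c::real_inner"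
    using diff_chain_at[OF bounded_linear_imp_has_derivative[OF that(2)] has_derivative_norm[OF that(1)]]
    by (simp add: o_def sgn_div_norm inner_commute divide_inverse mult.commute)
  have "((\<lambda>X. (norm (fst X), norm (snd X))) has_derivative (\<lambda>h. ((fst X \<bullet> fst h) / norm (fst X), (snd X \<bullet> snd h) / norm (snd X)))) (at X)"
    by (intro has_derivative_Pair norm nz bounded_linear_fst bounded_linear_snd)
  from diff_chain_at[OF this has_derivative_pderivative[OF dg]]
  have lift: "(axial_lift g has_derivative (\<lambda>h. pderivative ((fst X \<bullet> fst h) / norm (fst X), (snd X \<bullet> snd h) / norm (snd X)) g ?z)) (at X)"
    by (simp add: o_def axial_lift_def[abs_def])
  have split: "pderivative (a, b) g ?z = a * pderivative (1, 0) g ?z + b * pderivative (0, 1) g ?z" for a b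
    using pderivative_eq_sum_Basis[OF dg, of "(a, b)"] by (simp add: Basis_plane)
  have "(\<lambda>h. pderivative ((fst X \<bullet> fst h) / norm (fst X), (snd X \<bullet> snd h) / norm (snd X)) g ?z) =
      (\<lambda>h. (fst X \<bullet> fst h) * axial_lift (D1 g) X + (snd X \<bullet> snd h) * axial_lift (D2 g) X)"
    by (rule ext, subst split) (simp add: axial_lift_def rderiv_def)
  with lift show ?thesis by (rule has_derivative_eq_rhs)
qed

lemma pderivative_axial_lift:
  fixes X :: "('p::{finite,linorder}, 'q::{finite,linorder}) biaxial"
  assumes "smooth_on S g" "X \<in> axial_domain S"
  shows "c \<in> range Inl \<Longrightarrow> pderivative (direction c) (axial_lift g) X = (X \<bullet> direction c) * axial_lift (D1 g) X"
    and "c \<in> range Inr \<Longrightarrow> pderivative (direction c) (axial_lift g) X = (X \<bullet> direction c) * axial_lift (D2 g) X"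
proof -
  note eq = pderivative_eqI[OF has_derivative_axial_lift[OF assms], of "direction c"]
  show "pderivative (direction c) (axial_lift g) X = (X \<bullet> direction c) * axial_lift (D1 g) X" if "c \<in> range Inl"
    unfolding eq using that by (auto simp: inner_prod_def)
  show "pderivative (direction c) (axial_lift g) X = (X \<bullet> direction c) * axial_lift (D2 g) X" if "c \<in> range Inr"
    unfolding eq using that by (auto simp: inner_prod_def)
qed

lemma smooth_on_axial_lift:
  assumes "smooth_on S g"
  shows "smooth_on (axial_domain S :: (('p::{finite,linorder}, 'q::{finite,linorder}) biaxial) set) (axial_lift g)"
    (is "smooth_on ?\<Omega> _")
  unfolding smooth_on_def
proof
  fix n
  have \<Omega>: "open ?\<Omega>" by (rule open_axial_domain[OF S])
  show "Ck_on n ?\<Omega> (axial_lift g)"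
    using assms
  proof (induction n arbitrary: g)
    case 0
    then show ?case
      using has_derivative_continuous[OF has_derivative_axial_lift[OF 0]]
      by (auto intro!: continuous_at_imp_continuous_on)
  next
    case (Suc n)
    have "Ck_on n ?\<Omega> (pderivative b (axial_lift g))" if "b \<in> Basis" for b
    proof -
      have sD: "smooth_on S (D1 g)" "smooth_on S (D2 g)"
        using Suc.prems by (auto intro: smooth_op_smooth smooth_op_D[OF S quadrant])
      obtain c where b: "b = direction c" using \<open>b \<in> Basis\<close> by (auto simp: Basis_eq_direction)
      have *: "Ck_on n ?\<Omega> (\<lambda>X. (X \<bullet> direction c) * axial_lift h X)" if "smooth_on S h" for h
        by (intro bounded_bilinear.Ck_on_prod[OF bounded_bilinear_mult] \<Omega> Suc.IH that
            Ck_on_bounded_linear bounded_linear_inner_left)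
      consider "c \<in> range Inl" | "c \<in> range Inr" by (cases c) auto
      then show ?thesis
      proof cases
        case 1
        then show ?thesis
          by (intro Ck_on_cong[OF \<Omega> _ *[OF sD(1)]]) (simp add: b pderivative_axial_lift[OF Suc.prems])
      next
        case 2
        then show ?thesis
          by (intro Ck_on_cong[OF \<Omega> _ *[OF sD(2)]]) (simp add: b pderivative_axial_lift[OF Suc.prems])
      qed
    qed
    then show ?case
      using has_derivative_axial_lift[OF Suc.prems] unfolding Ck_on.simps differentiable_def by blast
  qed
qed

end

section \<open>Laplacians of products with functions of the two radii\<close>

lemma pderivative2_scaleR:
  fixes G :: "'a::euclidean_space \<Rightarrow> real" and K :: "'a \<Rightarrow> 'b::real_normed_vector"
  assumes S: "open S" "X \<in> S" and G: "smooth_on S G" and K: "smooth_on S K" and b: "b \<in> Basis"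
  shows "pderivative b (pderivative b (\<lambda>X. G X *\<^sub>R K X)) X =
    pderivative b (pderivative b G) X *\<^sub>R K X + 2 *\<^sub>R (pderivative b G X *\<^sub>R pderivative b K X)
      + G X *\<^sub>R pderivative b (pderivative b K) X"
proof -
  have pd: "pderivative b (\<lambda>X. g X *\<^sub>R k X) Y = g Y *\<^sub>R pderivative b k Y + pderivative b g Y *\<^sub>R k Y"
    if "smooth_on S g" "smooth_on S k" "Y \<in> S" for g :: "'a \<Rightarrow> real" and k :: "'a \<Rightarrow> 'b" and Y
    by (intro bounded_bilinear.pderivative_prod[OF bounded_bilinear_scaleR]
        smooth_on_differentiable[OF that(1,3)] smooth_on_differentiable[OF that(2,3)])
  note dG = smooth_on_pderivative[OF G b] and dK = smooth_on_pderivative[OF K b]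
  have "pderivative b (pderivative b (\<lambda>X. G X *\<^sub>R K X)) X =
      pderivative b (\<lambda>X. G X *\<^sub>R pderivative b K X + pderivative b G X *\<^sub>R K X) X"
    using pd[OF G K] by (rule pderivative_cong[OF S])
  also have "\<dots> = pderivative b (\<lambda>X. G X *\<^sub>R pderivative b K X) X + pderivative b (\<lambda>X. pderivative b G X *\<^sub>R K X) X"
    by (rule pderivative_add[OF smooth_on_differentiable[OF smooth_on_scaleR[OF S(1) G dK] S(2)]
          smooth_on_differentiable[OF smooth_on_scaleR[OF S(1) dG K] S(2)]])
  also have "\<dots> = (G X *\<^sub>R pderivative b (pderivative b K) X + pderivative b G X *\<^sub>R pderivative b K X)
      + (pderivative b G X *\<^sub>R pderivative b K X + pderivative b (pderivative b G) X *\<^sub>R K X)"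
    unfolding pd[OF G dK S(2)] pd[OF dG K S(2)] ..
  finally show ?thesis unfolding scaleR_2 by (simp only: ac_simps)
qed

lemma sum_Basis_direction:
  "(\<Sum>b\<in>Basis. h b) = (\<Sum>c\<in>range Inl. h (direction c)) + (\<Sum>c\<in>range Inr. h (direction (c :: 'p::finite + 'q::finite)))"
proof -
  have "(\<Sum>b\<in>Basis. h b) = (\<Sum>c\<in>(UNIV :: ('p + 'q) set). h (direction c))"
    unfolding Basis_eq_direction by (subst sum.reindex) (auto simp: inj_on_def direction_eq_iff)
  also have "\<dots> = (\<Sum>c\<in>range Inl. h (direction c)) + (\<Sum>c\<in>range Inr. h (direction (c :: 'p + 'q)))"
    unfolding UNIV_sum by (rule sum.union_disjoint) auto
  finally show ?thesis .
qed

lemma laplacian_eq_parts: "laplacian F X = laplacian_part (range Inl) F X + laplacian_part (range Inr) F X"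
  unfolding laplacian_def laplacian_part_def by (rule sum_Basis_direction)

lemma pderivative_curry:
  "pderivative a (\<lambda>x'. F (x', y)) x = pderivative (a, 0) F (x, y)"
  "pderivative b (\<lambda>y'. F (x, y')) y = pderivative (0, b) F (x, y)"
  by (simp_all add: pderivative_def)

lemma dirac_eq_parts: "dirac F X = dirac_part (range Inl) F X + dirac_part (range Inr) F X"
  by (cases X) (simp add: dirac_def dirac_p_def dirac_q_def dirac_part_def sum.reindex pderivative_curry)

lemma vec_p_eq_vec_part: "vec_p (fst X) = vec_part (range Inl) X"
  and vec_q_eq_vec_part: "vec_q (snd X) = vec_part (range Inr) X"
  by (simp_all add: vec_p_def vec_q_def vec_part_def sum.reindex inner_prod_def inner_axis)

lemma sum_coordinates_square:
  "(\<Sum>c\<in>range Inl. (X \<bullet> direction c)\<^sup>2) = (norm (fst X))\<^sup>2"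
  "(\<Sum>c\<in>range Inr. (X \<bullet> direction c)\<^sup>2) = (norm (snd X))\<^sup>2"
  by (simp_all add: sum.reindex inner_prod_def inner_axis norm_vec_def L2_set_def sum_nonneg)

context
  fixes S :: "(real \<times> real) set"
  assumes S: "open S" and quadrant: "S \<subseteq> {(x, y). 0 < x \<and> 0 < y}"
begin

lemmas nonzero = coordinate_nonzero[OF S quadrant]

context
  fixes I :: "('p::{finite,linorder} + 'q::{finite,linorder}) set" and b :: "real \<times> real"
  assumes Ib: "I = range Inl \<and> b = (1, 0) \<or> I = range Inr \<and> b = (0, 1)"
begin

lemma block_axis_Basis: "b \<in> Basis" using Ib by (auto simp: Basis_plane)

lemma pderivative_axial_lift_part:
  assumes "smooth_on S g" "X \<in> axial_domain S" "c \<in> I"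
  shows "pderivative (direction c) (axial_lift g) X = (X \<bullet> direction c) * axial_lift (rderiv b g) X"
  using pderivative_axial_lift[OF S quadrant assms(1,2), of c] Ib assms(3) by blast

lemma sum_coordinates_square_part: "(\<Sum>c\<in>I. (X \<bullet> direction c)\<^sup>2) = ((norm (fst X), norm (snd X)) \<bullet> b)\<^sup>2"
  using Ib sum_coordinates_square[of X] by (auto simp: inner_prod_def)

lemma dirac_part_axial_lift:
  assumes g: "smooth_on S g" and K: "K differentiable (at X)" and X: "X \<in> axial_domain S"
  shows "dirac_part I (\<lambda>X. axial_lift g X *\<^sub>R K X) X =
    axial_lift (rderiv b g) X *\<^sub>R (vec_part I X * K X) + axial_lift g X *\<^sub>R dirac_part I K X"
proof -
  have dg: "axial_lift g differentiable (at X)"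
    using has_derivative_axial_lift[OF S quadrant g X] by (auto simp: differentiable_def)
  have "dirac_part I (\<lambda>X. axial_lift g X *\<^sub>R K X) X = (\<Sum>c\<in>I. axial_lift g X *\<^sub>R (gen c * pderivative (direction c) K X)
      + axial_lift (rderiv b g) X *\<^sub>R (((X \<bullet> direction c) *\<^sub>R gen c) * K X))"
    unfolding dirac_part_def
    by (intro sum.cong refl) (simp add: bounded_bilinear.pderivative_prod[OF bounded_bilinear_scaleR dg K]
        pderivative_axial_lift_part[OF g X] distrib_left mult.commute)
  also have "\<dots> = axial_lift (rderiv b g) X *\<^sub>R (vec_part I X * K X) + axial_lift g X *\<^sub>R dirac_part I K X"
    by (simp only: sum.distrib dirac_part_def vec_part_def scaleR_sum_right[symmetric] sum_distrib_right[symmetric] add.commute)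
  finally show ?thesis .
qed

text \<open>
  The weight has two sources: the Laplacian of the radial factor contributes \<open>card I - 1\<close>, and the
  mixed term of the product rule contributes \<open>2 k\<close>, since \<open>\<partial>\<^sub>c\<close> of the radial factor is
  proportional to the coordinate \<open>X\<^sub>c\<close> and the sum therefore becomes the Euler operator on \<open>K\<close>.
\<close>

lemma laplacian_part_axial_lift:
  fixes K :: "('p, 'q) biaxial \<Rightarrow> ('p + 'q) clifford"
  assumes g: "smooth_on S g" and K: "smooth_on (axial_domain S) K" and X: "X \<in> axial_domain S"
    and euler: "euler_part I K X = k *\<^sub>R K X"
  shows "laplacian_part I (\<lambda>X. axial_lift g X *\<^sub>R K X) X =
    axial_lift (bessel b ((real (card I) - 1) / 2 + k) g) X *\<^sub>R K X + axial_lift g X *\<^sub>R laplacian_part I K X"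
proof -
  let ?\<Omega> = "axial_domain S :: (('p, 'q) biaxial) set"
  let ?D = "rderiv b" and ?d = "\<lambda>c. pderivative (direction c)" and ?z = "(norm (fst X), norm (snd X))"
  note nz = nonzero
  have \<Omega>: "open ?\<Omega>" by (rule open_axial_domain[OF S])
  have sD: "smooth_on S (?D f)" if "smooth_on S f" for f
    by (rule smooth_op_smooth[OF smooth_op_rderiv[OF S nz block_axis_Basis] that])
  have sl: "smooth_on ?\<Omega> (axial_lift f)" if "smooth_on S f" for f
    by (rule smooth_on_axial_lift[OF S quadrant that])
  have second: "?d c (?d c (axial_lift g)) X = axial_lift (?D g) X + (X \<bullet> direction c)\<^sup>2 * axial_lift (?D (?D g)) X"
    if c: "c \<in> I" for c
  proof -
    have "?d c (?d c (axial_lift g)) X = ?d c (\<lambda>X. (X \<bullet> direction c) * axial_lift (?D g) X) X"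
      by (rule pderivative_cong[OF \<Omega> X]) (rule pderivative_axial_lift_part[OF g _ c])
    also have "((\<lambda>X. (X \<bullet> direction c) * axial_lift (?D g) X) has_derivative
        (\<lambda>h. (X \<bullet> direction c) * pderivative h (axial_lift (?D g)) X + (h \<bullet> direction c) * axial_lift (?D g) X)) (at X)"
      by (intro has_derivative_mult has_derivative_pderivative smooth_on_differentiable[OF sl[OF sD[OF g]] X]
          bounded_linear_imp_has_derivative bounded_linear_inner_left)
    from pderivative_eqI[OF this] have "?d c (\<lambda>X. (X \<bullet> direction c) * axial_lift (?D g) X) X =
        axial_lift (?D g) X + (X \<bullet> direction c)\<^sup>2 * axial_lift (?D (?D g)) X"
      by (simp add: inner_direction pderivative_axial_lift_part[OF sD[OF g] X c] power2_eq_square)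
    finally show ?thesis .
  qed
  have z: "?z \<in> S" using X by (simp add: axial_domain_def)
  have radial: "(?z \<bullet> b)\<^sup>2 * ?D (?D g) ?z = pderivative b (pderivative b g) ?z - ?D g ?z"
    using nz[OF z block_axis_Basis] pderivative_rderiv[OF S nz g z block_axis_Basis]
    by (simp add: rderiv_def[of b "?D g"] power2_eq_square) (simp add: rderiv_def field_simps)
  have "laplacian_part I (\<lambda>X. axial_lift g X *\<^sub>R K X) X =
      (\<Sum>c\<in>I. (axial_lift (?D g) X + (X \<bullet> direction c)\<^sup>2 * axial_lift (?D (?D g)) X) *\<^sub>R K X
        + (2 * axial_lift (?D g) X) *\<^sub>R ((X \<bullet> direction c) *\<^sub>R ?d c K X) + axial_lift g X *\<^sub>R ?d c (?d c K) X)"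
    unfolding laplacian_part_def
    by (intro sum.cong refl) (simp add: pderivative2_scaleR[OF \<Omega> X sl[OF g] K] second pderivative_axial_lift_part[OF g X] ac_simps)
  also have "\<dots> = (\<Sum>c\<in>I. axial_lift (?D g) X + (X \<bullet> direction c)\<^sup>2 * axial_lift (?D (?D g)) X) *\<^sub>R K X
      + (2 * axial_lift (?D g) X) *\<^sub>R euler_part I K X + axial_lift g X *\<^sub>R laplacian_part I K X"
    by (simp only: sum.distrib laplacian_part_def euler_part_def scaleR_sum_right scaleR_sum_left scaleR_add_left)
  also have "(\<Sum>c\<in>I. axial_lift (?D g) X + (X \<bullet> direction c)\<^sup>2 * axial_lift (?D (?D g)) X) =
      real (card I) * ?D g ?z + (pderivative b (pderivative b g) ?z - ?D g ?z)"
    unfolding radial[symmetric] sum_coordinates_square_part[symmetric]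
    by (simp add: sum.distrib sum_distrib_right axial_lift_def)
  also have "(real (card I) * ?D g ?z + (pderivative b (pderivative b g) ?z - ?D g ?z)) *\<^sub>R K X
      + (2 * axial_lift (?D g) X) *\<^sub>R euler_part I K X =
      axial_lift (bessel b ((real (card I) - 1) / 2 + k) g) X *\<^sub>R K X"
    unfolding euler scaleR_scaleR scaleR_add_left[symmetric] axial_lift_def bessel_def
    by (rule arg_cong[where f = "\<lambda>r. r *\<^sub>R K X"]) (simp add: field_simps)
  finally show ?thesis .
qed

end

lemma laplacian_funpow_axial_lift:
  fixes K :: "('p::{finite,linorder}, 'q::{finite,linorder}) biaxial \<Rightarrow> ('p + 'q) clifford"
  assumes g: "smooth_on S g" and K: "smooth_on UNIV K"
    and euler: "\<And>X. euler_part (range Inl) K X = k *\<^sub>R K X" "\<And>X. euler_part (range Inr) K X = l *\<^sub>R K X"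
    and harmonic: "\<And>X. laplacian K X = 0"
    and X: "X \<in> axial_domain S"
  shows "(laplacian ^^ n) (\<lambda>X. axial_lift g X *\<^sub>R K X) X =
    axial_lift ((axial_laplacian ((real CARD('p) - 1) / 2 + k) ((real CARD('q) - 1) / 2 + l) ^^ n) g) X *\<^sub>R K X"
  using X
proof (induction n arbitrary: X)
  case (Suc n)
  let ?\<Omega> = "axial_domain S :: (('p, 'q) biaxial) set"
  let ?A = "axial_laplacian ((real CARD('p) - 1) / 2 + k) ((real CARD('q) - 1) / 2 + l)"
  have K': "smooth_on ?\<Omega> K" by (rule smooth_on_subset[OF K]) simp
  have h: "smooth_on S ((?A ^^ n) g)"
    by (rule smooth_op_smooth[OF smooth_op_funpow[OF smooth_op_axial[OF S quadrant]] g])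
  have card: "card (range Inl :: ('p + 'q) set) = CARD('p)" "card (range Inr :: ('p + 'q) set) = CARD('q)"
    by (simp_all add: card_image)
  have "(laplacian ^^ Suc n) (\<lambda>X. axial_lift g X *\<^sub>R K X) X =
      laplacian (\<lambda>X. axial_lift ((?A ^^ n) g) X *\<^sub>R K X) X"
    using smooth_op_cong[OF smooth_op_laplacian[OF open_axial_domain[OF S]] Suc.IH Suc.prems] by simp
  also have "\<dots> = axial_lift (?A ((?A ^^ n) g)) X *\<^sub>R K X + axial_lift ((?A ^^ n) g) X *\<^sub>R laplacian K X"
    unfolding laplacian_eq_parts
    using laplacian_part_axial_lift[where I = "range Inl" and b = "(1, 0)", OF _ h K' Suc.prems euler(1)]
      laplacian_part_axial_lift[where I = "range Inr" and b = "(0, 1)", OF _ h K' Suc.prems euler(2)]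
    by (simp add: card axial_laplacian_def axial_lift_def scaleR_add_left scaleR_add_right)
  finally show ?case by (simp add: harmonic)
qed simp

lemma axial_funpow_divide_fst:
  assumes "smooth_on S f" "z \<in> S"
  shows "(axial_laplacian 1 b ^^ n) (\<lambda>z. f z / fst z) z = (axial_laplacian 0 b ^^ n) f z / fst z"
proof -
  define T :: "(real \<times> real \<Rightarrow> real) \<Rightarrow> real \<times> real \<Rightarrow> real" where "T f = (\<lambda>z. f z / fst z)" for f
  have "(axial_laplacian 1 b ^^ n) (T f) z = T ((axial_laplacian 0 b ^^ n) f) z"
  proof (rule smooth_op_intertwine_funpow[OF _ _ _ _ assms])
    show "smooth_op S T"
      unfolding T_def[abs_def] by (rule smooth_op_divide_fst[OF S quadrant])
    show "axial_laplacian 1 b (T f) z = T (axial_laplacian 0 b f) z" if "smooth_on S f" "z \<in> S" for f z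
      unfolding T_def by (rule axial_divide_fst[OF S quadrant that])
  qed (rule smooth_op_axial[OF S quadrant])+
  then show ?thesis by (simp add: T_def)
qed

lemma axial_funpow_divide_snd:
  assumes "smooth_on S f" "z \<in> S"
  shows "(axial_laplacian a 1 ^^ n) (\<lambda>z. f z / snd z) z = (axial_laplacian a 0 ^^ n) f z / snd z"
proof -
  define T :: "(real \<times> real \<Rightarrow> real) \<Rightarrow> real \<times> real \<Rightarrow> real" where "T f = (\<lambda>z. f z / snd z)" for f
  have "(axial_laplacian a 1 ^^ n) (T f) z = T ((axial_laplacian a 0 ^^ n) f) z"
  proof (rule smooth_op_intertwine_funpow[OF _ _ _ _ assms])
    show "smooth_op S T"
      unfolding T_def[abs_def] by (rule smooth_op_divide_snd[OF S quadrant])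
    show "axial_laplacian a 1 (T f) z = T (axial_laplacian a 0 f) z" if "smooth_on S f" "z \<in> S" for f z
      unfolding T_def by (rule axial_divide_snd[OF S quadrant that])
  qed (rule smooth_op_axial[OF S quadrant])+
  then show ?thesis by (simp add: T_def)
qed

lemma euler_D1:
  assumes h: "smooth_on S h" and z: "z \<in> S"
  shows "(fst z)\<^sup>2 * D1 (rderivs s t (\<lambda>z. h z / fst z)) z + (2 * real s + 1) * rderivs s t (\<lambda>z. h z / fst z) z = rderivs s t (pderivative (1, 0) h) z"
proof -
  have "fst z \<noteq> 0" using z quadrant by auto
  then show ?thesis
    using euler_rderivs[OF S nonzero h z, of "(1, 0)" "(0, 1)" s t]
    by (simp add: Basis_plane inner_prod_def rderiv_def[of "(1, 0)" "(D1 ^^ s) _"] power2_eq_square)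
qed

lemma euler_D2:
  assumes h: "smooth_on S h" and z: "z \<in> S"
  shows "(snd z)\<^sup>2 * D2 (rderivs s t (\<lambda>z. h z / snd z)) z + (2 * real t + 1) * rderivs s t (\<lambda>z. h z / snd z) z = rderivs s t (pderivative (0, 1) h) z"
proof -
  have nz: "snd z \<noteq> 0" using z quadrant by auto
  have comm: "rderivs s t f z = (D2 ^^ t) ((D1 ^^ s) f) z" if "smooth_on S f" "z \<in> S" for f z
    using rderivs_commute[OF S nonzero that] by (simp add: Basis_plane)
  have hd: "smooth_on S (\<lambda>z. h z / snd z)" and dh: "smooth_on S (pderivative (0, 1) h)"
    using smooth_op_smooth[OF smooth_op_divide_snd[OF S quadrant] h]
      smooth_on_pderivative[OF h] by (simp_all add: Basis_plane)
  have "pderivative (0, 1) (rderivs s t (\<lambda>z. h z / snd z)) z = pderivative (0, 1) ((D2 ^^ t) ((D1 ^^ s) (\<lambda>z. h z / snd z))) z"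
    by (rule pderivative_cong[OF S z comm[OF hd]])
  then show ?thesis
    using euler_rderivs[OF S nonzero h z, of "(0, 1)" "(1, 0)" t s] nz
    by (simp add: Basis_plane inner_prod_def rderiv_def[of "(0, 1)" "(D1 ^^ s) _"] power2_eq_square
        comm[OF hd z] comm[OF dh z])
qed

lemma D1_rderivs: "smooth_on S h \<Longrightarrow> z \<in> S \<Longrightarrow> D1 (rderivs s t h) z = rderivs s t (D1 h) z"
proof -
  assume h: "smooth_on S h" and z: "z \<in> S"
  note D = smooth_op_D[OF S quadrant]
  have "(D2 ^^ t) (D1 h) y = D1 ((D2 ^^ t) h) y" if "y \<in> S" for y
    using that by (intro smooth_op_intertwine_funpow[OF D(2) D(2) D(1) _ h]
        rderiv_commute[OF S nonzero]) (simp_all add: Basis_plane)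
  from smooth_op_cong[OF smooth_op_funpow[OF D(1), of s] this z]
  show ?thesis by (simp add: funpow_swap1)
qed

lemma D2_rderivs: "smooth_on S h \<Longrightarrow> z \<in> S \<Longrightarrow> D2 (rderivs s t h) z = rderivs s t (D2 h) z"
proof -
  assume h: "smooth_on S h" and z: "z \<in> S"
  note D = smooth_op_D[OF S quadrant]
  have "(D1 ^^ s) (D2 ((D2 ^^ t) h)) z = D2 (rderivs s t h) z"
    using z by (intro smooth_op_intertwine_funpow[OF D(1) D(1) D(2)]
        rderiv_commute[OF S nonzero]
        smooth_op_smooth[OF smooth_op_funpow[OF D(2)] h]) (simp_all add: Basis_plane)
  then show ?thesis by (simp add: funpow_swap1)
qed

context
  fixes U V :: "real \<times> real \<Rightarrow> real"
  assumes U: "smooth_on S U" and V: "smooth_on S V"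
    and cr: "\<And>z. z \<in> S \<Longrightarrow> pderivative (1, 0) U z = - pderivative (0, 1) V z"
      "\<And>z. z \<in> S \<Longrightarrow> pderivative (1, 0) V z = pderivative (0, 1) U z"
begin

lemma pderivative_quotients:
  assumes "smooth_on S h" "z \<in> S"
  shows "pderivative (0, 1) (\<lambda>z. h z / fst z) z = pderivative (0, 1) h z / fst z"
    and "pderivative (1, 0) (\<lambda>z. h z / snd z) z = pderivative (1, 0) h z / snd z"
  using pderivative_divide_coordinate[OF S nonzero assms, of "(1, 0)" "(0, 1)"]
    pderivative_divide_coordinate[OF S nonzero assms, of "(0, 1)" "(1, 0)"]
  by (simp_all add: Basis_plane inner_prod_def)

text \<open>
  The system that \<open>dirac_even_combination\<close> asks for. By \<open>euler_rderivs\<close> both equations are images under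
  \<open>rderivs s t\<close> of the Cauchy-Riemann equations for \<open>U\<close> and \<open>V\<close>, divided by a radius.
\<close>

lemma vekua_system_even:
  assumes z: "z \<in> S"
  defines "W \<equiv> \<lambda>z. V z / fst z / snd z"
  shows "D1 (rderivs s t U) z + (snd z)\<^sup>2 * D2 (rderivs s t W) z + (2 * real t + 1) * rderivs s t W z = 0"
    and "D2 (rderivs s t U) z - (fst z)\<^sup>2 * D1 (rderivs s t W) z - (2 * real s + 1) * rderivs s t W z = 0"
proof -
  note op = smooth_op_D_funpow[OF S quadrant, of s t]
  note D = smooth_op_D[OF S quadrant]
  note sq = smooth_op_smooth[OF smooth_op_divide_fst[OF S quadrant] V]
    smooth_op_smooth[OF smooth_op_divide_snd[OF S quadrant] V]
  have "(snd z)\<^sup>2 * D2 (rderivs s t W) z + (2 * real t + 1) * rderivs s t W z = rderivs s t (pderivative (0, 1) (\<lambda>z. V z / fst z)) z"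
    unfolding W_def by (rule euler_D2[OF sq(1) z])
  also have "\<dots> = rderivs s t (\<lambda>z. (- 1) *\<^sub>R D1 U z) z"
    by (rule smooth_op_cong[OF op _ z]) (simp add: pderivative_quotients V rderiv_def cr inner_prod_def)
  also have "\<dots> = - D1 (rderivs s t U) z"
    using smooth_op_scale[OF op smooth_op_smooth[OF D(1) U] z, of "-1"] D1_rderivs[OF U z] by simp
  finally show "D1 (rderivs s t U) z + (snd z)\<^sup>2 * D2 (rderivs s t W) z + (2 * real t + 1) * rderivs s t W z = 0" by simp
  have W: "W = (\<lambda>z. V z / snd z / fst z)" by (simp add: W_def fun_eq_iff mult.commute)
  have "(fst z)\<^sup>2 * D1 (rderivs s t W) z + (2 * real s + 1) * rderivs s t W z = rderivs s t (pderivative (1, 0) (\<lambda>z. V z / snd z)) z"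
    unfolding W by (rule euler_D1[OF sq(2) z])
  also have "\<dots> = rderivs s t (D2 U) z"
    by (rule smooth_op_cong[OF op _ z]) (simp add: pderivative_quotients V rderiv_def cr inner_prod_def)
  also have "\<dots> = D2 (rderivs s t U) z" by (rule D2_rderivs[OF U z, symmetric])
  finally show "D2 (rderivs s t U) z - (fst z)\<^sup>2 * D1 (rderivs s t W) z - (2 * real s + 1) * rderivs s t W z = 0" by simp
qed

text \<open>
  The system that \<open>dirac_odd_combination\<close> asks for, again an image of the Cauchy-Riemann equations.
\<close>

lemma vekua_system_odd:
  assumes z: "z \<in> S"
  defines "A \<equiv> \<lambda>z. U z / fst z" and "B \<equiv> \<lambda>z. V z / snd z"
  shows "(fst z)\<^sup>2 * D1 (rderivs s t A) z + (2 * real s + 1) * rderivs s t A z + ((snd z)\<^sup>2 * D2 (rderivs s t B) z + (2 * real t + 1) * rderivs s t B z) = 0"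
    and "D1 (rderivs s t B) z = D2 (rderivs s t A) z"
proof -
  note op = smooth_op_D_funpow[OF S quadrant, of s t]
  have sA: "smooth_on S A" and sB: "smooth_on S B"
    unfolding A_def B_def by (intro smooth_op_smooth[OF smooth_op_divide_fst[OF S quadrant] U]
        smooth_op_smooth[OF smooth_op_divide_snd[OF S quadrant] V])+
  have dV: "smooth_on S (pderivative (0, 1) V)" by (rule smooth_on_pderivative[OF V]) (simp add: Basis_plane)
  have "(fst z)\<^sup>2 * D1 (rderivs s t A) z + (2 * real s + 1) * rderivs s t A z + ((snd z)\<^sup>2 * D2 (rderivs s t B) z + (2 * real t + 1) * rderivs s t B z)
      = rderivs s t (pderivative (1, 0) U) z + rderivs s t (pderivative (0, 1) V) z"
    unfolding A_def B_def euler_D1[OF U z] euler_D2[OF V z] ..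
  also have "rderivs s t (pderivative (1, 0) U) z = rderivs s t (\<lambda>z. (- 1) *\<^sub>R pderivative (0, 1) V z) z"
    by (rule smooth_op_cong[OF op _ z]) (simp add: cr)
  also have "\<dots> + rderivs s t (pderivative (0, 1) V) z = 0"
    using smooth_op_scale[OF op dV z, of "-1"] by simp
  finally show "(fst z)\<^sup>2 * D1 (rderivs s t A) z + (2 * real s + 1) * rderivs s t A z
      + ((snd z)\<^sup>2 * D2 (rderivs s t B) z + (2 * real t + 1) * rderivs s t B z) = 0" .
  have "rderivs s t (D1 B) z = rderivs s t (D2 A) z"
    by (rule smooth_op_cong[OF op _ z])
      (simp add: A_def B_def rderiv_def pderivative_quotients U V cr inner_prod_def mult.commute)
  then show "D1 (rderivs s t B) z = D2 (rderivs s t A) z" by (simp add: D1_rderivs[OF sB z] D2_rderivs[OF sA z])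
qed

end

end

section \<open>The Fueter construction for bimonogenic factors\<close>

text \<open>
  The properties of \<open>R = P\<^sub>k(x) P\<^sub>\<ell>(y)\<close> that enter the construction. Homogeneity is
  expressed by Euler's relations, which is how the degrees reach the weights of the radial operators.
\<close>

definition bimonogenic ::
  "real \<Rightarrow> real \<Rightarrow> (('p::{finite,linorder}, 'q::{finite,linorder}) biaxial \<Rightarrow> ('p + 'q) clifford) \<Rightarrow> bool"
  where "bimonogenic k l R \<longleftrightarrow> smooth_on UNIV R \<and>
    (\<forall>X. dirac_part (range Inl) R X = 0 \<and> dirac_part (range Inr) R X = 0 \<and>
      euler_part (range Inl) R X = k *\<^sub>R R X \<and> euler_part (range Inr) R X = l *\<^sub>R R X)"

abbreviation "vec_x \<equiv> vec_part (range Inl)"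
abbreviation "vec_y \<equiv> vec_part (range Inr)"

lemma card_range_Inl: "card (range Inl :: ('p::finite + 'q::finite) set) = CARD('p)"
  and card_range_Inr: "card (range Inr :: ('p::finite + 'q::finite) set) = CARD('q)"
  by (simp_all add: card_image)

lemma disjoint_ranges: "range Inl \<inter> range Inr = {}" "range Inr \<inter> range Inl = {}"
  by auto

lemma ranges_neq: "range Inl \<noteq> (range Inr :: ('a + 'b) set)" "range Inr \<noteq> (range Inl :: ('a + 'b) set)"
  by auto

lemma dirac_part_add:
  assumes "F differentiable (at X)" "G differentiable (at X)"
  shows "dirac_part I (\<lambda>X. F X + G X) X = dirac_part I F X + dirac_part I G X"
  by (simp add: dirac_part_def pderivative_add[OF assms] distrib_left sum.distrib)

context
  fixes k l :: real and R :: "('p::{finite,linorder}, 'q::{finite,linorder}) biaxial \<Rightarrow> ('p + 'q) clifford"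
  assumes R: "bimonogenic k l R"
begin

lemma bimonogenic_smooth: "smooth_on UNIV R"
  and bimonogenic_dirac: "dirac_part (range Inl) R X = 0" "dirac_part (range Inr) R X = 0"
  and bimonogenic_euler: "euler_part (range Inl) R X = k *\<^sub>R R X" "euler_part (range Inr) R X = l *\<^sub>R R X"
  using R unfolding bimonogenic_def by blast+

lemma bimonogenic_smooth_products:
  "smooth_on UNIV (\<lambda>X. vec_x X * R X)" "smooth_on UNIV (\<lambda>X. vec_y X * R X)"
  "smooth_on UNIV (\<lambda>X. vec_x X * (vec_y X * R X))"
  by (intro smooth_on_vec_part_mult open_UNIV bimonogenic_smooth)+

lemma bimonogenic_differentiable:
  "R differentiable (at X)" "(\<lambda>X. vec_x X * R X) differentiable (at X)" "(\<lambda>X. vec_y X * R X) differentiable (at X)"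
  "(\<lambda>X. vec_x X * (vec_y X * R X)) differentiable (at X)"
  using smooth_on_differentiable[OF bimonogenic_smooth] bimonogenic_smooth_products[THEN smooth_on_differentiable] by auto

lemma bimonogenic_harmonic: "laplacian_part (range Inl) R X = 0" "laplacian_part (range Inr) R X = 0"
proof -
  have "dirac_part I (dirac_part J R) X = 0" if "J = range Inl \<or> J = range Inr" for I J
  proof -
    have "dirac_part J R = (\<lambda>_. 0)" using that bimonogenic_dirac by (auto simp: fun_eq_iff)
    then show ?thesis by (simp add: dirac_part_def)
  qed
  then show "laplacian_part (range Inl) R X = 0" "laplacian_part (range Inr) R X = 0"
    using dirac_part_square[OF open_UNIV bimonogenic_smooth, of X] by (metis UNIV_I neg_equal_0_iff_equal)+
qed

text \<open>
  In the mixed cases the Dirac operator passes the vector with a sign and then annihilates \<open>R\<close>; in the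
  other cases the constants \<open>p + 2 k\<close> and \<open>q + 2 l\<close> of the first order systems arise.
\<close>

lemma bimonogenic_dirac_vec:
  "dirac_part (range Inl) (\<lambda>X. vec_x X * R X) X = - ((real CARD('p) + 2 * k) *\<^sub>R R X)"
  "dirac_part (range Inr) (\<lambda>X. vec_x X * R X) X = 0"
  "dirac_part (range Inl) (\<lambda>X. vec_y X * R X) X = 0"
  "dirac_part (range Inr) (\<lambda>X. vec_y X * R X) X = - ((real CARD('q) + 2 * l) *\<^sub>R R X)"
  by (simp_all add: dirac_part_vec_part_same dirac_part_vec_part_other disjoint_ranges bimonogenic_differentiable
      bimonogenic_dirac bimonogenic_euler card_range_Inl card_range_Inr scaleR_add_left)

lemma bimonogenic_euler_vec:
  "euler_part (range Inl) (\<lambda>X. vec_x X * R X) X = (k + 1) *\<^sub>R (vec_x X * R X)"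
  "euler_part (range Inr) (\<lambda>X. vec_x X * R X) X = l *\<^sub>R (vec_x X * R X)"
  "euler_part (range Inl) (\<lambda>X. vec_y X * R X) X = k *\<^sub>R (vec_y X * R X)"
  "euler_part (range Inr) (\<lambda>X. vec_y X * R X) X = (l + 1) *\<^sub>R (vec_y X * R X)"
  by (simp_all add: euler_part_vec_part disjoint_ranges ranges_neq bimonogenic_differentiable bimonogenic_euler scaleR_add_left)

lemma bimonogenic_dirac_vec_vec:
  "dirac_part (range Inl) (\<lambda>X. vec_x X * (vec_y X * R X)) X = - ((real CARD('p) + 2 * k) *\<^sub>R (vec_y X * R X))"
  "dirac_part (range Inr) (\<lambda>X. vec_x X * (vec_y X * R X)) X = (real CARD('q) + 2 * l) *\<^sub>R (vec_x X * R X)"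
  by (simp_all add: dirac_part_vec_part_same dirac_part_vec_part_other disjoint_ranges bimonogenic_differentiable
      bimonogenic_dirac_vec bimonogenic_euler_vec card_range_Inl scaleR_add_left distrib_left right_diff_distrib)

lemma bimonogenic_euler_vec_vec:
  "euler_part (range Inl) (\<lambda>X. vec_x X * (vec_y X * R X)) X = (k + 1) *\<^sub>R (vec_x X * (vec_y X * R X))"
  "euler_part (range Inr) (\<lambda>X. vec_x X * (vec_y X * R X)) X = (l + 1) *\<^sub>R (vec_x X * (vec_y X * R X))"
  by (simp_all add: euler_part_vec_part disjoint_ranges ranges_neq bimonogenic_differentiable bimonogenic_euler_vec
      scaleR_add_left distrib_left)

text \<open>
  Multiplication by a vector preserves harmonicity because the additional term of the product rule is
  the Dirac operator on the other factor, which vanishes.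
\<close>

lemma bimonogenic_harmonic_products:
  "laplacian R X = 0" "laplacian (\<lambda>X. vec_x X * R X) X = 0" "laplacian (\<lambda>X. vec_y X * R X) X = 0"
  "laplacian (\<lambda>X. vec_x X * (vec_y X * R X)) X = 0"
proof -
  note L = laplacian_part_vec_part[OF open_UNIV _ UNIV_I]
  have y: "laplacian_part (range Inl) (\<lambda>X. vec_y X * R X) X = 0" "laplacian_part (range Inr) (\<lambda>X. vec_y X * R X) X = 0" for X
    by (simp_all add: L[OF bimonogenic_smooth] disjoint_ranges ranges_neq bimonogenic_harmonic bimonogenic_dirac)
  show "laplacian R X = 0" by (simp add: laplacian_eq_parts bimonogenic_harmonic)
  show "laplacian (\<lambda>X. vec_x X * R X) X = 0" "laplacian (\<lambda>X. vec_y X * R X) X = 0"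
    by (simp_all add: laplacian_eq_parts L[OF bimonogenic_smooth] disjoint_ranges ranges_neq bimonogenic_harmonic bimonogenic_dirac)
  show "laplacian (\<lambda>X. vec_x X * (vec_y X * R X)) X = 0"
    by (simp add: laplacian_eq_parts L[OF bimonogenic_smooth_products(2)] disjoint_ranges ranges_neq y bimonogenic_dirac_vec)
qed

lemma vec_mult_identities:
  "vec_x X * (vec_x X * F) = - ((norm (fst X))\<^sup>2 *\<^sub>R F)"
  "vec_y X * (vec_y X * F) = - ((norm (snd X))\<^sup>2 *\<^sub>R F)"
  "vec_y X * (vec_x X * F) = - (vec_x X * (vec_y X * F))"
  for X :: "('p, 'q) biaxial"
  by (simp_all add: vec_part_square sum_coordinates_square vec_part_anticommute[of "range Inr" "range Inl"]
      disjoint_ranges flip: mult.assoc)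

context
  fixes S :: "(real \<times> real) set"
  assumes S: "open S" and quadrant: "S \<subseteq> {(x, y). 0 < x \<and> 0 < y}"
begin

lemma differentiable_lift:
  fixes X :: "('p, 'q) biaxial" and K :: "('p, 'q) biaxial \<Rightarrow> ('p + 'q) clifford"
  assumes "smooth_on S g" "X \<in> axial_domain S" "K differentiable (at X)"
  shows "(\<lambda>X. axial_lift g X *\<^sub>R K X) differentiable (at X)"
proof -
  have "axial_lift g differentiable (at X)"
    using has_derivative_axial_lift[OF S quadrant assms(1,2)] by (auto simp: differentiable_def)
  then show ?thesis using assms(3) by (rule bounded_bilinear.differentiable_prod[OF bounded_bilinear_scaleR])
qed

text \<open>
  The result is a combination of \<open>x R\<close> and \<open>y R\<close>; the two equations say that their coefficients vanish.
\<close>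

lemma dirac_even_combination:
  assumes a: "smooth_on S a" and b: "smooth_on S b"
    and system: "\<And>z. z \<in> S \<Longrightarrow> D1 a z + (snd z)\<^sup>2 * D2 b z + (real CARD('q) + 2 * l) * b z = 0"
      "\<And>z. z \<in> S \<Longrightarrow> D2 a z - (fst z)\<^sup>2 * D1 b z - (real CARD('p) + 2 * k) * b z = 0"
    and X: "X \<in> axial_domain S"
  shows "dirac (\<lambda>X. axial_lift a X *\<^sub>R R X + axial_lift b X *\<^sub>R (vec_x X * (vec_y X * R X))) X = 0"
proof -
  let ?L = "\<lambda>g. axial_lift g X"
  have z: "(norm (fst X), norm (snd X)) \<in> S" using X by (simp add: axial_domain_def)
  note Dx = dirac_part_axial_lift[OF S quadrant, of "range Inl" "(1, 0)"]
  note Dy = dirac_part_axial_lift[OF S quadrant, of "range Inr" "(0, 1)"]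
  have "dirac (\<lambda>X. axial_lift a X *\<^sub>R R X + axial_lift b X *\<^sub>R (vec_x X * (vec_y X * R X))) X =
      (?L (D1 a) + (norm (snd X))\<^sup>2 * ?L (D2 b) + (real CARD('q) + 2 * l) * ?L b) *\<^sub>R (vec_x X * R X)
      + (?L (D2 a) - (norm (fst X))\<^sup>2 * ?L (D1 b) - (real CARD('p) + 2 * k) * ?L b) *\<^sub>R (vec_y X * R X)"
    by (simp add: dirac_eq_parts dirac_part_add differentiable_lift a b X bimonogenic_differentiable Dx Dy bimonogenic_dirac
        bimonogenic_dirac_vec_vec vec_mult_identities algebra_simps)
  also have "\<dots> = 0" using system[OF z] by (simp add: axial_lift_def)
  finally show ?thesis .
qed

text \<open>
  Here the two equations are the vanishing of the coefficients of \<open>R\<close> and of \<open>x y R\<close>.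
\<close>

lemma dirac_odd_combination:
  assumes a: "smooth_on S a" and b: "smooth_on S b"
    and system: "\<And>z. z \<in> S \<Longrightarrow> (fst z)\<^sup>2 * D1 a z + (real CARD('p) + 2 * k) * a z +
        ((snd z)\<^sup>2 * D2 b z + (real CARD('q) + 2 * l) * b z) = 0"
      "\<And>z. z \<in> S \<Longrightarrow> D1 b z = D2 a z"
    and X: "X \<in> axial_domain S"
  shows "dirac (\<lambda>X. axial_lift a X *\<^sub>R (vec_x X * R X) + axial_lift b X *\<^sub>R (vec_y X * R X)) X = 0"
proof -
  let ?L = "\<lambda>g. axial_lift g X"
  have z: "(norm (fst X), norm (snd X)) \<in> S" using X by (simp add: axial_domain_def)
  note Dx = dirac_part_axial_lift[OF S quadrant, of "range Inl" "(1, 0)"]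
  note Dy = dirac_part_axial_lift[OF S quadrant, of "range Inr" "(0, 1)"]
  have "dirac (\<lambda>X. axial_lift a X *\<^sub>R (vec_x X * R X) + axial_lift b X *\<^sub>R (vec_y X * R X)) X =
      (- ((norm (fst X))\<^sup>2 * ?L (D1 a) + (real CARD('p) + 2 * k) * ?L a +
        ((norm (snd X))\<^sup>2 * ?L (D2 b) + (real CARD('q) + 2 * l) * ?L b))) *\<^sub>R R X
      + (?L (D1 b) - ?L (D2 a)) *\<^sub>R (vec_x X * (vec_y X * R X))"
    by (simp add: dirac_eq_parts dirac_part_add differentiable_lift a b X bimonogenic_differentiable Dx Dy bimonogenic_dirac
        bimonogenic_dirac_vec vec_mult_identities algebra_simps)
  also have "\<dots> = 0" using system[OF z] by (simp add: axial_lift_def)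
  finally show ?thesis .
qed

lemma laplacian_funpow_lift_products:
  assumes g: "smooth_on S g" and X: "X \<in> axial_domain S"
  shows "(laplacian ^^ n) (\<lambda>X. axial_lift g X *\<^sub>R R X) X =
      axial_lift ((axial_laplacian ((real CARD('p) - 1) / 2 + k) ((real CARD('q) - 1) / 2 + l) ^^ n) g) X *\<^sub>R R X"
    and "(laplacian ^^ n) (\<lambda>X. axial_lift g X *\<^sub>R (vec_x X * R X)) X =
      axial_lift ((axial_laplacian ((real CARD('p) - 1) / 2 + (k + 1)) ((real CARD('q) - 1) / 2 + l) ^^ n) g) X *\<^sub>R (vec_x X * R X)"
    and "(laplacian ^^ n) (\<lambda>X. axial_lift g X *\<^sub>R (vec_y X * R X)) X =
      axial_lift ((axial_laplacian ((real CARD('p) - 1) / 2 + k) ((real CARD('q) - 1) / 2 + (l + 1)) ^^ n) g) X *\<^sub>R (vec_y X * R X)"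
    and "(laplacian ^^ n) (\<lambda>X. axial_lift g X *\<^sub>R (vec_x X * (vec_y X * R X))) X =
      axial_lift ((axial_laplacian ((real CARD('p) - 1) / 2 + (k + 1)) ((real CARD('q) - 1) / 2 + (l + 1)) ^^ n) g) X
        *\<^sub>R (vec_x X * (vec_y X * R X))"
  by (rule laplacian_funpow_axial_lift[OF S quadrant g bimonogenic_smooth bimonogenic_euler bimonogenic_harmonic_products(1) X]
      laplacian_funpow_axial_lift[OF S quadrant g bimonogenic_smooth_products(1) bimonogenic_euler_vec(1,2) bimonogenic_harmonic_products(2) X]
      laplacian_funpow_axial_lift[OF S quadrant g bimonogenic_smooth_products(2) bimonogenic_euler_vec(3,4) bimonogenic_harmonic_products(3) X]
      laplacian_funpow_axial_lift[OF S quadrant g bimonogenic_smooth_products(3) bimonogenic_euler_vec_vec bimonogenic_harmonic_products(4) X])+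

lemma smooth_lift:
  assumes "smooth_on S g" "smooth_on UNIV K"
  shows "smooth_on (axial_domain S :: (('p, 'q) biaxial) set) (\<lambda>X. axial_lift g X *\<^sub>R K X)"
  by (intro smooth_on_scaleR open_axial_domain S smooth_on_axial_lift[OF S quadrant] assms smooth_on_subset[OF assms(2)]) simp

end

end

text \<open>
  Both the iterated Laplacian and the Dirac operator are local, so a closed form of the
  iterated Laplacian on \<open>\<Omega>\<close> is enough.
\<close>

lemma monogenic_on_laplacian_funpow:
  assumes \<Omega>: "open \<Omega>" and F: "\<And>X. X \<in> \<Omega> \<Longrightarrow> F X = F' X" and F': "smooth_on \<Omega> F'"
    and G: "\<And>X. X \<in> \<Omega> \<Longrightarrow> (laplacian ^^ n) F' X = G X" and dirac: "\<And>X. X \<in> \<Omega> \<Longrightarrow> dirac G X = 0"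
  shows "monogenic_on \<Omega> ((laplacian ^^ n) F)"
  unfolding monogenic_on_def
proof (intro conjI ballI)
  note lap = smooth_op_funpow[OF smooth_op_laplacian[OF \<Omega>], of n]
  have eq: "(laplacian ^^ n) F X = G X" if "X \<in> \<Omega>" for X
    using smooth_op_cong[OF lap F that] G[OF that] by simp
  have "smooth_on \<Omega> ((laplacian ^^ n) F)"
    using smooth_on_cong[OF \<Omega> F[symmetric] F'] by (rule smooth_op_smooth[OF lap])
  then show "C_on 1 \<Omega> ((laplacian ^^ n) F)" unfolding smooth_on_def by (intro Ck_on_imp_C_on) blast
  fix X assume X: "X \<in> \<Omega>"
  have "dirac ((laplacian ^^ n) F) X = dirac G X"
    unfolding dirac_eq_parts dirac_part_def using pderivative_cong[OF \<Omega> X eq] by simp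
  with dirac[OF X] show "dirac ((laplacian ^^ n) F) X = 0" by simp
qed (rule \<Omega>)

text \<open>
  The equations for \<open>s\<close> and \<open>t\<close> have solutions exactly when \<open>p\<close> and \<open>q\<close> are odd. Then the factors in front of
  \<open>R\<close>, \<open>x R\<close>, \<open>y R\<close>, \<open>x y R\<close> have weights \<open>(s, t)\<close>, \<open>(s + 1, t)\<close>, \<open>(s, t + 1)\<close>, \<open>(s + 1, t + 1)\<close>, that is,
  base weights \<open>0\<close> or \<open>1\<close> raised by \<open>(s, t)\<close> in all cases.
\<close>

theorem fueter_bimonogenic:
  fixes R :: "('p::{finite,linorder}, 'q::{finite,linorder}) biaxial \<Rightarrow> ('p + 'q) clifford"
    and k l :: nat
  assumes R: "bimonogenic k l R"
    and S: "open S" and quadrant: "S \<subseteq> {(x, y). 0 < x \<and> 0 < y}"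
    and w: "\<And>z. z \<in> S \<Longrightarrow> w z = of_real (u z) + \<i> * of_real (v z)"
    and C: "C_on (2 * \<mu> + 1) S w" and 0: "\<And>z. z \<in> S \<Longrightarrow> wirtinger ((laplacian ^^ \<mu>) w) z = 0"
    and s: "real s = (real CARD('p) - 1) / 2 + k" and t: "real t = (real CARD('q) - 1) / 2 + l"
  shows "(\<And>X. X \<in> axial_domain S \<Longrightarrow> F X = axial_lift u X *\<^sub>R R X +
        axial_lift (\<lambda>z. v z / fst z / snd z) X *\<^sub>R (vec_x X * (vec_y X * R X))) \<Longrightarrow>
      monogenic_on (axial_domain S) ((laplacian ^^ (\<mu> + s + t)) F)"
    and "(\<And>X. X \<in> axial_domain S \<Longrightarrow> F X = axial_lift (\<lambda>z. u z / fst z) X *\<^sub>R (vec_x X * R X) +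
        axial_lift (\<lambda>z. v z / snd z) X *\<^sub>R (vec_y X * R X)) \<Longrightarrow>
      monogenic_on (axial_domain S) ((laplacian ^^ (\<mu> + s + t)) F)"
proof -
  let ?N = "\<mu> + s + t" and ?\<Omega> = "axial_domain S :: (('p, 'q) biaxial) set"
  let ?U = "(axial_laplacian 0 0 ^^ \<mu>) u" and ?V = "(axial_laplacian 0 0 ^^ \<mu>) v"
  note cs = conjugate_system[OF S w C 0]
  note ax = smooth_op_funpow[OF smooth_op_axial[OF S quadrant]]
  note opM = smooth_op_D_funpow[OF S quadrant, of s t]
  note sdiv = smooth_op_smooth[OF smooth_op_divide_fst[OF S quadrant]]
    smooth_op_smooth[OF smooth_op_divide_snd[OF S quadrant]]
  have \<Omega>: "open ?\<Omega>" by (rule open_axial_domain[OF S])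
  have sU: "smooth_on S ?U" using cs(1) by (rule smooth_op_smooth[OF ax])
  have sV: "smooth_on S ?V" using cs(2) by (rule smooth_op_smooth[OF ax])
  obtain c where c: "\<And>a b f z. smooth_on S f \<Longrightarrow> (\<And>z. z \<in> S \<Longrightarrow> (axial_laplacian a b ^^ Suc \<mu>) f z = 0) \<Longrightarrow> z \<in> S \<Longrightarrow>
      (axial_laplacian (a + real s) (b + real t) ^^ ?N) f z = c * (D1 ^^ s) ((D2 ^^ t) ((axial_laplacian a b ^^ \<mu>) f)) z"
    using axial_funpow_shift[OF S quadrant, of \<mu> s t] by blast
  \<comment> \<open>One operator \<open>M\<close> serves all components because \<open>c\<close> does not depend on the weights.\<close>
  define M where "M h z = c *\<^sub>R (D1 ^^ s) ((D2 ^^ t) h) z" for h z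
  have M: "smooth_op S M"
    using smooth_op_compose[OF smooth_op_mult[OF S smooth_on_const[of S c], where 'b = real] opM]
    by (simp add: M_def[abs_def])
  have DM: "D1 (M h) z = c * D1 ((D1 ^^ s) ((D2 ^^ t) h)) z" "D2 (M h) z = c * D2 ((D1 ^^ s) ((D2 ^^ t) h)) z"
    if "smooth_on S h" "z \<in> S" for h z
    using smooth_op_scale[OF smooth_op_D(1)[OF S quadrant] smooth_op_smooth[OF opM that(1)] that(2), of c]
      smooth_op_scale[OF smooth_op_D(2)[OF S quadrant] smooth_op_smooth[OF opM that(1)] that(2), of c]
    by (simp_all add: M_def[abs_def])
  have Mcong: "M f z = M g z" if "\<And>z. z \<in> S \<Longrightarrow> f z = g z" "z \<in> S" for f g z
    using that by (rule smooth_op_cong[OF M])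
  let ?W = "\<lambda>z. v z / fst z / snd z" and ?W\<mu> = "\<lambda>z. ?V z / fst z / snd z"
  have sW: "smooth_on S ?W" "smooth_on S ?W\<mu>"
    using sdiv(2)[OF sdiv(1)[OF cs(2)]] sdiv(2)[OF sdiv(1)[OF sV]] by simp_all
  have pow_W: "(axial_laplacian 1 1 ^^ n) ?W z = (axial_laplacian 0 0 ^^ n) v z / fst z / snd z" if "z \<in> S" for n z
    using axial_funpow_divide_snd[OF S quadrant sdiv(1)[OF cs(2)] that, where a = 1 and n = n]
      axial_funpow_divide_fst[OF S quadrant cs(2) that, where b = 0 and n = n] by simp
  have pow_A: "(axial_laplacian 1 0 ^^ n) (\<lambda>z. u z / fst z) z = (axial_laplacian 0 0 ^^ n) u z / fst z" if "z \<in> S" for n z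
    by (rule axial_funpow_divide_fst[OF S quadrant cs(1) that])
  have pow_B: "(axial_laplacian 0 1 ^^ n) (\<lambda>z. v z / snd z) z = (axial_laplacian 0 0 ^^ n) v z / snd z" if "z \<in> S" for n z
    by (rule axial_funpow_divide_snd[OF S quadrant cs(2) that])
  have image_u: "(axial_laplacian (real s) (real t) ^^ ?N) u z = M ?U z" if "z \<in> S" for z
    using c[OF cs(1) cs(5) that] by (simp add: M_def)
  have image_W: "(axial_laplacian (real s + 1) (real t + 1) ^^ ?N) ?W z = M ?W\<mu> z" if z: "z \<in> S" for z
  proof -
    have "(axial_laplacian (real s + 1) (real t + 1) ^^ ?N) ?W z = M ((axial_laplacian 1 1 ^^ \<mu>) ?W) z"
      using c[OF sW(1) _ z, of 1 1] pow_W[of _ "Suc \<mu>"] cs(6) by (simp add: M_def add.commute del: funpow.simps)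
    also have "\<dots> = M ?W\<mu> z" using pow_W z by (rule Mcong)
    finally show ?thesis .
  qed
  have image_A: "(axial_laplacian (real s + 1) (real t) ^^ ?N) (\<lambda>z. u z / fst z) z = M (\<lambda>z. ?U z / fst z) z" if z: "z \<in> S" for z
  proof -
    have "(axial_laplacian (real s + 1) (real t) ^^ ?N) (\<lambda>z. u z / fst z) z = M ((axial_laplacian 1 0 ^^ \<mu>) (\<lambda>z. u z / fst z)) z"
      using c[OF sdiv(1)[OF cs(1)] _ z, of 1 0] pow_A[of _ "Suc \<mu>"] cs(5)
      by (simp add: M_def add.commute del: funpow.simps)
    also have "\<dots> = M (\<lambda>z. ?U z / fst z) z" using pow_A z by (rule Mcong)
    finally show ?thesis .
  qed
  have image_B: "(axial_laplacian (real s) (real t + 1) ^^ ?N) (\<lambda>z. v z / snd z) z = M (\<lambda>z. ?V z / snd z) z" if z: "z \<in> S" for z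
  proof -
    have "(axial_laplacian (real s) (real t + 1) ^^ ?N) (\<lambda>z. v z / snd z) z = M ((axial_laplacian 0 1 ^^ \<mu>) (\<lambda>z. v z / snd z)) z"
      using c[OF sdiv(2)[OF cs(2)] _ z, of 0 1] pow_B[of _ "Suc \<mu>"] cs(6)
      by (simp add: M_def add.commute del: funpow.simps)
    also have "\<dots> = M (\<lambda>z. ?V z / snd z) z" using pow_B z by (rule Mcong)
    finally show ?thesis .
  qed
  have index: "(real CARD('p) - 1) / 2 + (real k + 1) = real s + 1" "(real CARD('q) - 1) / 2 + (real l + 1) = real t + 1"
    using s t by simp_all
  note lap = laplacian_funpow_lift_products[OF R S quadrant, folded s t, unfolded index]
  have lap_add: "(laplacian ^^ ?N) (\<lambda>X. F X + G X) X = (laplacian ^^ ?N) F X + (laplacian ^^ ?N) G X"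
    if "smooth_on ?\<Omega> F" "smooth_on ?\<Omega> G" "X \<in> ?\<Omega>"
    for F G :: "('p, 'q) biaxial \<Rightarrow> ('p + 'q) clifford" and X
    using that by (rule smooth_op_add[OF smooth_op_funpow[OF smooth_op_laplacian[OF \<Omega>]]])
  have z: "(norm (fst X), norm (snd X)) \<in> S" if "X \<in> ?\<Omega>" for X using that by (simp add: axial_domain_def)
  note sl = smooth_lift[OF R S quadrant]
  note sR = bimonogenic_smooth[OF R] bimonogenic_smooth_products[OF R]
  have st: "real CARD('p) + 2 * real k = 2 * real s + 1" "real CARD('q) + 2 * real l = 2 * real t + 1"
    using s t by (simp_all add: field_simps)
  show "monogenic_on ?\<Omega> ((laplacian ^^ ?N) F)"
    if F: "\<And>X. X \<in> ?\<Omega> \<Longrightarrow> F X = axial_lift u X *\<^sub>R R X + axial_lift ?W X *\<^sub>R (vec_x X * (vec_y X * R X))"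
  proof (rule monogenic_on_laplacian_funpow[OF \<Omega> F])
    show "smooth_on ?\<Omega> (\<lambda>X. axial_lift u X *\<^sub>R R X + axial_lift ?W X *\<^sub>R (vec_x X * (vec_y X * R X)))"
      by (rule smooth_on_add[OF \<Omega> sl[OF cs(1) sR(1)] sl[OF sW(1) sR(4)]])
    show "(laplacian ^^ ?N) (\<lambda>X. axial_lift u X *\<^sub>R R X + axial_lift ?W X *\<^sub>R (vec_x X * (vec_y X * R X))) X =
        axial_lift (M ?U) X *\<^sub>R R X + axial_lift (M ?W\<mu>) X *\<^sub>R (vec_x X * (vec_y X * R X))" if X: "X \<in> ?\<Omega>" for X
    proof -
      have "(laplacian ^^ ?N) (\<lambda>X. axial_lift u X *\<^sub>R R X + axial_lift ?W X *\<^sub>R (vec_x X * (vec_y X * R X))) X =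
          (laplacian ^^ ?N) (\<lambda>X. axial_lift u X *\<^sub>R R X) X +
          (laplacian ^^ ?N) (\<lambda>X. axial_lift ?W X *\<^sub>R (vec_x X * (vec_y X * R X))) X"
        by (rule lap_add[OF sl[OF cs(1) sR(1)] sl[OF sW(1) sR(4)] X])
      also have "\<dots> = axial_lift ((axial_laplacian (real s) (real t) ^^ ?N) u) X *\<^sub>R R X +
          axial_lift ((axial_laplacian (real s + 1) (real t + 1) ^^ ?N) ?W) X *\<^sub>R (vec_x X * (vec_y X * R X))"
        by (rule arg_cong2[where f = "(+)", OF lap(1)[OF cs(1) X] lap(4)[OF sW(1) X]])
      finally show ?thesis by (simp only: axial_lift_def image_u[OF z[OF X]] image_W[OF z[OF X]])
    qed
    show "dirac (\<lambda>X. axial_lift (M ?U) X *\<^sub>R R X + axial_lift (M ?W\<mu>) X *\<^sub>R (vec_x X * (vec_y X * R X))) X = 0"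
      if X: "X \<in> ?\<Omega>" for X
    proof (rule dirac_even_combination[OF R S quadrant smooth_op_smooth[OF M sU] smooth_op_smooth[OF M sW(2)] _ _ X])
      fix z assume z: "z \<in> S"
      note sys = vekua_system_even[OF S quadrant sU sV cs(3,4) z, of s t]
      show "D1 (M ?U) z + (snd z)\<^sup>2 * D2 (M ?W\<mu>) z + (real CARD('q) + 2 * real l) * M ?W\<mu> z = 0"
        using arg_cong[OF sys(1), of "\<lambda>r. c * r"] unfolding st DM[OF sU z] DM[OF sW(2) z]
        by (simp add: M_def algebra_simps)
      show "D2 (M ?U) z - (fst z)\<^sup>2 * D1 (M ?W\<mu>) z - (real CARD('p) + 2 * real k) * M ?W\<mu> z = 0"
        using arg_cong[OF sys(2), of "\<lambda>r. c * r"] unfolding st DM[OF sU z] DM[OF sW(2) z]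
        by (simp add: M_def algebra_simps)
    qed
  qed
  let ?A = "\<lambda>z. u z / fst z" and ?A\<mu> = "\<lambda>z. ?U z / fst z" and ?B = "\<lambda>z. v z / snd z" and ?B\<mu> = "\<lambda>z. ?V z / snd z"
  note sA = sdiv(1)[OF cs(1)] and sA\<mu> = sdiv(1)[OF sU] and sB = sdiv(2)[OF cs(2)] and sB\<mu> = sdiv(2)[OF sV]
  show "monogenic_on ?\<Omega> ((laplacian ^^ ?N) F)"
    if F: "\<And>X. X \<in> ?\<Omega> \<Longrightarrow> F X = axial_lift ?A X *\<^sub>R (vec_x X * R X) + axial_lift ?B X *\<^sub>R (vec_y X * R X)"
  proof (rule monogenic_on_laplacian_funpow[OF \<Omega> F])
    show "smooth_on ?\<Omega> (\<lambda>X. axial_lift ?A X *\<^sub>R (vec_x X * R X) + axial_lift ?B X *\<^sub>R (vec_y X * R X))"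
      by (rule smooth_on_add[OF \<Omega> sl[OF sA sR(2)] sl[OF sB sR(3)]])
    show "(laplacian ^^ ?N) (\<lambda>X. axial_lift ?A X *\<^sub>R (vec_x X * R X) + axial_lift ?B X *\<^sub>R (vec_y X * R X)) X =
        axial_lift (M ?A\<mu>) X *\<^sub>R (vec_x X * R X) + axial_lift (M ?B\<mu>) X *\<^sub>R (vec_y X * R X)" if X: "X \<in> ?\<Omega>" for X
    proof -
      have "(laplacian ^^ ?N) (\<lambda>X. axial_lift ?A X *\<^sub>R (vec_x X * R X) + axial_lift ?B X *\<^sub>R (vec_y X * R X)) X =
          (laplacian ^^ ?N) (\<lambda>X. axial_lift ?A X *\<^sub>R (vec_x X * R X)) X +
          (laplacian ^^ ?N) (\<lambda>X. axial_lift ?B X *\<^sub>R (vec_y X * R X)) X"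
        by (rule lap_add[OF sl[OF sA sR(2)] sl[OF sB sR(3)] X])
      also have "\<dots> = axial_lift ((axial_laplacian (real s + 1) (real t) ^^ ?N) ?A) X *\<^sub>R (vec_x X * R X) +
          axial_lift ((axial_laplacian (real s) (real t + 1) ^^ ?N) ?B) X *\<^sub>R (vec_y X * R X)"
        by (rule arg_cong2[where f = "(+)", OF lap(2)[OF sA X] lap(3)[OF sB X]])
      finally show ?thesis by (simp only: axial_lift_def image_A[OF z[OF X]] image_B[OF z[OF X]])
    qed
    show "dirac (\<lambda>X. axial_lift (M ?A\<mu>) X *\<^sub>R (vec_x X * R X) + axial_lift (M ?B\<mu>) X *\<^sub>R (vec_y X * R X)) X = 0"
      if X: "X \<in> ?\<Omega>" for X
    proof (rule dirac_odd_combination[OF R S quadrant smooth_op_smooth[OF M sA\<mu>] smooth_op_smooth[OF M sB\<mu>] _ _ X])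
      fix z assume z: "z \<in> S"
      note sys = vekua_system_odd[OF S quadrant sU sV cs(3,4) z, of s t]
      show "(fst z)\<^sup>2 * D1 (M ?A\<mu>) z + (real CARD('p) + 2 * real k) * M ?A\<mu> z +
          ((snd z)\<^sup>2 * D2 (M ?B\<mu>) z + (real CARD('q) + 2 * real l) * M ?B\<mu> z) = 0"
        using arg_cong[OF sys(1), of "\<lambda>r. c * r"] unfolding st DM[OF sA\<mu> z] DM[OF sB\<mu> z]
        by (simp add: M_def algebra_simps)
      show "D1 (M ?B\<mu>) z = D2 (M ?A\<mu>) z"
        using sys(2) unfolding DM[OF sA\<mu> z] DM[OF sB\<mu> z] by simp
    qed
  qed
qed

section \<open>Products of homogeneous monogenic polynomials\<close>

lemma homogeneous_polynomial_smooth: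
  fixes P :: "(real, 'n::finite) vec \<Rightarrow> 'b::real_normed_vector"
  assumes "homogeneous_polynomial V k P"
  shows "smooth_on UNIV P"
proof -
  obtain c where c: "P x = (\<Sum>\<alpha> | sum \<alpha> UNIV = k. (\<Prod>j\<in>UNIV. x $ j ^ \<alpha> j) *\<^sub>R c \<alpha>)" for x
    using assms unfolding homogeneous_polynomial_def by blast
  have "smooth_on UNIV (\<lambda>x :: (real, 'n) vec. \<Prod>j\<in>UNIV. x $ j ^ \<alpha> j)" for \<alpha> :: "'n \<Rightarrow> nat"
    unfolding smooth_on_def
    by (intro allI Ck_on_real_prod Ck_on_power Ck_on_bounded_linear bounded_linear_vec_nth open_UNIV)
  then have "smooth_on UNIV (\<lambda>x. \<Sum>\<alpha> | sum \<alpha> UNIV = k. (\<Prod>j\<in>UNIV. x $ j ^ \<alpha> j) *\<^sub>R c \<alpha>)"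
    by (intro smooth_on_sum smooth_on_scaleR smooth_on_const open_UNIV)
  then show ?thesis using c by presburger
qed

lemma homogeneous_polynomial_scaleR:
  assumes "homogeneous_polynomial V k P"
  shows "P (r *\<^sub>R x) = r ^ k *\<^sub>R P x"
proof -
  obtain c where c: "P x = (\<Sum>\<alpha> | sum \<alpha> UNIV = k. (\<Prod>j\<in>UNIV. x $ j ^ \<alpha> j) *\<^sub>R c \<alpha>)" for x
    using assms unfolding homogeneous_polynomial_def by blast
  show ?thesis
    unfolding c scaleR_sum_right
    by (intro sum.cong refl) (auto simp: power_mult_distrib prod.distrib power_sum)
qed

lemma Basis_vec_eq: "(Basis :: (real, 'n::finite) vec set) = range (\<lambda>j. axis j 1)"
  by (auto simp: Basis_vec_def)

text \<open>
  Euler's relation is the derivative of \<open>P ((1 + t) x) = (1 + t)\<^sup>k P x\<close> at \<open>t = 0\<close>.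
\<close>

lemma euler_homogeneous_polynomial:
  fixes P :: "(real, 'n::finite) vec \<Rightarrow> 'b::real_normed_vector"
  assumes P: "homogeneous_polynomial V k P"
  shows "(\<Sum>j\<in>UNIV. x $ j *\<^sub>R pderivative (axis j 1) P x) = real k *\<^sub>R P x"
proof -
  have d: "P differentiable (at x)" by (rule smooth_on_differentiable[OF homogeneous_polynomial_smooth[OF P]]) simp
  have eq: "(\<lambda>t. P (x + t *\<^sub>R x)) = (\<lambda>t. (1 + t) ^ k *\<^sub>R P x)"
    using homogeneous_polynomial_scaleR[OF P, of "1 + _" x] by (simp add: scaleR_add_left)
  have der: "((\<lambda>t. (1 + t) ^ k *\<^sub>R P x) has_vector_derivative real k *\<^sub>R P x) (at 0)"
    by (auto intro!: derivative_eq_intros simp: has_real_derivative_iff_has_vector_derivative[symmetric])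
  have "real k *\<^sub>R P x = pderivative x P x"
    unfolding pderivative_def eq using der by (rule vector_derivative_at[symmetric])
  also have "\<dots> = (\<Sum>j\<in>UNIV. x $ j *\<^sub>R pderivative (axis j 1) P x)"
    unfolding pderivative_eq_sum_Basis[OF d, of x] Basis_vec_eq
    by (subst sum.reindex) (auto simp: inj_on_def axis_eq_axis inner_axis)
  finally show ?thesis ..
qed

lemma homogeneous_polynomial_in_subspace:
  assumes "homogeneous_polynomial V k P" "subspace W" "V \<subseteq> W"
  shows "P x \<in> W"
proof -
  obtain c where c: "\<And>\<alpha>. c \<alpha> \<in> V" "P x = (\<Sum>\<alpha> | sum \<alpha> UNIV = k. (\<Prod>j\<in>UNIV. x $ j ^ \<alpha> j) *\<^sub>R c \<alpha>)" for x
    using assms(1) unfolding homogeneous_polynomial_def by blast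
  show ?thesis unfolding c(2) using c(1) assms(2,3) by (intro subspace_sum subspace_scale) auto
qed

text \<open>
  The elements past which all generators \<open>e\<^sub>p\<^sub>+\<^sub>j\<close> can be moved, with one and the same correction \<open>a'\<close>. On \<open>\<real>\<^sub>p\<close> the
  correction is the main involution, which changes the sign of each generator.
\<close>

definition twisted_commutant :: "('p::{finite,linorder} + 'q::{finite,linorder}) clifford set"
  where "twisted_commutant = {a. \<exists>a'. \<forall>j. gen (Inr j) * a = a' * gen (Inr j)}"

lemma subalgebra_twisted_commutant: "subalgebra (twisted_commutant :: ('p::{finite,linorder} + 'q::{finite,linorder}) clifford set)"
  unfolding subalgebra_def
proof (intro conjI ballI)
  show "subspace (twisted_commutant :: ('p + 'q) clifford set)"
  proof (rule subspaceI)
    show "(0 :: ('p + 'q) clifford) \<in> twisted_commutant"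
      unfolding twisted_commutant_def by (auto intro: exI[of _ 0])
    fix a b :: "('p + 'q) clifford" and r :: real
    assume "a \<in> twisted_commutant"
    then obtain a' where a': "\<forall>j. gen (Inr j) * a = a' * gen (Inr j)" unfolding twisted_commutant_def by blast
    then show "r *\<^sub>R a \<in> twisted_commutant"
      unfolding twisted_commutant_def by (auto intro!: exI[of _ "r *\<^sub>R a'"])
    assume "b \<in> twisted_commutant"
    then obtain b' where "\<forall>j. gen (Inr j) * b = b' * gen (Inr j)" unfolding twisted_commutant_def by blast
    with a' show "a + b \<in> twisted_commutant"
      unfolding twisted_commutant_def by (auto intro!: exI[of _ "a' + b'"] simp: distrib_left distrib_right)
  qed
  show "(1 :: ('p + 'q) clifford) \<in> twisted_commutant"
    unfolding twisted_commutant_def by (auto intro: exI[of _ 1])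
  fix a b :: "('p + 'q) clifford"
  assume "a \<in> twisted_commutant" "b \<in> twisted_commutant"
  then obtain a' b' where a': "\<And>j. gen (Inr j) * a = a' * gen (Inr j)" "\<And>j. gen (Inr j) * b = b' * gen (Inr j)"
    unfolding twisted_commutant_def by blast
  have "gen (Inr j) * (a * b) = (a' * b') * gen (Inr j)" for j
    by (metis a' mult.assoc)
  then show "a * b \<in> twisted_commutant" unfolding twisted_commutant_def by blast
qed

lemma cliff_p_twisted: "cliff_p \<subseteq> twisted_commutant"
  unfolding cliff_p_def
proof (rule hull_minimal[where S = subalgebra, OF _ subalgebra_twisted_commutant])
  have "gen (Inr j) * gen (Inl i) = - gen (Inl i) * gen (Inr j)" for i :: 'a and j :: 'b
    using gen_anticommute[of "Inr j :: 'a + 'b" "Inl i"] by (simp add: eq_neg_iff_add_eq_0)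
  then show "range (\<lambda>j. gen (Inl j)) \<subseteq> (twisted_commutant :: ('a + 'b) clifford set)"
    unfolding twisted_commutant_def by blast
qed

lemma pderivative_compose_linear:
  assumes "bounded_linear L"
  shows "pderivative b (\<lambda>X. P (L X)) X = pderivative (L b) P (L X)"
proof -
  interpret bounded_linear L by fact
  show ?thesis by (simp add: pderivative_def add scaleR)
qed

lemma smooth_on_compose_projection:
  assumes L: "bounded_linear L" "\<And>b. b \<in> Basis \<Longrightarrow> L b \<in> Basis \<or> L b = 0"
    and P: "smooth_on UNIV P"
  shows "smooth_on UNIV (\<lambda>X. P (L X))"
  unfolding smooth_on_def
proof
  fix n show "Ck_on n UNIV (\<lambda>X. P (L X))"
    using P
  proof (induction n arbitrary: P)
    case 0
    then show ?case
      using continuous_on_compose2[OF smooth_on_continuous[OF 0] bounded_linear.continuous_on[OF L(1) continuous_on_id]]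
      by simp
  next
    case (Suc n)
    have "Ck_on n UNIV (pderivative b (\<lambda>X. P (L X)))" if b: "b \<in> Basis" for b
    proof (cases "L b = 0")
      case True
      then have "pderivative b (\<lambda>X. P (L X)) = (\<lambda>_. 0)"
        by (simp add: fun_eq_iff pderivative_compose_linear[OF L(1)]) (simp add: pderivative_def)
      then show ?thesis by (simp add: Ck_on_const)
    next
      case False
      have "pderivative b (\<lambda>X. P (L X)) = (\<lambda>X. pderivative (L b) P (L X))"
        by (simp add: fun_eq_iff pderivative_compose_linear[OF L(1)])
      then show ?thesis using Suc.IH[OF smooth_on_pderivative[OF Suc.prems]] L(2)[OF b] False by simp
    qed
    moreover have "(\<lambda>X. P (L X)) differentiable (at X)" for X
      using differentiable_chain_at[of L X P] smooth_on_differentiable[OF Suc.prems]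
        bounded_linear_imp_differentiable[OF L(1)] by (simp add: o_def)
    ultimately show ?case by simp
  qed
qed

text \<open>
  Only the operator in \<open>y\<close> needs an argument: its generators stand to the left of \<open>P\<close> and reach \<open>Q\<close> after
  being moved past \<open>P x\<close>, which lies in \<open>\<real>\<^sub>p\<close>.
\<close>

lemma bimonogenic_product:
  fixes P :: "(real, 'p) vec \<Rightarrow> ('p::{finite,linorder} + 'q::{finite,linorder}) clifford"
    and Q :: "(real, 'q) vec \<Rightarrow> ('p + 'q) clifford"
  assumes P: "homogeneous_polynomial cliff_p k P" "\<forall>x. dirac_p P x = 0"
    and Q: "homogeneous_polynomial V l Q" "\<forall>y. dirac_q Q y = 0"
  shows "bimonogenic (real k) (real l) (\<lambda>X. P (fst X) * Q (snd X))"
proof -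
  let ?P = "\<lambda>X :: ('p, 'q) biaxial. P (fst X)"
  let ?Q = "\<lambda>X :: ('p, 'q) biaxial. Q (snd X)"
  have sP: "smooth_on UNIV ?P" and sQ: "smooth_on UNIV ?Q"
    by (rule smooth_on_compose_projection[OF bounded_linear_fst _ homogeneous_polynomial_smooth[OF P(1)]]
        smooth_on_compose_projection[OF bounded_linear_snd _ homogeneous_polynomial_smooth[OF Q(1)]];
        auto simp: Basis_prod_def)+
  have zero: "pderivative 0 f x = 0" for f :: "'x::real_normed_vector \<Rightarrow> ('p + 'q) clifford" and x
    by (simp add: pderivative_def)
  have d: "pderivative b (\<lambda>X. P (fst X) * Q (snd X)) X =
      P (fst X) * pderivative (snd b) Q (snd X) + pderivative (fst b) P (fst X) * Q (snd X)" for b X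
    using bounded_bilinear.pderivative_prod[OF bounded_bilinear_clifford_mult
        smooth_on_differentiable[OF sP] smooth_on_differentiable[OF sQ], of X b]
    by (simp add: pderivative_compose_linear bounded_linear_fst bounded_linear_snd)
  show ?thesis
    unfolding bimonogenic_def
  proof (intro conjI allI)
    show "smooth_on UNIV (\<lambda>X. P (fst X) * Q (snd X))"
      by (rule smooth_on_clifford_mult[OF open_UNIV sP sQ])
    fix X :: "('p, 'q) biaxial"
    have "dirac_part (range Inl) (\<lambda>X. P (fst X) * Q (snd X)) X = dirac_p P (fst X) * Q (snd X)"
      by (simp add: dirac_part_def dirac_p_def sum.reindex d zero sum_distrib_right mult.assoc)
    then show "dirac_part (range Inl) (\<lambda>X. P (fst X) * Q (snd X)) X = 0" using P(2) by simp
    have "subspace (twisted_commutant :: ('p + 'q) clifford set)"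
      using subalgebra_twisted_commutant unfolding subalgebra_def by blast
    then have "P (fst X) \<in> twisted_commutant"
      by (rule homogeneous_polynomial_in_subspace[OF P(1) _ cliff_p_twisted])
    then obtain a where a: "\<And>j. gen (Inr j) * P (fst X) = a * gen (Inr j)" unfolding twisted_commutant_def by blast
    have "dirac_part (range Inr) (\<lambda>X. P (fst X) * Q (snd X)) X = (\<Sum>j\<in>UNIV. (gen (Inr j) * P (fst X)) * pderivative (axis j 1) Q (snd X))"
      by (simp add: dirac_part_def sum.reindex d zero mult.assoc)
    also have "\<dots> = a * dirac_q Q (snd X)"
      by (simp add: a dirac_q_def sum_distrib_left mult.assoc)
    finally show "dirac_part (range Inr) (\<lambda>X. P (fst X) * Q (snd X)) X = 0" using Q(2) by simp
    have "euler_part (range Inl) (\<lambda>X. P (fst X) * Q (snd X)) X =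
        (\<Sum>j\<in>UNIV. fst X $ j *\<^sub>R pderivative (axis j 1) P (fst X)) * Q (snd X)"
      by (simp add: euler_part_def sum.reindex d zero sum_distrib_right inner_prod_def inner_axis)
    then show "euler_part (range Inl) (\<lambda>X. P (fst X) * Q (snd X)) X = real k *\<^sub>R (P (fst X) * Q (snd X))"
      by (simp add: euler_homogeneous_polynomial[OF P(1)])
    have "euler_part (range Inr) (\<lambda>X. P (fst X) * Q (snd X)) X =
        P (fst X) * (\<Sum>j\<in>UNIV. snd X $ j *\<^sub>R pderivative (axis j 1) Q (snd X))"
      by (simp add: euler_part_def sum.reindex d zero sum_distrib_left inner_prod_def inner_axis)
    then show "euler_part (range Inr) (\<lambda>X. P (fst X) * Q (snd X)) X = real l *\<^sub>R (P (fst X) * Q (snd X))"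
      by (simp add: euler_homogeneous_polynomial[OF Q(1)])
  qed
qed

theorem theorem3:
  fixes P :: "(real, 'p) vec \<Rightarrow> ('p::{finite,linorder} + 'q::{finite,linorder}) clifford"
    and Q :: "(real, 'q) vec \<Rightarrow> ('p + 'q) clifford"
    and w :: "real \<times> real \<Rightarrow> complex"
    and u v :: "real \<times> real \<Rightarrow> real"
    and \<Xi> :: "(real \<times> real) set"
    and \<mu> k l :: nat
  defines "N \<equiv> \<mu> + k + l + (CARD('p) + CARD('q) - 2) div 2"
    and "\<Omega> \<equiv> {(x :: (real, 'p) vec, y :: (real, 'q) vec). (norm x, norm y) \<in> \<Xi>}"
    and "\<omega> \<equiv> \<lambda>x. vec_p x /\<^sub>R norm x"
    and "\<nu> \<equiv> \<lambda>y. vec_q y /\<^sub>R norm y"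
  assumes "odd CARD('p)" and "odd CARD('q)"
    and "homogeneous_polynomial cliff_p k P" and "\<forall>x. dirac_p P x = 0"
    and "homogeneous_polynomial cliff_q l Q" and "\<forall>y. dirac_q Q y = 0"
    and "open \<Xi>" and "\<Xi> \<subseteq> {(x, y). 0 < x \<and> 0 < y}"
    and "\<forall>z\<in>\<Xi>. w z = of_real (u z) + \<i> * of_real (v z)"
    and "C_on (2 * \<mu> + 1) \<Xi> w"
    and "\<forall>z\<in>\<Xi>. wirtinger ((laplacian ^^ \<mu>) w) z = 0"
  shows "monogenic_on \<Omega> ((laplacian ^^ N) (\<lambda>(x, y).
            (of_real (u (norm x, norm y)) + \<omega> x * \<nu> y * of_real (v (norm x, norm y))) * P x * Q y))
       \<and> monogenic_on \<Omega> ((laplacian ^^ N) (\<lambda>(x, y).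
            (\<omega> x * of_real (u (norm x, norm y)) + \<nu> y * of_real (v (norm x, norm y))) * P x * Q y))"
proof -
  let ?\<Omega> = "axial_domain \<Xi> :: (('p, 'q) biaxial) set"
  define R where "R = (\<lambda>X :: ('p, 'q) biaxial. P (fst X) * Q (snd X))"
  have R: "bimonogenic (real k) (real l) R"
    unfolding R_def by (rule bimonogenic_product[OF assms(7-10)])
  obtain a b where ab: "CARD('p) = 2 * a + 1" "CARD('q) = 2 * b + 1" using assms(5,6) by (auto elim!: oddE)
  have N: "N = \<mu> + (a + k) + (b + l)" by (simp add: N_def ab)
  have st: "real (a + k) = (real CARD('p) - 1) / 2 + k" "real (b + l) = (real CARD('q) - 1) / 2 + l"
    by (simp_all add: ab)
  have \<Omega>: "\<Omega> = ?\<Omega>" by (auto simp: \<Omega>_def axial_domain_def)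
  have w: "\<And>z. z \<in> \<Xi> \<Longrightarrow> w z = of_real (u z) + \<i> * of_real (v z)"
    and w0: "\<And>z. z \<in> \<Xi> \<Longrightarrow> wirtinger ((laplacian ^^ \<mu>) w) z = 0" using assms(13,15) by blast+
  note fueter = fueter_bimonogenic[OF R assms(11,12) w assms(14) w0 st, folded N, folded \<Omega>]
  have vec: "vec_p x = vec_x (x, y)" "vec_q y = vec_y (x, y)" for x :: "(real, 'p) vec" and y :: "(real, 'q) vec"
    using vec_p_eq_vec_part[of "(x, y)"] vec_q_eq_vec_part[of "(x, y)"] by simp_all
  show ?thesis
  proof (rule conjI[OF fueter])
    fix X assume "X \<in> \<Omega>"
    obtain x y where X: "X = (x, y)" by (cases X)
    show "(\<lambda>(x, y). (of_real (u (norm x, norm y)) + \<omega> x * \<nu> y * of_real (v (norm x, norm y))) * P x * Q y) X =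
        axial_lift u X *\<^sub>R R X + axial_lift (\<lambda>z. v z / fst z / snd z) X *\<^sub>R (vec_x X * (vec_y X * R X))"
      by (simp add: X \<omega>_def \<nu>_def R_def axial_lift_def of_real_def vec[where x = x and y = y] distrib_right mult.assoc divide_inverse mult_ac)
    show "(\<lambda>(x, y). (\<omega> x * of_real (u (norm x, norm y)) + \<nu> y * of_real (v (norm x, norm y))) * P x * Q y) X =
        axial_lift (\<lambda>z. u z / fst z) X *\<^sub>R (vec_x X * R X) + axial_lift (\<lambda>z. v z / snd z) X *\<^sub>R (vec_y X * R X)"
      by (simp add: X \<omega>_def \<nu>_def R_def axial_lift_def of_real_def vec[where x = x and y = y] distrib_right mult.assoc divide_inverse mult_ac)
  qed
qed

end
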